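(* Let $(R,\mathfrak{m})$ be an $F$-finite local domain of characteristic $p>0$. If $S$ is a solid $R$-algebra, then $S$ is a phantom extension of $R$ (via the structure map $\alpha:R\to S$) with respect to tight closure defined for all $R$-modules.
   Context: All rings are commutative; a local ring is a Noetherian local ring. A reduced ring $R$ of characteristic $p$ is $F$-finite if $R\to R^{1/p}$ is a module-finite extension. An $R$-module $M$ is solid if $\mathrm{Hom}_R(M,R)\neq 0$; an $R$-algebra is solid if it is solid as an $R$-module (equivalently, there is an $R$-linear $\gamma:S\to R$ with $\gamma(1)\neq 0$). Over a local domain $R$ the structure map of a solid $R$-algebra is injective. Tight closure: let $\mathcal{F}^e$ be the $e$-th iterate of the Frobenius functor on $R$-modules (base change along the $e$-th iterate of the Frobenius endomorphism of $R$), $q=p^e$. For arbitrary $R$-modules $N\subseteq M$ let $N_M^{[q]}=\mathrm{Im}(\mathcal{F}^e(N)\to\mathcal{F}^e(M))$, and for $u\in M$ let $u^q=1\otimes u\in\mathcal{F}^e(M)$. Then $u\in N_M^*$ if and only if there exists $c\neq0$ in $R$ such that $cu^q\in N_M^{[q]}$ for all $e\ge0$. Phantom extensions with respect to tight closure: write $(-)^\vee=\mathrm{Hom}_R(-,R)$. Given an injection $\alpha:R\to M$ of $R$-modules, let $0\to R\xrightarrow{\alpha}M\xrightarrow{\beta}Q\to 0$ be the resulting short exact sequence. Choose a free presentation $G\xrightarrow{\nu}F\xrightarrow{\mu}Q\to 0$ ($F,G$ free, possibly of infinite rank) and a lift $\tilde\mu:F\to M$ with $\beta\circ\tilde\mu=\mu$,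 and let $\tilde\nu=\alpha^{-1}\circ\tilde\mu\circ\nu:G\to R$ (well defined since $\tilde\mu\circ\nu$ maps into $\mathrm{Im}\,\alpha$). Let $\nu^\vee:F^\vee\to G^\vee$, $h\mapsto h\circ\nu$. Then $M$ is a phantom extension of $R$ via $\alpha$ if $\tilde\nu\in(\mathrm{Im}\,\nu^\vee)^{*}_{G^\vee}$; this does not depend on the choices of free presentation and lift. *)

theory Defs
  imports "HOL-Algebra.Module" "HOL-Algebra.Ring_Divisibility"
begin

section \<open>Modules\<close>

text \<open>
  In HOL-Algebra a module is a record that extends the ring record.  The fields \<open>mult\<close> and \<open>one\<close>
  play no role for a module that is not an algebra; they are left undefined below.
\<close>

definition ring_mod :: "('a, 'c) ring_scheme \<Rightarrow> ('a, 'a) module" where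
  "ring_mod R = \<lparr>carrier = carrier R, mult = mult R, one = one R, zero = zero R, add = add R,
     smult = mult R\<rparr>"

definition mod_hom :: "('a, 'c) ring_scheme \<Rightarrow> ('a, 'm) module \<Rightarrow> ('a, 'n) module \<Rightarrow> ('m \<Rightarrow> 'n) set" where
  "mod_hom R M N = {f \<in> carrier M \<rightarrow> carrier N.
     (\<forall>x\<in>carrier M. \<forall>y\<in>carrier M. f (x \<oplus>\<^bsub>M\<^esub> y) = f x \<oplus>\<^bsub>N\<^esub> f y) \<and>
     (\<forall>a\<in>carrier R. \<forall>x\<in>carrier M. f (a \<odot>\<^bsub>M\<^esub> x) = a \<odot>\<^bsub>N\<^esub> f x)}"

text \<open>The dual \<open>Hom\<^sub>R(M, R)\<close>; its elements are extensional, so that equality is equality on \<open>M\<close>.\<close>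

definition dual_mod :: "('a, 'c) ring_scheme \<Rightarrow> ('a, 'm) module \<Rightarrow> ('a, 'm \<Rightarrow> 'a) module" where
  "dual_mod R M = \<lparr>carrier = mod_hom R M (ring_mod R) \<inter> extensional (carrier M),
     mult = undefined, one = undefined,
     zero = (\<lambda>x\<in>carrier M. \<zero>\<^bsub>R\<^esub>),
     add = (\<lambda>f g. \<lambda>x\<in>carrier M. f x \<oplus>\<^bsub>R\<^esub> g x),
     smult = (\<lambda>a f. \<lambda>x\<in>carrier M. a \<otimes>\<^bsub>R\<^esub> f x)\<rparr>"

definition solid :: "('a, 'c) ring_scheme \<Rightarrow> ('a, 'm) module \<Rightarrow> bool" where
  "solid R M \<longleftrightarrow> carrier (dual_mod R M) \<noteq> {\<zero>\<^bsub>dual_mod R M\<^esub>}"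

text \<open>\<open>M/N\<close>, carried by the cosets of \<open>N\<close>.\<close>

definition quot_mod :: "('a, 'm) module \<Rightarrow> 'm set \<Rightarrow> ('a, 'm set) module" where
  "quot_mod M N = \<lparr>carrier = a_rcosets\<^bsub>M\<^esub> N, mult = undefined, one = undefined,
     zero = N, add = (\<lambda>X Y. X <+>\<^bsub>M\<^esub> Y),
     smult = (\<lambda>a X. \<Union>x\<in>X. N +>\<^bsub>M\<^esub> (a \<odot>\<^bsub>M\<^esub> x))\<rparr>"

definition submod_gen :: "('a, 'c) ring_scheme \<Rightarrow> ('a, 'm) module \<Rightarrow> 'm set \<Rightarrow> 'm set" where
  "submod_gen R M X = \<Inter>{H. submodule H R M \<and> X \<subseteq> H}"

text \<open>The free module \<open>R\<^sup>(\<^sup>I\<^sup>)\<close> of finitely supported families.\<close>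

definition free_mod :: "('a, 'c) ring_scheme \<Rightarrow> 'i set \<Rightarrow> ('a, 'i \<Rightarrow> 'a) module" where
  "free_mod R I = \<lparr>carrier = {c. (\<forall>i. c i \<in> carrier R) \<and> (\<forall>i. i \<notin> I \<longrightarrow> c i = \<zero>\<^bsub>R\<^esub>) \<and>
       finite {i. c i \<noteq> \<zero>\<^bsub>R\<^esub>}},
     mult = undefined, one = undefined,
     zero = (\<lambda>_. \<zero>\<^bsub>R\<^esub>),
     add = (\<lambda>c d i. c i \<oplus>\<^bsub>R\<^esub> d i),
     smult = (\<lambda>a c i. a \<otimes>\<^bsub>R\<^esub> c i)\<rparr>"

definition unit_vec :: "('a, 'c) ring_scheme \<Rightarrow> 'i \<Rightarrow> 'i \<Rightarrow> 'a" where
  "unit_vec R i = (\<lambda>j. if j = i then \<one>\<^bsub>R\<^esub> else \<zero>\<^bsub>R\<^esub>)"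

definition lin_comb :: "('a, 'c) ring_scheme \<Rightarrow> ('a, 'm) module \<Rightarrow> ('i \<Rightarrow> 'm) \<Rightarrow> ('i \<Rightarrow> 'a) \<Rightarrow> 'm" where
  "lin_comb R M v c = (\<Oplus>\<^bsub>M\<^esub>i\<in>{i. c i \<noteq> \<zero>\<^bsub>R\<^esub>}. c i \<odot>\<^bsub>M\<^esub> v i)"

definition is_basis :: "('a, 'c) ring_scheme \<Rightarrow> ('a, 'm) module \<Rightarrow> 'm set \<Rightarrow> bool" where
  "is_basis R M B \<longleftrightarrow> B \<subseteq> carrier M \<and>
     bij_betw (lin_comb R M (\<lambda>b. b)) (carrier (free_mod R B)) (carrier M)"

definition free_module :: "('a, 'c) ring_scheme \<Rightarrow> ('a, 'm) module \<Rightarrow> bool" where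
  "free_module R M \<longleftrightarrow> module R M \<and> (\<exists>B. is_basis R M B)"

text \<open>\<open>G \<longlongrightarrow>\<^sub>\<nu> F \<longlongrightarrow>\<^sub>\<mu> Q \<longlongrightarrow> 0\<close> is exact with \<open>F\<close>, \<open>G\<close> free.\<close>

definition free_presentation :: "('a, 'c) ring_scheme \<Rightarrow> ('a, 'q) module \<Rightarrow> ('a, 'f) module \<Rightarrow>
    ('a, 'g) module \<Rightarrow> ('f \<Rightarrow> 'q) \<Rightarrow> ('g \<Rightarrow> 'f) \<Rightarrow> bool" where
  "free_presentation R Q F G \<mu> \<nu> \<longleftrightarrow> free_module R F \<and> free_module R G \<and>
     \<mu> \<in> mod_hom R F Q \<and> \<nu> \<in> mod_hom R G F \<and>
     \<mu> ` carrier F = carrier Q \<and> \<nu> ` carrier G = {x \<in> carrier F. \<mu> x = \<zero>\<^bsub>Q\<^esub>}"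


section \<open>The Frobenius functor and tight closure\<close>

text \<open>
  The base change \<open>A \<otimes>\<^sub>R M\<close> of an \<open>R\<close>-module \<open>M\<close> along a ring homomorphism \<open>\<phi> : R \<rightarrow> A\<close> is the
  \<open>A\<close>-module with generators \<open>1 \<otimes> x\<close> (\<open>x \<in> M\<close>) and relations
  \<open>1 \<otimes> (x + y) = 1 \<otimes> x + 1 \<otimes> y\<close> and \<open>1 \<otimes> r x = \<phi>(r) (1 \<otimes> x)\<close>.
  The element \<open>a \<otimes> x\<close> is \<open>a (1 \<otimes> x)\<close>.
\<close>

definition base_change_rels :: "('a, 'c) ring_scheme \<Rightarrow> ('b, 'd) ring_scheme \<Rightarrow> ('a \<Rightarrow> 'b) \<Rightarrow>
    ('a, 'm) module \<Rightarrow> ('m \<Rightarrow> 'b) set" where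
  "base_change_rels R A \<phi> M = submod_gen A (free_mod A (carrier M))
    ({unit_vec A (x \<oplus>\<^bsub>M\<^esub> y) \<ominus>\<^bsub>free_mod A (carrier M)\<^esub>
        (unit_vec A x \<oplus>\<^bsub>free_mod A (carrier M)\<^esub> unit_vec A y) | x y. x \<in> carrier M \<and> y \<in> carrier M} \<union>
     {unit_vec A (r \<odot>\<^bsub>M\<^esub> x) \<ominus>\<^bsub>free_mod A (carrier M)\<^esub>
        (\<phi> r \<odot>\<^bsub>free_mod A (carrier M)\<^esub> unit_vec A x) | r x. r \<in> carrier R \<and> x \<in> carrier M})"

definition base_change :: "('a, 'c) ring_scheme \<Rightarrow> ('b, 'd) ring_scheme \<Rightarrow> ('a \<Rightarrow> 'b) \<Rightarrow>
    ('a, 'm) module \<Rightarrow> ('b, ('m \<Rightarrow> 'b) set) module" where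
  "base_change R A \<phi> M = quot_mod (free_mod A (carrier M)) (base_change_rels R A \<phi> M)"

definition frob :: "('a, 'c) ring_scheme \<Rightarrow> nat \<Rightarrow> nat \<Rightarrow> 'a \<Rightarrow> 'a" where
  "frob R p e r = r [^]\<^bsub>R\<^esub> (p ^ e)"

definition frob_functor :: "('a, 'c) ring_scheme \<Rightarrow> nat \<Rightarrow> nat \<Rightarrow> ('a, 'm) module \<Rightarrow>
    ('a, ('m \<Rightarrow> 'a) set) module" where
  "frob_functor R p e M = base_change R R (frob R p e) M"

text \<open>\<open>u\<^sup>q = 1 \<otimes> u\<close>.\<close>

definition frob_elt :: "('a, 'c) ring_scheme \<Rightarrow> nat \<Rightarrow> nat \<Rightarrow> ('a, 'm) module \<Rightarrow> 'm \<Rightarrow> ('m \<Rightarrow> 'a) set" where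
  "frob_elt R p e M u =
     base_change_rels R R (frob R p e) M +>\<^bsub>free_mod R (carrier M)\<^esub> unit_vec R u"

text \<open>
  The image of \<open>\<F>\<^sup>e(N) \<rightarrow> \<F>\<^sup>e(M)\<close>.  A formal combination of elements of \<open>N\<close> is (extended by zero)
  one of elements of \<open>M\<close>, and the map sends its class modulo the relations of \<open>N\<close> to its class modulo
  the relations of \<open>M\<close>, i.e. it enlarges a coset \<open>X\<close> by adding the latter relations.
\<close>

definition frob_power :: "('a, 'c) ring_scheme \<Rightarrow> nat \<Rightarrow> nat \<Rightarrow> ('a, 'm) module \<Rightarrow> 'm set \<Rightarrow>
    ('m \<Rightarrow> 'a) set set" where
  "frob_power R p e M N =
     (\<lambda>X. base_change_rels R R (frob R p e) M <+>\<^bsub>free_mod R (carrier M)\<^esub> X)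
       ` carrier (frob_functor R p e (M\<lparr>carrier := N\<rparr>))"

definition tight_closure :: "('a, 'c) ring_scheme \<Rightarrow> nat \<Rightarrow> ('a, 'm) module \<Rightarrow> 'm set \<Rightarrow> 'm set" where
  "tight_closure R p M N = {u \<in> carrier M. \<exists>c\<in>carrier R - {\<zero>\<^bsub>R\<^esub>}. \<forall>e.
     c \<odot>\<^bsub>frob_functor R p e M\<^esub> frob_elt R p e M u \<in> frob_power R p e M N}"


section \<open>Local and F-finite rings\<close>

definition noetherian_local_ring :: "('a, 'c) ring_scheme \<Rightarrow> 'a set \<Rightarrow> bool" where
  "noetherian_local_ring R \<mm> \<longleftrightarrow> cring R \<and> noetherian_ring R \<and> maximalideal \<mm> R \<and>
     (\<forall>I. maximalideal I R \<longrightarrow> I = \<mm>)"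

definition has_char :: "('a, 'c) ring_scheme \<Rightarrow> nat \<Rightarrow> bool" where
  "has_char R p \<longleftrightarrow> (\<forall>n::nat. [n] \<cdot>\<^bsub>R\<^esub> \<one>\<^bsub>R\<^esub> = \<zero>\<^bsub>R\<^esub> \<longleftrightarrow> p dvd n)"

definition reduced_ring :: "('a, 'c) ring_scheme \<Rightarrow> bool" where
  "reduced_ring R \<longleftrightarrow> cring R \<and>
     (\<forall>x\<in>carrier R. \<forall>n::nat. x [^]\<^bsub>R\<^esub> n = \<zero>\<^bsub>R\<^esub> \<longrightarrow> x = \<zero>\<^bsub>R\<^esub>)"

text \<open>
  \<open>T\<close> is the ring \<open>R\<^sup>1\<^sup>/\<^sup>p\<close> of all \<open>p\<close>-th roots of elements of the reduced ring \<open>R\<close> of characteristic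
  \<open>p\<close>, and \<open>\<iota>\<close> is the inclusion \<open>R \<rightarrow> R\<^sup>1\<^sup>/\<^sup>p\<close>.  This determines \<open>(T, \<iota>)\<close> up to a unique isomorphism,
  since \<open>p\<close>-th roots are unique in a reduced ring of characteristic \<open>p\<close>.
\<close>

definition is_pth_root_ring :: "('a, 'c) ring_scheme \<Rightarrow> nat \<Rightarrow> 'b ring \<Rightarrow> ('a \<Rightarrow> 'b) \<Rightarrow> bool" where
  "is_pth_root_ring R p T \<iota> \<longleftrightarrow> reduced_ring T \<and> \<iota> \<in> ring_hom R T \<and> inj_on \<iota> (carrier R) \<and>
     (\<forall>t\<in>carrier T. t [^]\<^bsub>T\<^esub> p \<in> \<iota> ` carrier R) \<and>
     (\<forall>r\<in>carrier R. \<exists>t\<in>carrier T. t [^]\<^bsub>T\<^esub> p = \<iota> r)"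

definition module_finite_hom :: "('a, 'c) ring_scheme \<Rightarrow> ('b, 'd) ring_scheme \<Rightarrow> ('a \<Rightarrow> 'b) \<Rightarrow> bool" where
  "module_finite_hom R T \<iota> \<longleftrightarrow> (\<exists>X. finite X \<and> X \<subseteq> carrier T \<and>
     (\<forall>t\<in>carrier T. \<exists>c\<in>X \<rightarrow> carrier R. t = (\<Oplus>\<^bsub>T\<^esub>x\<in>X. \<iota> (c x) \<otimes>\<^bsub>T\<^esub> x)))"

text \<open>
  The type of the elements of \<open>R\<^sup>1\<^sup>/\<^sup>p\<close> is no restriction: the ring \<open>R\<close> itself, with the Frobenius
  endomorphism as inclusion, is a model.
\<close>

definition F_finite :: "('a, 'c) ring_scheme \<Rightarrow> nat \<Rightarrow> bool" where
  "F_finite R p \<longleftrightarrow> reduced_ring R \<and> has_char R p \<and>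
     (\<exists>(T::'a ring) \<iota>. is_pth_root_ring R p T \<iota> \<and> module_finite_hom R T \<iota>)"


section \<open>Phantom extensions\<close>

text \<open>
  In the definition below \<open>Q = M / \<alpha>(R)\<close>, the map \<open>\<beta> : M \<rightarrow> Q\<close> is \<open>x \<mapsto> \<alpha>(R) + x\<close>,
  and \<open>\<mu>'\<close> is the lift of \<open>\<mu>\<close>.  The condition
  does not depend on the free presentation and the lift, and is required for all of them.  A type
  quantified over in a definition has to be fixed; the types of \<open>F\<close> and \<open>G\<close> are those of a free module
  on the elements of \<open>M\<close> and of a free module on the elements of the former, so that
  presentations exist (lemma \<open>free_presentation_exists\<close>).
\<close>

definition phantom_extension :: "('a, 'c) ring_scheme \<Rightarrow> nat \<Rightarrow> ('a, 'm) module \<Rightarrow> ('a \<Rightarrow> 'm) \<Rightarrow> bool" where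
  "phantom_extension R p M \<alpha> \<longleftrightarrow> \<alpha> \<in> mod_hom R (ring_mod R) M \<and> inj_on \<alpha> (carrier R) \<and>
     (\<forall>(F :: ('a, 'm \<Rightarrow> 'a) module) (G :: ('a, ('m \<Rightarrow> 'a) \<Rightarrow> 'a) module) \<mu> \<nu> \<mu>'.
        free_presentation R (quot_mod M (\<alpha> ` carrier R)) F G \<mu> \<nu> \<and>
        \<mu>' \<in> mod_hom R F M \<and> (\<forall>x\<in>carrier F. (\<alpha> ` carrier R) +>\<^bsub>M\<^esub> \<mu>' x = \<mu> x) \<longrightarrow>
        (\<lambda>g\<in>carrier G. inv_into (carrier R) \<alpha> (\<mu>' (\<nu> g)))
          \<in> tight_closure R p (dual_mod R G)
              ((\<lambda>h. compose (carrier G) h \<nu>) ` carrier (dual_mod R F)))"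

definition structure_map :: "('a, 's) module \<Rightarrow> 'a \<Rightarrow> 's" where
  "structure_map S r = r \<odot>\<^bsub>S\<^esub> \<one>\<^bsub>S\<^esub>"


section \<open>Existence of free presentations\<close>

lemma free_mod_simps:
  "c \<in> carrier (free_mod R I) \<longleftrightarrow> (\<forall>i. c i \<in> carrier R) \<and> (\<forall>i. i \<notin> I \<longrightarrow> c i = \<zero>\<^bsub>R\<^esub>) \<and>
       finite {i. c i \<noteq> \<zero>\<^bsub>R\<^esub>}"
  "\<zero>\<^bsub>free_mod R I\<^esub> = (\<lambda>_. \<zero>\<^bsub>R\<^esub>)"
  "c \<oplus>\<^bsub>free_mod R I\<^esub> d = (\<lambda>i. c i \<oplus>\<^bsub>R\<^esub> d i)"
  "a \<odot>\<^bsub>free_mod R I\<^esub> c = (\<lambda>i. a \<otimes>\<^bsub>R\<^esub> c i)"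
  by (auto simp: free_mod_def)

lemma free_mod_module:
  fixes R :: "('a, 'c) ring_scheme" (structure) and I :: "'i set"
  assumes "cring R" shows "module R (free_mod R I)"
proof -
  interpret cring R by fact
  have fin_add: "finite {i. c i \<oplus> d i \<noteq> \<zero>}"
    if "finite {i. c i \<noteq> \<zero>}" "finite {i. d i \<noteq> \<zero>}" for c d :: "'i \<Rightarrow> 'a"
  proof (rule finite_subset[of _ "{i. c i \<noteq> \<zero>} \<union> {i. d i \<noteq> \<zero>}"])
    show "{i. c i \<oplus> d i \<noteq> \<zero>} \<subseteq> {i. c i \<noteq> \<zero>} \<union> {i. d i \<noteq> \<zero>}" by auto
  qed (use that in auto)
  have fin_smult: "finite {i. a \<otimes> c i \<noteq> \<zero>}"
    if "finite {i. c i \<noteq> \<zero>}" "a \<in> carrier R" for a and c :: "'i \<Rightarrow> 'a"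
  proof (rule finite_subset[OF _ that(1)])
    show "{i. a \<otimes> c i \<noteq> \<zero>} \<subseteq> {i. c i \<noteq> \<zero>}" using that by auto
  qed
  have ag: "abelian_group (free_mod R I)"
  proof (rule abelian_groupI)
    fix c assume c: "c \<in> carrier (free_mod R I)"
    have "{i. \<ominus> c i \<noteq> \<zero>} \<subseteq> {i. c i \<noteq> \<zero>}" by auto
    then have "finite {i. \<ominus> c i \<noteq> \<zero>}" using c finite_subset by (auto simp: free_mod_simps)
    then show "\<exists>y\<in>carrier (free_mod R I). y \<oplus>\<^bsub>free_mod R I\<^esub> c = \<zero>\<^bsub>free_mod R I\<^esub>"
      using c by (intro bexI[of _ "\<lambda>i. \<ominus> c i"]) (auto simp: free_mod_simps l_neg)
  qed (auto simp: free_mod_simps a_ac fin_add)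
  show ?thesis
    by (rule moduleI[OF assms ag])
       (auto simp: free_mod_simps fin_smult l_distr r_distr m_assoc)
qed

lemma lin_comb_superset:
  assumes "module R M" "finite A" "{i. c i \<noteq> \<zero>\<^bsub>R\<^esub>} \<subseteq> A" "\<And>i. c i \<in> carrier R"
    "\<And>i. i \<in> A \<Longrightarrow> v i \<in> carrier M"
  shows "lin_comb R M v c = (\<Oplus>\<^bsub>M\<^esub>i\<in>A. c i \<odot>\<^bsub>M\<^esub> v i)"
proof -
  interpret module R M by fact
  show ?thesis unfolding lin_comb_def
    using assms(2-5) by (intro M.add.finprod_mono_neutral_cong_left) auto
qed

lemma lin_comb_mod_hom:
  assumes "module R M" "v \<in> I \<rightarrow> carrier M"
  shows "lin_comb R M v \<in> mod_hom R (free_mod R I) M"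
proof -
  interpret module R M by fact
  have supp: "{i. c i \<noteq> \<zero>\<^bsub>R\<^esub>} \<subseteq> I" if "c \<in> carrier (free_mod R I)" for c
    using that by (auto simp: free_mod_simps)
  have v: "v i \<in> carrier M" if "i \<in> I" for i using assms(2) that by auto
  show ?thesis unfolding mod_hom_def
  proof (intro CollectI conjI ballI funcsetI)
    fix c assume c: "c \<in> carrier (free_mod R I)"
    show "lin_comb R M v c \<in> carrier M" unfolding lin_comb_def
      using c supp[OF c] v by (intro M.finsum_closed) (auto simp: free_mod_simps)
  next
    fix c d assume c: "c \<in> carrier (free_mod R I)" and d: "d \<in> carrier (free_mod R I)"
    let ?A = "{i. c i \<noteq> \<zero>\<^bsub>R\<^esub>} \<union> {i. d i \<noteq> \<zero>\<^bsub>R\<^esub>}"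
    have fin: "finite ?A" using c d by (auto simp: free_mod_simps)
    have A: "?A \<subseteq> I" using supp c d by blast
    have R: "c i \<in> carrier R" "d i \<in> carrier R" for i using c d by (auto simp: free_mod_simps)
    have vA: "v i \<in> carrier M" if "i \<in> ?A" for i using that A v by blast
    have "lin_comb R M v (\<lambda>i. c i \<oplus>\<^bsub>R\<^esub> d i) = (\<Oplus>\<^bsub>M\<^esub>i\<in>?A. (c i \<oplus>\<^bsub>R\<^esub> d i) \<odot>\<^bsub>M\<^esub> v i)"
      by (rule lin_comb_superset[OF assms(1) fin]) (use R vA in auto)
    also have "\<dots> = (\<Oplus>\<^bsub>M\<^esub>i\<in>?A. c i \<odot>\<^bsub>M\<^esub> v i \<oplus>\<^bsub>M\<^esub> d i \<odot>\<^bsub>M\<^esub> v i)"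
      using R vA by (intro M.finsum_cong') (auto simp: smult_l_distr)
    also have "\<dots> = (\<Oplus>\<^bsub>M\<^esub>i\<in>?A. c i \<odot>\<^bsub>M\<^esub> v i) \<oplus>\<^bsub>M\<^esub> (\<Oplus>\<^bsub>M\<^esub>i\<in>?A. d i \<odot>\<^bsub>M\<^esub> v i)"
      using R vA by (intro M.finsum_addf) auto
    also have "\<dots> = lin_comb R M v c \<oplus>\<^bsub>M\<^esub> lin_comb R M v d"
      using R vA fin by (subst (1 2) lin_comb_superset[OF assms(1) fin]) auto
    finally show "lin_comb R M v (c \<oplus>\<^bsub>free_mod R I\<^esub> d) = lin_comb R M v c \<oplus>\<^bsub>M\<^esub> lin_comb R M v d"
      by (simp add: free_mod_simps)
  next
    fix a c assume a: "a \<in> carrier R" and c: "c \<in> carrier (free_mod R I)"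
    let ?A = "{i. c i \<noteq> \<zero>\<^bsub>R\<^esub>}"
    have fin: "finite ?A" using c by (auto simp: free_mod_simps)
    have R: "c i \<in> carrier R" for i using c by (auto simp: free_mod_simps)
    have vA: "v i \<in> carrier M" if "i \<in> ?A" for i using that supp[OF c] v by blast
    have "lin_comb R M v (\<lambda>i. a \<otimes>\<^bsub>R\<^esub> c i) = (\<Oplus>\<^bsub>M\<^esub>i\<in>?A. (a \<otimes>\<^bsub>R\<^esub> c i) \<odot>\<^bsub>M\<^esub> v i)"
      by (rule lin_comb_superset[OF assms(1) fin]) (use R vA a in auto)
    also have "\<dots> = (\<Oplus>\<^bsub>M\<^esub>i\<in>?A. a \<odot>\<^bsub>M\<^esub> (c i \<odot>\<^bsub>M\<^esub> v i))"
      using R vA a by (intro M.finsum_cong') (auto simp: smult_assoc1)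
    also have "\<dots> = a \<odot>\<^bsub>M\<^esub> lin_comb R M v c" unfolding lin_comb_def
      using R vA a fin by (intro finsum_smult_ldistr[symmetric]) auto
    finally show "lin_comb R M v (a \<odot>\<^bsub>free_mod R I\<^esub> c) = a \<odot>\<^bsub>M\<^esub> lin_comb R M v c"
      by (simp add: free_mod_simps)
  qed
qed

lemma unit_vec_closed:
  assumes "cring R" "i \<in> I" shows "unit_vec R i \<in> carrier (free_mod R I)"
proof -
  interpret cring R by fact
  have "{j. unit_vec R i j \<noteq> \<zero>\<^bsub>R\<^esub>} \<subseteq> {i}" by (auto simp: unit_vec_def)
  then have "finite {j. unit_vec R i j \<noteq> \<zero>\<^bsub>R\<^esub>}" using finite_subset by blast
  then show ?thesis using assms(2) by (auto simp: free_mod_simps unit_vec_def)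
qed

lemma lin_comb_unit_vec:
  assumes "module R M" "v i \<in> carrier M" "\<one>\<^bsub>R\<^esub> \<noteq> \<zero>\<^bsub>R\<^esub>"
  shows "lin_comb R M v (unit_vec R i) = v i"
proof -
  interpret module R M by fact
  have "{j. unit_vec R i j \<noteq> \<zero>\<^bsub>R\<^esub>} = {i}" using assms(3) by (auto simp: unit_vec_def)
  then show ?thesis using assms(2) by (simp add: lin_comb_def unit_vec_def)
qed

lemma free_mod_finsum:
  assumes "cring R" "finite A" "\<And>b. b \<in> A \<Longrightarrow> f b \<in> carrier (free_mod R I)"
  shows "(\<Oplus>\<^bsub>free_mod R I\<^esub>b\<in>A. f b) i = (\<Oplus>\<^bsub>R\<^esub>b\<in>A. f b i)"
proof -
  interpret cring R by fact
  interpret F: module R "free_mod R I" by (rule free_mod_module) fact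
  show ?thesis using assms(2,3)
  proof (induction A rule: finite_induct)
    case empty then show ?case by (simp add: free_mod_simps)
  next
    case (insert b A)
    have "f b i \<in> carrier R" "(\<lambda>b. f b i) \<in> A \<rightarrow> carrier R"
      using insert by (auto simp: free_mod_simps)
    then show ?case using insert
      by (subst F.M.finsum_insert) (auto simp: free_mod_simps)
  qed
qed

lemma free_module_free_mod:
  assumes "cring R" "\<one>\<^bsub>R\<^esub> \<noteq> \<zero>\<^bsub>R\<^esub>"
  shows "free_module R (free_mod R I)"
proof -
  interpret cring R by fact
  have mod: "module R (free_mod R I)" by (rule free_mod_module) fact
  interpret F: module R "free_mod R I" by fact
  define B where "B = unit_vec R ` I"
  have inj: "unit_vec R i = unit_vec R j \<longleftrightarrow> i = j" for i j :: 'c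
    using assms(2) by (auto simp: unit_vec_def fun_eq_iff)
  have B: "B \<subseteq> carrier (free_mod R I)" using unit_vec_closed[OF assms(1)] by (auto simp: B_def)
  have hom: "lin_comb R (free_mod R I) (\<lambda>b. b) \<in> mod_hom R (free_mod R B) (free_mod R I)"
    by (rule lin_comb_mod_hom[OF mod]) (use B in auto)
  have eval: "lin_comb R (free_mod R I) (\<lambda>b. b) c i = (if i \<in> I then c (unit_vec R i) else \<zero>\<^bsub>R\<^esub>)"
    if c: "c \<in> carrier (free_mod R B)" for c i
  proof -
    let ?S = "{b. c b \<noteq> \<zero>\<^bsub>R\<^esub>}"
    have fin: "finite ?S" and S: "?S \<subseteq> B" and R: "\<And>b. c b \<in> carrier R"
      using c by (auto simp: free_mod_simps)
    have uR: "b i \<in> carrier R" if "b \<in> B" for b using that B by (auto simp: free_mod_simps)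
    have "c b \<odot>\<^bsub>free_mod R I\<^esub> b \<in> carrier (free_mod R I)" if "b \<in> ?S" for b
      using F.smult_closed R S B that by blast
    then have "lin_comb R (free_mod R I) (\<lambda>b. b) c i = (\<Oplus>\<^bsub>R\<^esub>b\<in>?S. (c b \<odot>\<^bsub>free_mod R I\<^esub> b) i)"
      unfolding lin_comb_def by (rule free_mod_finsum[OF assms(1) fin])
    also have "\<dots> = (\<Oplus>\<^bsub>R\<^esub>b\<in>?S. c b \<otimes>\<^bsub>R\<^esub> b i)" by (simp add: free_mod_simps)
    also have "\<dots> = (if i \<in> I then c (unit_vec R i) else \<zero>\<^bsub>R\<^esub>)"
    proof (cases "i \<in> I \<and> unit_vec R i \<in> ?S")
      case True
      have "(\<Oplus>\<^bsub>R\<^esub>b\<in>?S. c b \<otimes>\<^bsub>R\<^esub> b i) = (\<Oplus>\<^bsub>R\<^esub>b\<in>{unit_vec R i}. c b \<otimes>\<^bsub>R\<^esub> b i)"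
      proof (rule add.finprod_mono_neutral_cong_right[OF fin])
        show "c b \<otimes>\<^bsub>R\<^esub> b i = \<zero>\<^bsub>R\<^esub>" if b: "b \<in> ?S - {unit_vec R i}" for b
        proof -
          from b obtain j where "b = unit_vec R j" "j \<noteq> i" using S by (auto simp: B_def)
          then have "b i = \<zero>\<^bsub>R\<^esub>" by (simp add: unit_vec_def)
          then show "c b \<otimes>\<^bsub>R\<^esub> b i = \<zero>\<^bsub>R\<^esub>" using R by simp
        qed
      qed (use True R uR S in auto)
      also have "\<dots> = c (unit_vec R i)" using R by (simp add: unit_vec_def)
      finally show ?thesis using True by simp
    next
      case False
      have "(\<Oplus>\<^bsub>R\<^esub>b\<in>?S. c b \<otimes>\<^bsub>R\<^esub> b i) = (\<Oplus>\<^bsub>R\<^esub>b\<in>?S. \<zero>\<^bsub>R\<^esub>)"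
      proof (rule finsum_cong')
        fix b assume b: "b \<in> ?S"
        then obtain j where "b = unit_vec R j" "j \<in> I" using S by (auto simp: B_def)
        then have "b i = \<zero>\<^bsub>R\<^esub>" using False b by (auto simp: unit_vec_def)
        then show "c b \<otimes>\<^bsub>R\<^esub> b i = \<zero>\<^bsub>R\<^esub>" using R by simp
      qed auto
      also have "\<dots> = \<zero>\<^bsub>R\<^esub>" by simp
      finally show ?thesis using False by auto
    qed
    finally show ?thesis .
  qed
  have "bij_betw (lin_comb R (free_mod R I) (\<lambda>b. b)) (carrier (free_mod R B)) (carrier (free_mod R I))"
    unfolding bij_betw_def
  proof
    show "inj_on (lin_comb R (free_mod R I) (\<lambda>b. b)) (carrier (free_mod R B))"
    proof (rule inj_onI)
      fix c d assume c: "c \<in> carrier (free_mod R B)" and d: "d \<in> carrier (free_mod R B)"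
        and eq: "lin_comb R (free_mod R I) (\<lambda>b. b) c = lin_comb R (free_mod R I) (\<lambda>b. b) d"
      show "c = d"
      proof
        fix b show "c b = d b"
        proof (cases "b \<in> B")
          case True
          then obtain i where "i \<in> I" "b = unit_vec R i" by (auto simp: B_def)
          then show ?thesis using eval[OF c, of i] eval[OF d, of i] eq by simp
        qed (use c d in \<open>auto simp: free_mod_simps\<close>)
      qed
    qed
  next
    show "lin_comb R (free_mod R I) (\<lambda>b. b) ` carrier (free_mod R B) = carrier (free_mod R I)"
    proof
      show "lin_comb R (free_mod R I) (\<lambda>b. b) ` carrier (free_mod R B) \<subseteq> carrier (free_mod R I)"
        using hom by (auto simp: mod_hom_def)
    next
      show "carrier (free_mod R I) \<subseteq> lin_comb R (free_mod R I) (\<lambda>b. b) ` carrier (free_mod R B)"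
      proof
        fix x assume x: "x \<in> carrier (free_mod R I)"
        define c where "c = (\<lambda>b. if b \<in> B then x (inv_into I (unit_vec R) b) else \<zero>\<^bsub>R\<^esub>)"
        have inv: "inv_into I (unit_vec R) (unit_vec R i) = i" if "i \<in> I" for i
          using that inj by (intro inv_into_f_f) (auto simp: inj_on_def)
        have cu: "c (unit_vec R i) = x i" if "i \<in> I" for i using that inv by (auto simp: c_def B_def)
        have "{b. c b \<noteq> \<zero>\<^bsub>R\<^esub>} \<subseteq> unit_vec R ` {i. x i \<noteq> \<zero>\<^bsub>R\<^esub>}"
          using inv by (auto simp: c_def B_def split: if_splits)
        moreover have "finite {i. x i \<noteq> \<zero>\<^bsub>R\<^esub>}" using x by (auto simp: free_mod_simps)
        ultimately have "finite {b. c b \<noteq> \<zero>\<^bsub>R\<^esub>}" using finite_surj by blast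
        then have c: "c \<in> carrier (free_mod R B)" using x by (auto simp: free_mod_simps c_def)
        have "lin_comb R (free_mod R I) (\<lambda>b. b) c = x"
          using x by (auto simp: fun_eq_iff eval[OF c] cu free_mod_simps)
        then show "x \<in> lin_comb R (free_mod R I) (\<lambda>b. b) ` carrier (free_mod R B)" using c by blast
      qed
    qed
  qed
  then show ?thesis using mod B unfolding free_module_def is_basis_def by blast
qed

lemma quot_proj_mod_hom:
  assumes "module R M" "submodule N R M"
  shows "(\<lambda>x. N +>\<^bsub>M\<^esub> x) \<in> mod_hom R M (quot_mod M N)"
proof -
  interpret module R M by fact
  interpret N: submodule N R M by fact
  have sub: "subgroup N (add_monoid M)" by (rule N.subgroup_axioms)
  interpret nN: abelian_subgroup N M
    by (rule abelian_subgroupI3[OF additive_subgroupI[OF sub] M.abelian_group_axioms])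
  have smult: "(\<Union>y\<in>N +>\<^bsub>M\<^esub> x. N +>\<^bsub>M\<^esub> (a \<odot>\<^bsub>M\<^esub> y)) = N +>\<^bsub>M\<^esub> (a \<odot>\<^bsub>M\<^esub> x)"
    if a: "a \<in> carrier R" and x: "x \<in> carrier M" for a x
  proof -
    have "N +>\<^bsub>M\<^esub> (a \<odot>\<^bsub>M\<^esub> y) = N +>\<^bsub>M\<^esub> (a \<odot>\<^bsub>M\<^esub> x)" if y: "y \<in> N +>\<^bsub>M\<^esub> x" for y
    proof -
      from y obtain n where n: "n \<in> N" "y = n \<oplus>\<^bsub>M\<^esub> x" by (auto simp: a_r_coset_def')
      have nM: "n \<in> carrier M" using n(1) by (rule nN.a_Hcarr)
      have "a \<odot>\<^bsub>M\<^esub> y = a \<odot>\<^bsub>M\<^esub> n \<oplus>\<^bsub>M\<^esub> a \<odot>\<^bsub>M\<^esub> x" using n nM a x by (simp add: smult_r_distr)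
      moreover have "a \<odot>\<^bsub>M\<^esub> n \<in> N" using a n(1) by (rule N.smult_closed)
      ultimately have "a \<odot>\<^bsub>M\<^esub> y \<in> N +>\<^bsub>M\<^esub> (a \<odot>\<^bsub>M\<^esub> x)" by (auto simp: a_r_coset_def')
      then show ?thesis using a x by (metis nN.a_repr_independence' smult_closed)
    qed
    moreover have "x \<in> N +>\<^bsub>M\<^esub> x" using x by (rule nN.a_rcos_self)
    ultimately show ?thesis by blast
  qed
  show ?thesis
    using smult nN.a_rcos_sum
    by (auto simp: mod_hom_def quot_mod_def A_RCOSETS_def')
qed

lemma image_submodule:
  assumes "module R M" "module R N" "f \<in> mod_hom R M N"
  shows "submodule (f ` carrier M) R N"
proof -
  interpret M: module R M by fact
  interpret N: module R N by fact
  have fc: "f x \<in> carrier N" if "x \<in> carrier M" for x using assms(3) that by (auto simp: mod_hom_def)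
  have fa: "f (x \<oplus>\<^bsub>M\<^esub> y) = f x \<oplus>\<^bsub>N\<^esub> f y" if "x \<in> carrier M" "y \<in> carrier M" for x y
    using assms(3) that by (auto simp: mod_hom_def)
  have fs: "f (a \<odot>\<^bsub>M\<^esub> x) = a \<odot>\<^bsub>N\<^esub> f x" if "a \<in> carrier R" "x \<in> carrier M" for a x
    using assms(3) that by (auto simp: mod_hom_def)
  have f0: "f \<zero>\<^bsub>M\<^esub> = \<zero>\<^bsub>N\<^esub>"
    using fs[of "\<zero>\<^bsub>R\<^esub>" "\<zero>\<^bsub>M\<^esub>"] fc by simp
  have fm: "f (\<ominus>\<^bsub>M\<^esub> x) = \<ominus>\<^bsub>N\<^esub> f x" if x: "x \<in> carrier M" for x
  proof -
    have "f (\<ominus>\<^bsub>M\<^esub> x) \<oplus>\<^bsub>N\<^esub> f x = \<zero>\<^bsub>N\<^esub>" using fa[of "\<ominus>\<^bsub>M\<^esub> x" x] x f0 by (simp add: M.M.l_neg)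
    then show ?thesis using fc x by (metis M.M.a_inv_closed N.M.minus_equality)
  qed
  show ?thesis
  proof (rule N.submoduleI)
    show "\<zero>\<^bsub>N\<^esub> \<in> f ` carrier M" using f0 by (metis M.M.zero_closed imageI)
  next
    fix y assume "y \<in> f ` carrier M"
    then obtain x where x: "x \<in> carrier M" "y = f x" by auto
    then show "\<ominus>\<^bsub>N\<^esub> y \<in> f ` carrier M" using fm[of x] by (metis M.M.a_inv_closed imageI)
  next
    fix y z assume "y \<in> f ` carrier M" "z \<in> f ` carrier M"
    then obtain x x' where x: "x \<in> carrier M" "x' \<in> carrier M" "y = f x" "z = f x'" by auto
    then show "y \<oplus>\<^bsub>N\<^esub> z \<in> f ` carrier M" using fa[of x x'] by (metis M.M.a_closed imageI)
  next
    fix a y assume a: "a \<in> carrier R" and "y \<in> f ` carrier M"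
    then obtain x where x: "x \<in> carrier M" "y = f x" by auto
    then show "a \<odot>\<^bsub>N\<^esub> y \<in> f ` carrier M" using fs[OF a, of x] a by (metis M.smult_closed imageI)
  qed (use fc in auto)
qed

lemma ring_mod_module:
  fixes R (structure) assumes "cring R" shows "module R (ring_mod R)"
proof -
  interpret cring R by fact
  have ag: "abelian_group (ring_mod R)"
  proof (rule abelian_groupI)
    fix x assume "x \<in> carrier (ring_mod R)"
    then show "\<exists>y\<in>carrier (ring_mod R). y \<oplus>\<^bsub>ring_mod R\<^esub> x = \<zero>\<^bsub>ring_mod R\<^esub>"
      by (intro bexI[of _ "\<ominus> x"]) (auto simp: ring_mod_def l_neg)
  qed (auto simp: ring_mod_def a_ac)
  show ?thesis by (rule moduleI[OF assms ag]) (auto simp: ring_mod_def l_distr r_distr m_assoc)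
qed

lemma free_presentation_exists:
  fixes M :: "('a, 'm) module"
  assumes "domain R" "module R M" "\<alpha> \<in> mod_hom R (ring_mod R) M"
  shows "\<exists>(F :: ('a, 'm \<Rightarrow> 'a) module) (G :: ('a, ('m \<Rightarrow> 'a) \<Rightarrow> 'a) module) \<mu> \<nu> \<mu>'.
    free_presentation R (quot_mod M (\<alpha> ` carrier R)) F G \<mu> \<nu> \<and>
    \<mu>' \<in> mod_hom R F M \<and> (\<forall>x\<in>carrier F. (\<alpha> ` carrier R) +>\<^bsub>M\<^esub> \<mu>' x = \<mu> x)"
proof -
  interpret domain R by fact
  interpret M: module R M by fact
  have cr: "cring R" by (rule cring_axioms)
  define N where "N = \<alpha> ` carrier R"
  have subm: "submodule N R M"
    using image_submodule[OF ring_mod_module[OF cr] assms(2,3)] by (simp add: N_def ring_mod_def)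
  define F where "F = free_mod R (carrier M)"
  have Fmod: "module R F" unfolding F_def by (rule free_mod_module[OF cr])
  interpret F: module R F by fact
  define m where "m = lin_comb R M (\<lambda>x. x)"
  have m: "m \<in> mod_hom R F M" unfolding m_def F_def by (rule lin_comb_mod_hom[OF assms(2)]) auto
  define \<mu> where "\<mu> = (\<lambda>x. N +>\<^bsub>M\<^esub> m x)"
  have proj: "(\<lambda>x. N +>\<^bsub>M\<^esub> x) \<in> mod_hom R M (quot_mod M N)"
    by (rule quot_proj_mod_hom[OF assms(2) subm])
  have \<mu>: "\<mu> \<in> mod_hom R F (quot_mod M N)"
    using m proj unfolding \<mu>_def mod_hom_def by (auto simp: Pi_iff)
  have m_surj: "y \<in> m ` carrier F" if "y \<in> carrier M" for y
  proof
    show "y = m (unit_vec R y)" unfolding m_def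
      using lin_comb_unit_vec[OF assms(2), of "\<lambda>x. x" y] that by simp
    show "unit_vec R y \<in> carrier F" unfolding F_def using unit_vec_closed[OF cr that] .
  qed
  have \<mu>_surj: "\<mu> ` carrier F = carrier (quot_mod M N)"
  proof
    show "\<mu> ` carrier F \<subseteq> carrier (quot_mod M N)" using \<mu> by (auto simp: mod_hom_def)
    show "carrier (quot_mod M N) \<subseteq> \<mu> ` carrier F"
      using m_surj by (force simp: quot_mod_def A_RCOSETS_def' \<mu>_def)
  qed
  define K where "K = {x \<in> carrier F. \<mu> x = \<zero>\<^bsub>quot_mod M N\<^esub>}"
  interpret N: submodule N R M by fact
  interpret nN: abelian_subgroup N M
    by (rule abelian_subgroupI3[OF additive_subgroupI[OF N.subgroup_axioms] M.M.abelian_group_axioms])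
  have mc: "m x \<in> carrier M" if "x \<in> carrier F" for x using m that by (auto simp: mod_hom_def)
  have K_iff: "x \<in> K \<longleftrightarrow> x \<in> carrier F \<and> m x \<in> N" for x
  proof -
    have "N +>\<^bsub>M\<^esub> m x = N \<longleftrightarrow> m x \<in> N" if "x \<in> carrier F"
      using nN.a_rcos_const nN.a_rcos_self[OF mc[OF that]] by metis
    then show ?thesis by (auto simp: K_def \<mu>_def quot_mod_def)
  qed
  have madd: "m (x \<oplus>\<^bsub>F\<^esub> y) = m x \<oplus>\<^bsub>M\<^esub> m y" if "x \<in> carrier F" "y \<in> carrier F" for x y
    using m that by (auto simp: mod_hom_def)
  have msm: "m (a \<odot>\<^bsub>F\<^esub> x) = a \<odot>\<^bsub>M\<^esub> m x" if "a \<in> carrier R" "x \<in> carrier F" for a x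
    using m that by (auto simp: mod_hom_def)
  have Kadd: "x \<oplus>\<^bsub>F\<^esub> y \<in> K" if "x \<in> K" "y \<in> K" for x y
    using that nN.a_closed by (auto simp: K_iff madd)
  have Ksm: "a \<odot>\<^bsub>F\<^esub> x \<in> K" if "a \<in> carrier R" "x \<in> K" for a x
    using that N.smult_closed by (auto simp: K_iff msm)
  have K0: "\<zero>\<^bsub>F\<^esub> \<in> K"
  proof -
    have "m \<zero>\<^bsub>F\<^esub> = \<zero>\<^bsub>M\<^esub>" using msm[of "\<zero>\<^bsub>R\<^esub>" "\<zero>\<^bsub>F\<^esub>"] mc by simp
    then show ?thesis using nN.zero_closed by (simp add: K_iff)
  qed
  have KF: "K \<subseteq> carrier F" by (auto simp: K_def)
  define G where "G = free_mod R K"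
  define \<nu> where "\<nu> = lin_comb R F (\<lambda>x. x)"
  have \<nu>: "\<nu> \<in> mod_hom R G F" unfolding \<nu>_def G_def
    by (rule lin_comb_mod_hom[OF Fmod]) (use KF in auto)
  have \<nu>_im: "\<nu> ` carrier G = K"
  proof
    show "\<nu> ` carrier G \<subseteq> K"
    proof
      fix y assume "y \<in> \<nu> ` carrier G"
      then obtain c where c: "c \<in> carrier G" "y = \<nu> c" by auto
      have fin: "finite {i. c i \<noteq> \<zero>\<^bsub>R\<^esub>}" and sub: "{i. c i \<noteq> \<zero>\<^bsub>R\<^esub>} \<subseteq> K" and cR: "\<And>i. c i \<in> carrier R"
        using c by (auto simp: G_def free_mod_simps)
      have "(\<Oplus>\<^bsub>F\<^esub>i\<in>A. c i \<odot>\<^bsub>F\<^esub> i) \<in> K" if "finite A" "A \<subseteq> K" for A using that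
      proof (induction A rule: finite_induct)
        case empty then show ?case using K0 by simp
      next
        case (insert x A)
        then have "(\<Oplus>\<^bsub>F\<^esub>i\<in>insert x A. c i \<odot>\<^bsub>F\<^esub> i) = c x \<odot>\<^bsub>F\<^esub> x \<oplus>\<^bsub>F\<^esub> (\<Oplus>\<^bsub>F\<^esub>i\<in>A. c i \<odot>\<^bsub>F\<^esub> i)"
          using KF cR by (intro F.M.finsum_insert) auto
        then show ?case using insert Kadd Ksm cR by auto
      qed
      then show "y \<in> K" using c fin sub by (simp add: \<nu>_def lin_comb_def)
    qed
    show "K \<subseteq> \<nu> ` carrier G"
    proof
      fix y assume y: "y \<in> K"
      show "y \<in> \<nu> ` carrier G"
      proof
        show "y = \<nu> (unit_vec R y)" unfolding \<nu>_def
          using lin_comb_unit_vec[OF Fmod, of "\<lambda>x. x" y] y KF by auto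
        show "unit_vec R y \<in> carrier G" unfolding G_def using unit_vec_closed[OF cr y] .
      qed
    qed
  qed
  have "free_presentation R (quot_mod M N) F G \<mu> \<nu>"
    unfolding free_presentation_def
    using free_module_free_mod[OF cr one_not_zero, of "carrier M"]
      free_module_free_mod[OF cr one_not_zero, of K] \<mu> \<mu>_surj \<nu> \<nu>_im
    by (simp flip: F_def G_def K_def)
  then show ?thesis using m unfolding N_def \<mu>_def by blast
qed

end

theory Submission
  imports Defs "HOL-Computational_Algebra.Primes"
begin

text \<open>
  Let \<open>\<alpha> : R \<rightarrow> S\<close> be the structure map.  As \<open>S\<close> is solid, there is a linear map \<open>\<gamma> : S \<rightarrow> R\<close> with
  \<open>c = \<gamma>(1) \<noteq> 0\<close> (\<open>solid_algebra_retraction\<close>).  This \<open>c\<close> witnesses the tight closure condition for all \<open>e\<close>.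
  Indeed, let \<open>\<nu> : G \<rightarrow> F\<close> be part of a free presentation of \<open>S/R\<close>, let \<open>\<mu>' : F \<rightarrow> S\<close> be a lift, let
  \<open>t : G \<rightarrow> R\<close> be the functional with \<open>\<alpha> t = \<mu>' \<nu>\<close>, and let \<open>q = p\<^sup>e\<close>.  Taking \<open>q\<close>-th powers in the ring \<open>S\<close>
  and applying \<open>\<gamma>\<close> gives \<open>c t(g)\<^sup>q = \<gamma>(\<alpha>(t(g)\<^sup>q)) = \<gamma>((\<mu>'(\<nu>(g)))\<^sup>q) = H(\<nu>(g))\<close>, where the map
  \<open>H(x) = \<gamma>((\<mu>'(x))\<^sup>q)\<close> from \<open>F\<close> to \<open>R\<close> is Frobenius-semilinear.

  For a free module \<open>F\<close> with a basis indexed by \<open>I\<close>, the dual of \<open>F\<close> is the product \<open>R\<^sup>I\<close>, and semilinear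
  maps \<open>F \<rightarrow> R\<close> also correspond to \<open>R\<^sup>I\<close>.  There is a comparison map from the Frobenius functor applied
  to the dual of \<open>F\<close> to the semilinear maps, sending \<open>a \<otimes> u\<close> to \<open>x \<mapsto> a u(x)\<^sup>q\<close>.  It is bijective even if \<open>I\<close>
  is infinite, because tensoring with a finitely presented module commutes with products and the
  Frobenius endomorphism makes \<open>R\<close> such a module over itself: the map is surjective since \<open>R\<close> is F-finite
  (\<open>twisted_eval_surj\<close>), and injective since \<open>R\<close> is Noetherian (\<open>base_change_dual_eqI\<close>).

  By surjectivity for \<open>F\<close>, the map \<open>H\<close> comes from an element \<open>\<Sum>\<^sub>u z(u) \<otimes> u\<close> with functionals \<open>u\<close> on \<open>F\<close>.
  Then \<open>\<Sum>\<^sub>u z(u) \<otimes> (u \<nu>)\<close> comes from the image of the dual of \<open>\<nu>\<close>, and it induces the same semilinear map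
  \<open>H \<nu>\<close> on \<open>G\<close> as \<open>c \<otimes> t\<close>.  By injectivity for \<open>G\<close> the two elements are equal, which is the claim.
\<close>

section \<open>The Frobenius endomorphism\<close>

lemma (in cring) binomial_theorem:
  assumes x: "x \<in> carrier R" and y: "y \<in> carrier R"
  shows "(x \<oplus> y) [^] n = (\<Oplus>k\<in>{..n}. [(n choose k)] \<cdot> (x [^] k \<otimes> y [^] (n - k)))"
proof (induction n)
  case 0
  then show ?case by (simp add: Pi_def)
next
  case (Suc n)
  define t where "t k = x [^] k \<otimes> y [^] (n - k)" for k
  define s where "s k = x [^] (Suc k) \<otimes> y [^] (n - k)" for k
  have t: "t k \<in> carrier R" and s: "s k \<in> carrier R" for k using x y by (auto simp: t_def s_def)
  have tx: "t k \<otimes> x = s k" for k using x y by (simp add: t_def s_def m_ac)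
  have ty: "t (Suc k) \<otimes> y = s k" if "Suc k \<le> n" for k
  proof -
    have "n - k = Suc (n - Suc k)" using that by simp
    then show ?thesis using x y by (simp add: t_def s_def m_ac)
  qed
  have yy: "(\<Oplus>k\<in>{..n}. [(n choose k)] \<cdot> (t k \<otimes> y)) =
      (\<Oplus>k\<in>{..n}. [(n choose Suc k)] \<cdot> s k) \<oplus> y [^] Suc n"
  proof -
    define u where "u k = [(n choose k)] \<cdot> (x [^] k \<otimes> y [^] (Suc n - k))" for k
    have u: "u k \<in> carrier R" for k using x y by (simp add: u_def)
    have "(\<Oplus>k\<in>{..n}. [(n choose k)] \<cdot> (t k \<otimes> y)) = (\<Oplus>k\<in>{..n}. u k)"
      using x y by (intro finsum_cong') (auto simp: u_def t_def Suc_diff_le m_ac)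
    also have "\<dots> = (\<Oplus>k\<in>{..Suc n}. u k)"
      using u by (subst finsum_Suc) (auto simp: u_def[of "Suc n"] binomial_eq_0)
    also have "\<dots> = (\<Oplus>k\<in>{..n}. u (Suc k)) \<oplus> u 0"
      using u by (intro finsum_Suc2) auto
    also have "(\<Oplus>k\<in>{..n}. u (Suc k)) = (\<Oplus>k\<in>{..n}. [(n choose Suc k)] \<cdot> s k)"
      using s x y by (intro finsum_cong') (auto simp: u_def s_def)
    also have "u 0 = y [^] Suc n" using y by (simp add: u_def add.nat_pow_eone)
    finally show ?thesis .
  qed
  have "(x \<oplus> y) [^] Suc n = (\<Oplus>k\<in>{..n}. [(n choose k)] \<cdot> t k) \<otimes> (x \<oplus> y)"
    using Suc by (simp add: t_def)
  also have "\<dots> = (\<Oplus>k\<in>{..n}. [(n choose k)] \<cdot> t k) \<otimes> x \<oplus> (\<Oplus>k\<in>{..n}. [(n choose k)] \<cdot> t k) \<otimes> y"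
    using t x y by (intro r_distr) auto
  also have "(\<Oplus>k\<in>{..n}. [(n choose k)] \<cdot> t k) \<otimes> x = (\<Oplus>k\<in>{..n}. [(n choose k)] \<cdot> s k)"
    using t s x by (simp add: finsum_ldistr add_pow_ldistr tx)
  also have "(\<Oplus>k\<in>{..n}. [(n choose k)] \<cdot> t k) \<otimes> y = (\<Oplus>k\<in>{..n}. [(n choose Suc k)] \<cdot> s k) \<oplus> y [^] Suc n"
    unfolding yy[symmetric] using t y by (simp add: finsum_ldistr add_pow_ldistr)
  also have "(\<Oplus>k\<in>{..n}. [(n choose k)] \<cdot> s k) \<oplus> ((\<Oplus>k\<in>{..n}. [(n choose Suc k)] \<cdot> s k) \<oplus> y [^] Suc n) =
      (\<Oplus>k\<in>{..n}. [(n choose k)] \<cdot> s k \<oplus> [(n choose Suc k)] \<cdot> s k) \<oplus> y [^] Suc n"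
    using s y by (subst finsum_addf) (auto simp: a_assoc intro!: finsum_closed)
  also have "(\<Oplus>k\<in>{..n}. [(n choose k)] \<cdot> s k \<oplus> [(n choose Suc k)] \<cdot> s k) =
      (\<Oplus>k\<in>{..n}. [(Suc n choose Suc k)] \<cdot> (x [^] Suc k \<otimes> y [^] (Suc n - Suc k)))"
    using s x y by (intro finsum_cong') (auto simp: s_def add.nat_pow_mult)
  also have "y [^] Suc n = [(Suc n choose 0)] \<cdot> (x [^] (0::nat) \<otimes> y [^] (Suc n - 0))"
    using y by (simp add: add.nat_pow_eone)
  also have "(\<Oplus>k\<in>{..n}. [(Suc n choose Suc k)] \<cdot> (x [^] Suc k \<otimes> y [^] (Suc n - Suc k))) \<oplus> \<dots> =
      (\<Oplus>k\<in>{..Suc n}. [(Suc n choose k)] \<cdot> (x [^] k \<otimes> y [^] (Suc n - k)))"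
    using x y by (intro finsum_Suc2[symmetric]) auto
  finally show ?case .
qed

lemma (in cring) add_pow_eq_zero:
  fixes p n :: nat
  assumes "[p] \<cdot> \<one> = \<zero>" "p dvd n" "x \<in> carrier R"
  shows "[n] \<cdot> x = \<zero>"
proof -
  obtain m where n: "n = p * m" using assms(2) ..
  have "[n] \<cdot> x = [m] \<cdot> ([p] \<cdot> (\<one> \<otimes> x))"
    using assms(3) by (simp add: n add.nat_pow_pow)
  also have "[p] \<cdot> (\<one> \<otimes> x) = \<zero>"
    using assms(1,3) add_pow_ldistr[of \<one> x p] by simp
  finally show ?thesis by simp
qed

text \<open>
  Every inner binomial coefficient of a prime exponent is divisible by that prime.
\<close>

lemma (in cring) pow_prime_add:
  fixes p :: nat
  assumes p: "prime p" "[p] \<cdot> \<one> = \<zero>" and x: "x \<in> carrier R" and y: "y \<in> carrier R"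
  shows "(x \<oplus> y) [^] p = x [^] p \<oplus> y [^] p"
proof -
  obtain m where m: "p = Suc m" using prime_gt_0_nat[OF p(1)] gr0_conv_Suc by auto
  define t where "t k = [(p choose k)] \<cdot> (x [^] k \<otimes> y [^] (p - k))" for k
  have t: "t k \<in> carrier R" for k using x y by (simp add: t_def)
  have "(x \<oplus> y) [^] p = (\<Oplus>k\<in>{..Suc m}. t k)"
    unfolding binomial_theorem[OF x y] t_def m ..
  also have "\<dots> = (\<Oplus>k\<in>{0, p}. t k)"
  proof (rule add.finprod_mono_neutral_cong_right)
    fix k assume "k \<in> {..Suc m} - {0, p}"
    then have "p dvd (p choose k)" using dvd_choose_prime[of k p] p(1) m by auto
    then show "t k = \<zero>" unfolding t_def using x y by (intro add_pow_eq_zero[OF p(2)]) auto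
  qed (use m t in auto)
  also have "\<dots> = t 0 \<oplus> t p" using t m by (subst finsum_insert) auto
  also have "\<dots> = x [^] p \<oplus> y [^] p"
    using x y by (simp add: t_def add.nat_pow_eone a_comm)
  finally show ?thesis .
qed

lemma frob_Suc:
  assumes "cring R" "r \<in> carrier R"
  shows "frob R p (Suc e) r = frob R p e (frob R p 1 r)" "frob R p (Suc e) r = frob R p 1 (frob R p e r)"
proof -
  interpret cring R by fact
  show "frob R p (Suc e) r = frob R p e (frob R p 1 r)" "frob R p (Suc e) r = frob R p 1 (frob R p e r)"
    using assms(2) by (simp_all add: frob_def nat_pow_pow mult.commute)
qed

lemma frob_ring_hom:
  assumes "cring R" "prime p" "[p] \<cdot>\<^bsub>R\<^esub> \<one>\<^bsub>R\<^esub> = \<zero>\<^bsub>R\<^esub>"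
  shows "frob R p e \<in> ring_hom R R"
proof -
  interpret cring R by fact
  have add: "frob R p e (x \<oplus>\<^bsub>R\<^esub> y) = frob R p e x \<oplus>\<^bsub>R\<^esub> frob R p e y"
    if "x \<in> carrier R" "y \<in> carrier R" for x y
  proof (induction e)
    case 0 show ?case using that by (simp add: frob_def nat_pow_eone)
  next
    case (Suc e)
    have "frob R p e z \<in> carrier R" if "z \<in> carrier R" for z using that by (simp add: frob_def)
    then show ?case
      using that Suc pow_prime_add[OF assms(2,3)] by (simp add: frob_Suc(2)[OF assms(1)]) (simp add: frob_def)
  qed
  show ?thesis
    by (rule ring_hom_memI) (auto simp: add, auto simp: frob_def nat_pow_distrib)
qed

text \<open>
  In a domain a factorisation of the characteristic gives a product of two integers that vanishes.
\<close>

lemma has_char_prime: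
  assumes "domain R" "p > 0" "has_char R p"
  shows "prime p"
proof -
  interpret domain R by fact
  have zero_iff: "[n] \<cdot>\<^bsub>R\<^esub> \<one>\<^bsub>R\<^esub> = \<zero>\<^bsub>R\<^esub> \<longleftrightarrow> p dvd n" for n :: nat
    using assms(3) by (simp add: has_char_def)
  have "p \<noteq> 1" using zero_iff[of 1] by (auto simp: add.nat_pow_eone)
  moreover have "p dvd a \<or> p dvd b" if "p dvd a * b" for a b
  proof -
    have "([a] \<cdot>\<^bsub>R\<^esub> \<one>\<^bsub>R\<^esub>) \<otimes>\<^bsub>R\<^esub> ([b] \<cdot>\<^bsub>R\<^esub> \<one>\<^bsub>R\<^esub>) = [(a * b)] \<cdot>\<^bsub>R\<^esub> \<one>\<^bsub>R\<^esub>"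
      by (simp add: add_pow_ldistr add.nat_pow_pow mult.commute)
    then show ?thesis using zero_iff that integral by (metis add.nat_pow_closed one_closed)
  qed
  ultimately have "prime_elem p" using assms(2) by (intro prime_elemI) auto
  then show ?thesis by simp
qed

section \<open>Linear maps\<close>

lemma (in abelian_monoid) finsum_swap:
  assumes "finite A" "finite B" "\<And>a b. a \<in> A \<Longrightarrow> b \<in> B \<Longrightarrow> f a b \<in> carrier G"
  shows "(\<Oplus>a\<in>A. \<Oplus>b\<in>B. f a b) = (\<Oplus>b\<in>B. \<Oplus>a\<in>A. f a b)"
  using assms
proof (induction A rule: finite_induct)
  case (insert x A)
  have IH: "(\<Oplus>a\<in>A. \<Oplus>b\<in>B. f a b) = (\<Oplus>b\<in>B. \<Oplus>a\<in>A. f a b)"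
    using insert by simp
  have "(\<Oplus>a\<in>insert x A. \<Oplus>b\<in>B. f a b) = (\<Oplus>b\<in>B. f x b) \<oplus> (\<Oplus>b\<in>B. \<Oplus>a\<in>A. f a b)"
    unfolding IH[symmetric] using insert.hyps insert.prems
    by (intro finsum_insert) (auto intro!: finsum_closed)
  also have "\<dots> = (\<Oplus>b\<in>B. f x b \<oplus> (\<Oplus>a\<in>A. f a b))"
    using insert by (intro finsum_addf[symmetric]) (auto intro!: finsum_closed)
  also have "\<dots> = (\<Oplus>b\<in>B. \<Oplus>a\<in>insert x A. f a b)"
    using insert by (intro finsum_cong' refl) (auto intro!: finsum_closed)
  finally show ?case .
qed simp

lemma mod_homD:
  assumes "f \<in> mod_hom R M N"
  shows "x \<in> carrier M \<Longrightarrow> f x \<in> carrier N"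
    and "x \<in> carrier M \<Longrightarrow> y \<in> carrier M \<Longrightarrow> f (x \<oplus>\<^bsub>M\<^esub> y) = f x \<oplus>\<^bsub>N\<^esub> f y"
    and "a \<in> carrier R \<Longrightarrow> x \<in> carrier M \<Longrightarrow> f (a \<odot>\<^bsub>M\<^esub> x) = a \<odot>\<^bsub>N\<^esub> f x"
  using assms by (auto simp: mod_hom_def)

lemma mod_hom_zero:
  assumes "module R M" "module R N" "f \<in> mod_hom R M N"
  shows "f \<zero>\<^bsub>M\<^esub> = \<zero>\<^bsub>N\<^esub>"
proof -
  interpret M: module R M by fact
  interpret N: module R N by fact
  show ?thesis
    using mod_homD(3)[OF assms(3), of "\<zero>\<^bsub>R\<^esub>" "\<zero>\<^bsub>M\<^esub>"] mod_homD(1)[OF assms(3)] by simp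
qed

lemma mod_hom_neg:
  assumes "module R M" "module R N" "f \<in> mod_hom R M N" "x \<in> carrier M"
  shows "f (\<ominus>\<^bsub>M\<^esub> x) = \<ominus>\<^bsub>N\<^esub> f x"
proof -
  interpret M: module R M by fact
  interpret N: module R N by fact
  note f = mod_homD[OF assms(3)]
  have "f (\<ominus>\<^bsub>M\<^esub> x) \<oplus>\<^bsub>N\<^esub> f x = \<zero>\<^bsub>N\<^esub>"
    using f(2)[of "\<ominus>\<^bsub>M\<^esub> x" x] assms(4) mod_hom_zero[OF assms(1-3)] by (simp add: M.M.l_neg)
  then show ?thesis using f(1) assms(4) by (metis M.M.a_inv_closed N.M.minus_equality)
qed

lemma mod_hom_diff:
  assumes "module R M" "module R N" "f \<in> mod_hom R M N" "x \<in> carrier M" "y \<in> carrier M"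
  shows "f (x \<ominus>\<^bsub>M\<^esub> y) = f x \<ominus>\<^bsub>N\<^esub> f y"
proof -
  interpret M: module R M by fact
  show ?thesis
    using mod_homD(2)[OF assms(3)] mod_hom_neg[OF assms(1-3,5)] assms(4,5) by (simp add: a_minus_def)
qed

lemma mod_hom_finsum:
  assumes "module R M" "module R N" "f \<in> mod_hom R M N" "finite A" "g \<in> A \<rightarrow> carrier M"
  shows "f (\<Oplus>\<^bsub>M\<^esub>i\<in>A. g i) = (\<Oplus>\<^bsub>N\<^esub>i\<in>A. f (g i))"
  using assms(4,5)
proof (induction A rule: finite_induct)
  interpret M: module R M by fact
  interpret N: module R N by fact
  case empty then show ?case using mod_hom_zero[OF assms(1-3)] by simp
next
  interpret M: module R M by fact
  interpret N: module R N by fact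
  note f = mod_homD[OF assms(3)]
  case (insert x A)
  have gA: "g i \<in> carrier M" if "i \<in> insert x A" for i using insert.prems that by auto
  have "f (\<Oplus>\<^bsub>M\<^esub>i\<in>insert x A. g i) = f (g x \<oplus>\<^bsub>M\<^esub> (\<Oplus>\<^bsub>M\<^esub>i\<in>A. g i))"
    using gA insert.hyps by (subst M.M.finsum_insert) auto
  also have "\<dots> = f (g x) \<oplus>\<^bsub>N\<^esub> f (\<Oplus>\<^bsub>M\<^esub>i\<in>A. g i)"
    using gA by (intro f(2) M.M.finsum_closed) auto
  also have "f (\<Oplus>\<^bsub>M\<^esub>i\<in>A. g i) = (\<Oplus>\<^bsub>N\<^esub>i\<in>A. f (g i))"
    using gA by (intro insert.IH) auto
  also have "f (g x) \<oplus>\<^bsub>N\<^esub> \<dots> = (\<Oplus>\<^bsub>N\<^esub>i\<in>insert x A. f (g i))"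
    using gA f(1) insert.hyps by (intro N.M.finsum_insert[symmetric]) auto
  finally show ?case .
qed

lemma mod_hom_lin_comb:
  assumes "module R M" "module R N" "f \<in> mod_hom R M N"
    and c: "c \<in> carrier (free_mod R I)" and v: "v \<in> I \<rightarrow> carrier M"
  shows "f (lin_comb R M v c) = lin_comb R N (\<lambda>i. f (v i)) c"
proof -
  interpret M: module R M by fact
  interpret N: module R N by fact
  note f = mod_homD[OF assms(3)]
  have fin: "finite {i. c i \<noteq> \<zero>\<^bsub>R\<^esub>}" and sub: "{i. c i \<noteq> \<zero>\<^bsub>R\<^esub>} \<subseteq> I" and cR: "\<And>i. c i \<in> carrier R"
    using c by (auto simp: free_mod_simps)
  have vM: "v i \<in> carrier M" if "c i \<noteq> \<zero>\<^bsub>R\<^esub>" for i using that sub v by auto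
  have "f (lin_comb R M v c) = (\<Oplus>\<^bsub>N\<^esub>i\<in>{i. c i \<noteq> \<zero>\<^bsub>R\<^esub>}. f (c i \<odot>\<^bsub>M\<^esub> v i))"
    unfolding lin_comb_def using cR vM by (intro mod_hom_finsum[OF assms(1-3) fin]) auto
  also have "\<dots> = lin_comb R N (\<lambda>i. f (v i)) c"
    unfolding lin_comb_def using cR vM f by (intro N.M.finsum_cong') auto
  finally show ?thesis .
qed

lemma mod_hom_compose:
  assumes "f \<in> mod_hom R L M" "g \<in> mod_hom R M N"
  shows "(\<lambda>x. g (f x)) \<in> mod_hom R L N"
  using assms by (auto simp: mod_hom_def Pi_iff)

lemma kernel_submodule:
  assumes "module R M" "module R N" "f \<in> mod_hom R M N"
  shows "submodule {x \<in> carrier M. f x = \<zero>\<^bsub>N\<^esub>} R M"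
proof -
  interpret M: module R M by fact
  interpret N: module R N by fact
  note f = mod_homD[OF assms(3)]
  show ?thesis
  proof (rule M.submoduleI)
    fix x assume x: "x \<in> {x \<in> carrier M. f x = \<zero>\<^bsub>N\<^esub>}"
    then have "f (\<zero>\<^bsub>M\<^esub> \<ominus>\<^bsub>M\<^esub> x) = \<zero>\<^bsub>N\<^esub>"
      by (subst mod_hom_diff[OF assms]) (auto simp: mod_hom_zero[OF assms] a_minus_def)
    then show "\<ominus>\<^bsub>M\<^esub> x \<in> {x \<in> carrier M. f x = \<zero>\<^bsub>N\<^esub>}" using x by (simp add: a_minus_def)
  qed (use f mod_hom_zero[OF assms] in auto)
qed

lemma submodule_finsum:
  assumes "module R M" "submodule H R M" "finite A" "f \<in> A \<rightarrow> H"
  shows "(\<Oplus>\<^bsub>M\<^esub>i\<in>A. f i) \<in> H"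
  using assms(3,4)
proof (induction A rule: finite_induct)
  interpret module R M by fact
  case empty then show ?case using submodule.axioms(1)[OF assms(2)] subgroup.one_closed by fastforce
next
  interpret module R M by fact
  note H = submoduleE[OF assms(2)]
  case (insert x A)
  have "(\<Oplus>\<^bsub>M\<^esub>i\<in>insert x A. f i) = f x \<oplus>\<^bsub>M\<^esub> (\<Oplus>\<^bsub>M\<^esub>i\<in>A. f i)"
    using insert H(1) by (intro M.finsum_insert) auto
  then show ?case using insert H(5) by auto
qed

text \<open>
  Every element of a free module is the combination of the unit vectors with its own coordinates.
  This turns a linear map on a free module into a \<open>lin_comb\<close>, see \<open>base_change_class\<close> below.
\<close>

lemma lin_comb_free_mod_unit_vec:
  assumes "cring R" "c \<in> carrier (free_mod R I)"
  shows "lin_comb R (free_mod R I) (unit_vec R) c = c"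
proof
  fix i
  interpret cring R by fact
  interpret F: module R "free_mod R I" by (rule free_mod_module[OF assms(1)])
  have cR: "\<And>i. c i \<in> carrier R" and fin: "finite {i. c i \<noteq> \<zero>\<^bsub>R\<^esub>}"
    and sub: "\<And>i. c i \<noteq> \<zero>\<^bsub>R\<^esub> \<Longrightarrow> i \<in> I" using assms by (auto simp: free_mod_simps)
  have "lin_comb R (free_mod R I) (unit_vec R) c i
      = (\<Oplus>\<^bsub>R\<^esub>j\<in>{j. c j \<noteq> \<zero>\<^bsub>R\<^esub>}. (c j \<odot>\<^bsub>free_mod R I\<^esub> unit_vec R j) i)"
    unfolding lin_comb_def
    using fin by (rule free_mod_finsum[OF assms(1)]) (intro F.smult_closed unit_vec_closed[OF assms(1)] cR, use sub in auto)
  also have "\<dots> = (\<Oplus>\<^bsub>R\<^esub>j\<in>{j. c j \<noteq> \<zero>\<^bsub>R\<^esub>}. if i = j then c j else \<zero>\<^bsub>R\<^esub>)"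
    using cR by (intro finsum_cong') (auto simp: free_mod_simps unit_vec_def)
  also have "\<dots> = c i"
  proof (cases "c i = \<zero>\<^bsub>R\<^esub>")
    case True
    then have "(\<Oplus>\<^bsub>R\<^esub>j\<in>{j. c j \<noteq> \<zero>\<^bsub>R\<^esub>}. if i = j then c j else \<zero>\<^bsub>R\<^esub>) = (\<Oplus>\<^bsub>R\<^esub>j\<in>{j. c j \<noteq> \<zero>\<^bsub>R\<^esub>}. \<zero>\<^bsub>R\<^esub>)"
      by (intro finsum_cong') auto
    then show ?thesis using True by simp
  next
    case False
    then show ?thesis using finsum_singleton[of i "{j. c j \<noteq> \<zero>\<^bsub>R\<^esub>}" c] fin cR by auto
  qed
  finally show "lin_comb R (free_mod R I) (unit_vec R) c i = c i" .
qed

section \<open>Bases\<close>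

text \<open>
  The universal property of a basis: the coordinate map of the basis is linear, being the inverse of
  a bijective linear map, and it is followed by the combination of the prescribed values.
\<close>

lemma basis_extend:
  assumes "module R M" "module R N" "is_basis R M B" "\<one>\<^bsub>R\<^esub> \<noteq> \<zero>\<^bsub>R\<^esub>" "h \<in> B \<rightarrow> carrier N"
  obtains f where "f \<in> mod_hom R M N" "\<And>b. b \<in> B \<Longrightarrow> f b = h b"
proof -
  interpret M: module R M by fact
  define F where "F = free_mod R B"
  define l where "l = lin_comb R M (\<lambda>b. b)"
  have B: "B \<subseteq> carrier M" and bij: "bij_betw l (carrier F) (carrier M)"
    using assms(3) by (auto simp: is_basis_def F_def l_def)
  have F: "module R F" unfolding F_def by (rule free_mod_module) (rule M.R.cring_axioms)
  interpret F: module R F by (rule F)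
  have l: "l \<in> mod_hom R F M" unfolding F_def l_def
    by (rule lin_comb_mod_hom[OF assms(1)]) (use B in auto)
  define g where "g = inv_into (carrier F) l"
  have gl: "g (l c) = c" if "c \<in> carrier F" for c
    unfolding g_def using bij that by (intro inv_into_f_f) (auto simp: bij_betw_def)
  have lg: "l (g x) = x" "g x \<in> carrier F" if "x \<in> carrier M" for x
    unfolding g_def using bij that by (auto simp: bij_betw_def f_inv_into_f inv_into_into)
  have g: "g \<in> mod_hom R M F" unfolding mod_hom_def
  proof (intro CollectI conjI ballI funcsetI)
    fix x y assume "x \<in> carrier M" "y \<in> carrier M"
    then show "g (x \<oplus>\<^bsub>M\<^esub> y) = g x \<oplus>\<^bsub>F\<^esub> g y"
      using gl[of "g x \<oplus>\<^bsub>F\<^esub> g y"] lg by (simp add: mod_homD(2)[OF l])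
  next
    fix a x assume "a \<in> carrier R" "x \<in> carrier M"
    then show "g (a \<odot>\<^bsub>M\<^esub> x) = a \<odot>\<^bsub>F\<^esub> g x"
      using gl[of "a \<odot>\<^bsub>F\<^esub> g x"] lg by (simp add: mod_homD(3)[OF l])
  qed (use lg in auto)
  have gb: "g b = unit_vec R b" if "b \<in> B" for b
  proof -
    have "l (unit_vec R b) = b" unfolding l_def
      using lin_comb_unit_vec[OF assms(1), of "\<lambda>b. b" b] that B assms(4) by auto
    then show ?thesis using gl[of "unit_vec R b"] unit_vec_closed[OF M.R.cring_axioms that]
      by (simp add: F_def)
  qed
  show ?thesis
  proof (rule that)
    show "(\<lambda>x. lin_comb R N h (g x)) \<in> mod_hom R M N"
      by (rule mod_hom_compose[OF g]) (unfold F_def, rule lin_comb_mod_hom[OF assms(2,5)])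
    show "lin_comb R N h (g b) = h b" if "b \<in> B" for b
      unfolding gb[OF that] using that assms(4,5) by (intro lin_comb_unit_vec[OF assms(2)]) auto
  qed
qed

lemma mod_hom_eq_on_basis:
  assumes "module R M" "module R N" "is_basis R M B" "f \<in> mod_hom R M N" "g \<in> mod_hom R M N"
    and "\<And>b. b \<in> B \<Longrightarrow> f b = g b" "x \<in> carrier M"
  shows "f x = g x"
proof -
  have "x \<in> lin_comb R M (\<lambda>b. b) ` carrier (free_mod R B)" and B: "(\<lambda>b. b) \<in> B \<rightarrow> carrier M"
    using assms(3,7) by (auto simp: is_basis_def bij_betw_def)
  then obtain c where c: "c \<in> carrier (free_mod R B)" "x = lin_comb R M (\<lambda>b. b) c" by auto
  interpret N: module R N by fact
  have cR: "c b \<in> carrier R" "c b \<noteq> \<zero>\<^bsub>R\<^esub> \<Longrightarrow> b \<in> B" for b using c by (auto simp: free_mod_simps)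
  have gN: "g b \<in> carrier N" if "b \<in> B" for b using B mod_homD(1)[OF assms(5)] that by auto
  have "lin_comb R N f c = lin_comb R N g c" unfolding lin_comb_def
    using cR gN assms(6) by (intro N.M.finsum_cong') auto
  then show ?thesis
    using mod_hom_lin_comb[OF assms(1,2,4) c(1) B] mod_hom_lin_comb[OF assms(1,2,5) c(1) B] c(2) by simp
qed

section \<open>Restriction of scalars\<close>

text \<open>
  Frobenius-semilinear maps \<open>M \<rightarrow> N\<close> are handled as linear maps from \<open>M\<close> to \<open>N\<close> with scalars
  restricted along the Frobenius endomorphism, so that all facts about linear maps apply to them.
\<close>

definition restrict_scalars :: "('a \<Rightarrow> 'a) \<Rightarrow> ('a, 'm) module \<Rightarrow> ('a, 'm) module" where
  "restrict_scalars \<phi> M = M\<lparr>smult := \<lambda>a x. \<phi> a \<odot>\<^bsub>M\<^esub> x\<rparr>"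

lemma restrict_scalars_simps [simp]:
  "carrier (restrict_scalars \<phi> M) = carrier M"
  "\<zero>\<^bsub>restrict_scalars \<phi> M\<^esub> = \<zero>\<^bsub>M\<^esub>"
  "x \<oplus>\<^bsub>restrict_scalars \<phi> M\<^esub> y = x \<oplus>\<^bsub>M\<^esub> y"
  "a \<odot>\<^bsub>restrict_scalars \<phi> M\<^esub> x = \<phi> a \<odot>\<^bsub>M\<^esub> x"
  "finsum (restrict_scalars \<phi> M) = finsum M"
  by (auto simp: restrict_scalars_def finsum_def finprod_def fun_eq_iff)

lemma ring_mod_simps [simp]:
  "carrier (ring_mod R) = carrier R"
  "\<zero>\<^bsub>ring_mod R\<^esub> = \<zero>\<^bsub>R\<^esub>"
  "x \<oplus>\<^bsub>ring_mod R\<^esub> y = x \<oplus>\<^bsub>R\<^esub> y"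
  "a \<odot>\<^bsub>ring_mod R\<^esub> x = a \<otimes>\<^bsub>R\<^esub> x"
  "finsum (ring_mod R) = finsum R"
  "\<ominus>\<^bsub>ring_mod R\<^esub> x = \<ominus>\<^bsub>R\<^esub> x"
  by (auto simp: ring_mod_def finsum_def finprod_def a_inv_def m_inv_def fun_eq_iff)

lemma restrict_scalars_module:
  assumes "module R M" "\<phi> \<in> ring_hom R R"
  shows "module R (restrict_scalars \<phi> M)"
proof -
  interpret module R M by fact
  note \<phi> = ring_hom_closed[OF assms(2)] ring_hom_add[OF assms(2)] ring_hom_mult[OF assms(2)]
    ring_hom_one[OF assms(2)]
  have "abelian_group (restrict_scalars \<phi> M)"
  proof (rule abelian_groupI)
    fix x assume "x \<in> carrier (restrict_scalars \<phi> M)"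
    then show "\<exists>y\<in>carrier (restrict_scalars \<phi> M).
        y \<oplus>\<^bsub>restrict_scalars \<phi> M\<^esub> x = \<zero>\<^bsub>restrict_scalars \<phi> M\<^esub>"
      by (intro bexI[of _ "\<ominus>\<^bsub>M\<^esub> x"]) (auto simp: M.l_neg)
  qed (auto simp: M.a_ac)
  then show ?thesis
    by (intro moduleI[OF R.cring_axioms])
       (auto simp: \<phi> smult_l_distr smult_r_distr smult_assoc1)
qed

section \<open>Spans and the Noetherian property of free modules\<close>

definition span :: "('a, 'c) ring_scheme \<Rightarrow> ('a, 'm) module \<Rightarrow> 'm set \<Rightarrow> 'm set" where
  "span R M X = lin_comb R M (\<lambda>x. x) ` carrier (free_mod R X)"

lemma span_submodule:
  assumes "module R M" "X \<subseteq> carrier M"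
  shows "submodule (span R M X) R M"
proof -
  interpret module R M by fact
  show ?thesis unfolding span_def
    using assms(2) by (intro image_submodule[OF free_mod_module[OF R.cring_axioms] assms(1)]
        lin_comb_mod_hom[OF assms(1)]) auto
qed

lemma span_superset:
  assumes "module R M" "X \<subseteq> carrier M" "\<one>\<^bsub>R\<^esub> \<noteq> \<zero>\<^bsub>R\<^esub>"
  shows "X \<subseteq> span R M X"
proof
  fix x assume x: "x \<in> X"
  interpret module R M by fact
  have "lin_comb R M (\<lambda>x. x) (unit_vec R x) = x"
    using x assms by (intro lin_comb_unit_vec[OF assms(1)]) auto
  then show "x \<in> span R M X"
    unfolding span_def using unit_vec_closed[OF R.cring_axioms x] by (metis imageI)
qed

lemma span_mono: "X \<subseteq> Y \<Longrightarrow> span R M X \<subseteq> span R M Y"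
  unfolding span_def by (intro image_mono) (force simp: free_mod_simps)

lemma span_finite_iff:
  assumes "module R M" "finite X" "X \<subseteq> carrier M"
  shows "y \<in> span R M X \<longleftrightarrow> (\<exists>c\<in>X \<rightarrow> carrier R. y = (\<Oplus>\<^bsub>M\<^esub>x\<in>X. c x \<odot>\<^bsub>M\<^esub> x))"
proof
  interpret module R M by fact
  assume "y \<in> span R M X"
  then obtain c where c: "c \<in> carrier (free_mod R X)" "y = lin_comb R M (\<lambda>x. x) c"
    by (auto simp: span_def)
  have "y = (\<Oplus>\<^bsub>M\<^esub>x\<in>X. c x \<odot>\<^bsub>M\<^esub> x)"
    unfolding c(2) using c(1) assms by (intro lin_comb_superset) (auto simp: free_mod_simps)
  then show "\<exists>c\<in>X \<rightarrow> carrier R. y = (\<Oplus>\<^bsub>M\<^esub>x\<in>X. c x \<odot>\<^bsub>M\<^esub> x)"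
    using c(1) by (auto simp: free_mod_simps)
next
  interpret module R M by fact
  assume "\<exists>c\<in>X \<rightarrow> carrier R. y = (\<Oplus>\<^bsub>M\<^esub>x\<in>X. c x \<odot>\<^bsub>M\<^esub> x)"
  then obtain c where c: "c \<in> X \<rightarrow> carrier R" "y = (\<Oplus>\<^bsub>M\<^esub>x\<in>X. c x \<odot>\<^bsub>M\<^esub> x)" by auto
  define d where "d x = (if x \<in> X then c x else \<zero>\<^bsub>R\<^esub>)" for x
  have "finite {x. d x \<noteq> \<zero>\<^bsub>R\<^esub>}"
    by (rule finite_subset[OF _ assms(2)]) (auto simp: d_def)
  then have d: "d \<in> carrier (free_mod R X)" using c(1) by (auto simp: free_mod_simps d_def)
  have "lin_comb R M (\<lambda>x. x) d = (\<Oplus>\<^bsub>M\<^esub>x\<in>X. d x \<odot>\<^bsub>M\<^esub> x)"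
    using d assms by (intro lin_comb_superset) (auto simp: free_mod_simps)
  also have "\<dots> = y" unfolding c(2) using c(1) assms(3) by (intro M.finsum_cong') (auto simp: d_def)
  finally show "y \<in> span R M X" unfolding span_def using d by (metis imageI)
qed

lemma submodule_ring_mod_ideal:
  assumes "cring R" "submodule I R (ring_mod R)"
  shows "ideal I R"
proof -
  interpret cring R by fact
  interpret I: submodule I R "ring_mod R" by fact
  have sub: "I \<subseteq> carrier R" using I.subset by simp
  show ?thesis
  proof (rule idealI[OF ring_axioms])
    show l: "x \<otimes>\<^bsub>R\<^esub> a \<in> I" if "a \<in> I" "x \<in> carrier R" for a x
      using I.smult_closed[OF that(2,1)] unfolding ring_mod_simps .
    show "a \<otimes>\<^bsub>R\<^esub> x \<in> I" if "a \<in> I" "x \<in> carrier R" for a x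
    proof -
      have "a \<in> carrier R" using that(1) sub by blast
      then have "a \<otimes>\<^bsub>R\<^esub> x = x \<otimes>\<^bsub>R\<^esub> a" using that(2) by (rule m_comm)
      then show ?thesis using l[OF that] by (simp only:)
    qed
    show "subgroup I (add_monoid R)"
    proof (rule add.subgroupI[OF sub])
      show "I \<noteq> {}" using I.one_closed by blast
      fix a b assume a: "a \<in> I" "b \<in> I"
      have "a \<in> carrier R" using a(1) sub by blast
      then have "\<ominus>\<^bsub>R\<^esub> a = (\<ominus>\<^bsub>R\<^esub> \<one>\<^bsub>R\<^esub>) \<otimes>\<^bsub>R\<^esub> a"
        by (simp add: l_minus)
      also have "\<dots> \<in> I" by (rule l[OF a(1) a_inv_closed[OF one_closed]])
      finally show "\<ominus>\<^bsub>R\<^esub> a \<in> I" .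
      show "a \<oplus>\<^bsub>R\<^esub> b \<in> I"
        using I.m_closed[OF a] by simp
    qed
  qed
qed

text \<open>
  The linear combinations of a set form an ideal that contains the set, hence contain the smallest
  such ideal.
\<close>

lemma noetherian_ideal_span:
  assumes "cring R" "noetherian_ring R" "\<one>\<^bsub>R\<^esub> \<noteq> \<zero>\<^bsub>R\<^esub>" "submodule I R (ring_mod R)"
  obtains Y where "finite Y" "Y \<subseteq> I" "I \<subseteq> span R (ring_mod R) Y"
proof -
  interpret cring R by fact
  have I: "ideal I R" by (rule submodule_ring_mod_ideal[OF assms(1,4)])
  obtain Y where Y: "Y \<subseteq> carrier R" "finite Y" "I = Idl\<^bsub>R\<^esub> Y"
    using noetherian_ring.finetely_gen[OF assms(2) I] by auto
  have RM: "module R (ring_mod R)" by (rule ring_mod_module[OF assms(1)])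
  have span: "I \<subseteq> span R (ring_mod R) Y" unfolding Y(3)
    using Y(1) by (intro genideal_minimal submodule_ring_mod_ideal[OF assms(1)]
        span_submodule[OF RM] span_superset[OF RM _ assms(3)]) auto
  have "Y \<subseteq> I" unfolding Y(3) by (rule genideal_self[OF Y(1)])
  then show ?thesis by (rule that[OF Y(2) _ span])
qed

text \<open>
  Induction on the set \<open>I\<close> of coordinates that may be nonzero.  The values of one coordinate \<open>i\<close> on
  \<open>H\<close> form a finitely generated ideal; subtracting a combination of elements of \<open>H\<close> that lift its
  generators moves any element of \<open>H\<close> into the submodule where coordinate \<open>i\<close> vanishes, to which the
  induction hypothesis applies.  The ambient index set \<open>J\<close> stays fixed, so that all submodules of the
  induction live in the same module.
\<close>

lemma noetherian_free_submodule_fg_supported: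
  fixes R (structure)
  assumes "cring R" "noetherian_ring R" "\<one> \<noteq> \<zero>" "finite I"
    and "I \<subseteq> J" "submodule H R (free_mod R J)" "\<And>h j. h \<in> H \<Longrightarrow> j \<notin> I \<Longrightarrow> h j = \<zero>"
  shows "\<exists>X. finite X \<and> X \<subseteq> H \<and> H \<subseteq> span R (free_mod R J) X"
  using assms(4-)
proof (induction I arbitrary: H rule: finite_induct)
  case empty
  interpret cring R by fact
  have P: "module R (free_mod R J)" by (rule free_mod_module[OF assms(1)])
  interpret P: module R "free_mod R J" by (rule P)
  have "h = \<zero>\<^bsub>free_mod R J\<^esub>" if "h \<in> H" for h
    unfolding free_mod_simps by (rule ext) (rule empty.prems(3)[OF that], simp)
  moreover have "\<zero>\<^bsub>free_mod R J\<^esub> \<in> span R (free_mod R J) {}"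
    using subgroup.one_closed[OF submodule.axioms(1)[OF span_submodule[OF P]], of "{}"] by simp
  ultimately show ?case by (intro exI[of _ "{}"]) auto
next
  case (insert i I)
  interpret cring R by fact
  define P where "P = free_mod R J"
  have P: "module R P" unfolding P_def by (rule free_mod_module[OF assms(1)])
  interpret P: module R P by (rule P)
  have RM: "module R (ring_mod R)" by (rule ring_mod_module[OF assms(1)])
  have H: "submodule H R P" using insert.prems by (simp add: P_def)
  note HE = P.submoduleE[OF H]
  have PR: "h j \<in> carrier R" if "h \<in> carrier P" for h j using that by (simp add: P_def free_mod_simps)
  have ev: "(\<lambda>h. h i) \<in> mod_hom R P (ring_mod R)"
    by (auto simp: mod_hom_def P_def free_mod_simps)
  have HM: "module R (P\<lparr>carrier := H\<rparr>)" by (rule submodule.submodule_is_module[OF H P])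
  have evH: "(\<lambda>h. h i) \<in> mod_hom R (P\<lparr>carrier := H\<rparr>) (ring_mod R)"
    using ev HE(1) by (auto simp: mod_hom_def Pi_iff subset_iff)
  obtain Y where Y: "finite Y" "Y \<subseteq> (\<lambda>h. h i) ` H" "(\<lambda>h. h i) ` H \<subseteq> span R (ring_mod R) Y"
    using noetherian_ideal_span[OF assms(1-3) image_submodule[OF HM RM evH]] by auto
  define g where "g y = (SOME h. h \<in> H \<and> h i = y)" for y
  have g: "g y \<in> H" "g y i = y" if "y \<in> Y" for y
  proof -
    have "\<exists>h. h \<in> H \<and> h i = y" using Y(2) that by auto
    then show "g y \<in> H" "g y i = y" unfolding g_def by (metis (mono_tags, lifting) someI_ex)+
  qed
  have YR: "Y \<subseteq> carrier (ring_mod R)" using Y(2) HE(1) PR by auto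
  define H0 where "H0 = {h \<in> H. h i = \<zero>}"
  have H0: "submodule H0 R P"
  proof (rule P.submoduleI)
    show "H0 \<subseteq> carrier P" using HE(1) by (auto simp: H0_def)
    show "\<zero>\<^bsub>P\<^esub> \<in> H0"
      using subgroup.one_closed[OF submodule.axioms(1)[OF H]] by (simp add: H0_def P_def free_mod_simps)
  next
    fix a assume a: "a \<in> H0"
    then have "(\<ominus>\<^bsub>P\<^esub> a) i = \<zero>"
      using HE(1) mod_hom_neg[OF P RM ev, of a] by (auto simp: H0_def)
    then show "\<ominus>\<^bsub>P\<^esub> a \<in> H0" using a HE(3) by (simp add: H0_def)
  next
    fix a b assume a: "a \<in> H0" "b \<in> H0"
    then show "a \<oplus>\<^bsub>P\<^esub> b \<in> H0"
      using HE(1) HE(5)[of a b] mod_homD(2)[OF ev, of a b] by (auto simp: H0_def)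
  next
    fix a x assume a: "a \<in> carrier R" "x \<in> H0"
    then show "a \<odot>\<^bsub>P\<^esub> x \<in> H0"
      using HE(1) HE(4)[of a x] mod_homD(3)[OF ev, of a x] by (auto simp: H0_def)
  qed
  obtain X0 where X0: "finite X0" "X0 \<subseteq> H0" "H0 \<subseteq> span R P X0"
  proof -
    have "h j = \<zero>" if "h \<in> H0" "j \<notin> I" for h j
      using that insert.prems(3)[of h j] by (cases "j = i") (auto simp: H0_def)
    then show ?thesis using insert.IH[of H0] insert.prems(1) H0 that unfolding P_def by blast
  qed
  define X where "X = X0 \<union> g ` Y"
  have XH: "X \<subseteq> H" using X0(2) g(1) by (auto simp: X_def H0_def)
  have XP: "X \<subseteq> carrier P" using XH HE(1) by auto
  have spX: "submodule (span R P X) R P" by (rule span_submodule[OF P XP])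
  note spE = P.submoduleE[OF spX]
  have "h \<in> span R P X" if h: "h \<in> H" for h
  proof -
    obtain c where c: "c \<in> Y \<rightarrow> carrier R" "h i = (\<Oplus>y\<in>Y. c y \<otimes> y)"
      using Y(3) h span_finite_iff[OF RM Y(1) YR, of "h i"] by auto
    define k where "k = (\<Oplus>\<^bsub>P\<^esub>y\<in>Y. c y \<odot>\<^bsub>P\<^esub> g y)"
    have cg: "c y \<odot>\<^bsub>P\<^esub> g y \<in> H" if "y \<in> Y" for y using c(1) g(1)[OF that] HE(4) that by auto
    have kH: "k \<in> H" unfolding k_def by (rule submodule_finsum[OF P H Y(1)]) (use cg in auto)
    have "c y \<odot>\<^bsub>P\<^esub> g y \<in> span R P X" if "y \<in> Y" for y
      using that c(1) span_superset[OF P XP assms(3)] by (intro spE(4)) (auto simp: X_def)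
    then have kX: "k \<in> span R P X" unfolding k_def by (intro submodule_finsum[OF P spX Y(1)]) auto
    have "k i = (\<Oplus>y\<in>Y. (c y \<odot>\<^bsub>P\<^esub> g y) i)"
      unfolding k_def using mod_hom_finsum[OF P RM ev Y(1), of "\<lambda>y. c y \<odot>\<^bsub>P\<^esub> g y"] cg HE(1) by auto
    also have "\<dots> = h i" unfolding c(2)
      using c(1) g YR by (intro finsum_cong') (auto simp: P_def free_mod_simps)
    finally have ki: "k i = h i" .
    have hP: "h \<in> carrier P" "k \<in> carrier P" using h kH HE(1) by auto
    have "(h \<ominus>\<^bsub>P\<^esub> k) i = h i \<ominus>\<^bsub>ring_mod R\<^esub> k i" using mod_hom_diff[OF P RM ev hP] .
    also have "\<dots> = \<zero>"
      using abelian_group.r_neg[OF module.axioms(2)[OF RM], of "h i"] PR[OF hP(1)]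
      by (simp add: ki a_minus_def)
    finally have "h \<ominus>\<^bsub>P\<^esub> k \<in> H0" using h kH HE(3,5) by (auto simp: H0_def a_minus_def)
    then have "h \<ominus>\<^bsub>P\<^esub> k \<in> span R P X" using X0(3) span_mono[of X0 X] by (auto simp: X_def)
    then have "(h \<ominus>\<^bsub>P\<^esub> k) \<oplus>\<^bsub>P\<^esub> k \<in> span R P X" using kX by (rule spE(5))
    then show ?thesis using hP by (simp add: a_minus_def P.M.a_assoc P.M.l_neg)
  qed
  then show ?case using XH X0(1) Y(1) unfolding P_def[symmetric] by (intro exI[of _ X]) (auto simp: X_def)
qed

lemma noetherian_free_submodule_fg:
  assumes "cring R" "noetherian_ring R" "\<one>\<^bsub>R\<^esub> \<noteq> \<zero>\<^bsub>R\<^esub>" "finite I" "submodule H R (free_mod R I)"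
  obtains X where "finite X" "X \<subseteq> H" "H \<subseteq> span R (free_mod R I) X"
proof -
  interpret module R "free_mod R I" by (rule free_mod_module[OF assms(1)])
  have "h j = \<zero>\<^bsub>R\<^esub>" if "h \<in> H" "j \<notin> I" for h j
    using submoduleE(1)[OF assms(5)] that by (auto simp: free_mod_simps)
  then show ?thesis
    using noetherian_free_submodule_fg_supported[OF assms(1-4) order_refl assms(5)] that by blast
qed

section \<open>Quotients and base change\<close>

text \<open>
  The module laws are equations, so they pass to the image of a map that respects the operations.
\<close>

lemma module_image:
  assumes "module R M" "f \<in> mod_hom R M N" "f ` carrier M = carrier N" "f \<zero>\<^bsub>M\<^esub> = \<zero>\<^bsub>N\<^esub>"
  shows "module R N"
proof -
  interpret module R M by fact
  note f = mod_homD[OF assms(2)]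
  have lift: thesis if "y \<in> carrier N" "\<And>x. x \<in> carrier M \<Longrightarrow> y = f x \<Longrightarrow> thesis" for y thesis
    using that unfolding assms(3)[symmetric] by auto
  have "abelian_group N"
  proof (rule abelian_groupI)
    fix x y assume x: "x \<in> carrier N" and y: "y \<in> carrier N"
    obtain x' where x': "x' \<in> carrier M" "x = f x'" by (rule lift[OF x])
    obtain y' where y': "y' \<in> carrier M" "y = f y'" by (rule lift[OF y])
    show "x \<oplus>\<^bsub>N\<^esub> y = y \<oplus>\<^bsub>N\<^esub> x"
      unfolding x' y' f(2)[OF x'(1) y'(1), symmetric] f(2)[OF y'(1) x'(1), symmetric]
      using x' y' by (simp add: M.a_comm)
    show "x \<oplus>\<^bsub>N\<^esub> y \<in> carrier N"
      unfolding x' y' f(2)[OF x'(1) y'(1), symmetric] using x' y' f(1) by simp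
    fix z assume z: "z \<in> carrier N"
    obtain z' where z': "z' \<in> carrier M" "z = f z'" by (rule lift[OF z])
    have "f (x' \<oplus>\<^bsub>M\<^esub> y' \<oplus>\<^bsub>M\<^esub> z') = f (x' \<oplus>\<^bsub>M\<^esub> (y' \<oplus>\<^bsub>M\<^esub> z'))"
      using x' y' z' by (simp add: M.a_assoc)
    then show "x \<oplus>\<^bsub>N\<^esub> y \<oplus>\<^bsub>N\<^esub> z = x \<oplus>\<^bsub>N\<^esub> (y \<oplus>\<^bsub>N\<^esub> z)"
      using x' y' z' by (simp add: f(2))
  next
    show "\<zero>\<^bsub>N\<^esub> \<in> carrier N" using f(1)[OF M.zero_closed] assms(4) by simp
  next
    fix x assume x: "x \<in> carrier N"
    obtain x' where x': "x' \<in> carrier M" "x = f x'" by (rule lift[OF x])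
    have "f \<zero>\<^bsub>M\<^esub> \<oplus>\<^bsub>N\<^esub> f x' = f x'" using x'(1) by (subst f(2)[symmetric]) auto
    then show "\<zero>\<^bsub>N\<^esub> \<oplus>\<^bsub>N\<^esub> x = x" by (simp only: x' assms(4))
    have "f (\<ominus>\<^bsub>M\<^esub> x') \<oplus>\<^bsub>N\<^esub> f x' = f \<zero>\<^bsub>M\<^esub>"
      using x'(1) by (subst f(2)[symmetric]) (auto simp: M.l_neg)
    then show "\<exists>y\<in>carrier N. y \<oplus>\<^bsub>N\<^esub> x = \<zero>\<^bsub>N\<^esub>"
      using f(1) x' assms(4) by (intro bexI[of _ "f (\<ominus>\<^bsub>M\<^esub> x')"]) auto
  qed
  then show ?thesis
  proof (rule moduleI[OF R.cring_axioms])
    fix a x assume a: "a \<in> carrier R" and x: "x \<in> carrier N"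
    obtain x' where x': "x' \<in> carrier M" "x = f x'" by (rule lift[OF x])
    have "f (a \<odot>\<^bsub>M\<^esub> x') \<in> carrier N" using a x'(1) f(1) by simp
    then show "a \<odot>\<^bsub>N\<^esub> x \<in> carrier N" using a x' by (simp add: f(3))
    {
      fix y assume y: "y \<in> carrier N"
      obtain y' where y': "y' \<in> carrier M" "y = f y'" by (rule lift[OF y])
      have "f (a \<odot>\<^bsub>M\<^esub> (x' \<oplus>\<^bsub>M\<^esub> y')) = f (a \<odot>\<^bsub>M\<^esub> x' \<oplus>\<^bsub>M\<^esub> a \<odot>\<^bsub>M\<^esub> y')"
        using a x' y' by (simp add: smult_r_distr)
      then show "a \<odot>\<^bsub>N\<^esub> (x \<oplus>\<^bsub>N\<^esub> y) = a \<odot>\<^bsub>N\<^esub> x \<oplus>\<^bsub>N\<^esub> a \<odot>\<^bsub>N\<^esub> y"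
        using a x' y' by (simp add: f(2,3))
    next
      fix b assume b: "b \<in> carrier R"
      have "f ((a \<oplus>\<^bsub>R\<^esub> b) \<odot>\<^bsub>M\<^esub> x') = f (a \<odot>\<^bsub>M\<^esub> x' \<oplus>\<^bsub>M\<^esub> b \<odot>\<^bsub>M\<^esub> x')"
        using a b x' by (simp add: smult_l_distr)
      then show "(a \<oplus>\<^bsub>R\<^esub> b) \<odot>\<^bsub>N\<^esub> x = a \<odot>\<^bsub>N\<^esub> x \<oplus>\<^bsub>N\<^esub> b \<odot>\<^bsub>N\<^esub> x"
        using a b x' by (simp add: f(2,3))
      have "f ((a \<otimes>\<^bsub>R\<^esub> b) \<odot>\<^bsub>M\<^esub> x') = f (a \<odot>\<^bsub>M\<^esub> (b \<odot>\<^bsub>M\<^esub> x'))"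
        using a b x' by (simp add: smult_assoc1)
      then show "(a \<otimes>\<^bsub>R\<^esub> b) \<odot>\<^bsub>N\<^esub> x = a \<odot>\<^bsub>N\<^esub> (b \<odot>\<^bsub>N\<^esub> x)"
        using a b x' by (simp add: f(3))
    }
  next
    fix x assume x: "x \<in> carrier N"
    obtain x' where x': "x' \<in> carrier M" "x = f x'" by (rule lift[OF x])
    show "\<one>\<^bsub>R\<^esub> \<odot>\<^bsub>N\<^esub> x = x" using x' f(3)[of "\<one>\<^bsub>R\<^esub>" x'] by simp
  qed
qed

lemma quot_proj_eq_zero_iff:
  assumes "module R M" "submodule N R M" "x \<in> carrier M"
  shows "N +>\<^bsub>M\<^esub> x = N \<longleftrightarrow> x \<in> N"
proof -
  interpret module R M by fact
  interpret N: submodule N R M by fact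
  interpret nN: abelian_subgroup N M
    by (rule abelian_subgroupI3[OF additive_subgroupI[OF N.subgroup_axioms] M.abelian_group_axioms])
  show ?thesis using nN.a_rcos_const nN.a_rcos_self[OF assms(3)] by metis
qed

lemma quot_mod_module:
  assumes "module R M" "submodule N R M"
  shows "module R (quot_mod M N)"
proof -
  interpret module R M by fact
  have "N +>\<^bsub>M\<^esub> \<zero>\<^bsub>M\<^esub> = N"
    using quot_proj_eq_zero_iff[OF assms M.zero_closed] subgroup.one_closed[OF submodule.axioms(1)[OF assms(2)]]
    by simp
  then show ?thesis
    by (intro module_image[OF assms(1) quot_proj_mod_hom[OF assms]])
       (auto simp: quot_mod_def A_RCOSETS_def')
qed

lemma (in module) eq_of_diff_eq_zero:
  assumes "x \<in> carrier M" "y \<in> carrier M" "x \<ominus>\<^bsub>M\<^esub> y = \<zero>\<^bsub>M\<^esub>"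
  shows "x = y"
proof -
  have "(x \<ominus>\<^bsub>M\<^esub> y) \<oplus>\<^bsub>M\<^esub> y = x" using assms(1,2) by (simp add: a_minus_def M.a_assoc M.l_neg)
  then show ?thesis using assms(2,3) by simp
qed

lemma quot_proj_eqI:
  fixes M :: "('a, 'm) module"
  assumes "module R M" "submodule N R M" "x \<in> carrier M" "y \<in> carrier M" "x \<ominus>\<^bsub>M\<^esub> y \<in> N"
  shows "N +>\<^bsub>M\<^esub> x = N +>\<^bsub>M\<^esub> y"
proof -
  interpret M: module R M by fact
  have Q: "module R (quot_mod M N)" by (rule quot_mod_module[OF assms(1,2)])
  note pr = quot_proj_mod_hom[OF assms(1,2)]
  have "(N +>\<^bsub>M\<^esub> x) \<ominus>\<^bsub>quot_mod M N\<^esub> (N +>\<^bsub>M\<^esub> y) = N +>\<^bsub>M\<^esub> (x \<ominus>\<^bsub>M\<^esub> y)"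
    using mod_hom_diff[OF assms(1) Q pr assms(3,4)] by simp
  also have "\<dots> = \<zero>\<^bsub>quot_mod M N\<^esub>"
    using quot_proj_eq_zero_iff[OF assms(1,2)] assms(3-5) by (simp add: quot_mod_def)
  finally show ?thesis
    by (rule module.eq_of_diff_eq_zero[OF Q mod_homD(1)[OF pr assms(3)] mod_homD(1)[OF pr assms(4)]])
qed

lemma submod_gen_submodule:
  assumes "module R M" "X \<subseteq> carrier M"
  shows "submodule (submod_gen R M X) R M"
proof -
  interpret module R M by fact
  have top: "submodule (carrier M) R M" by (rule carrier_is_submodule)
  show ?thesis unfolding submod_gen_def
  proof (rule submoduleI)
    show "\<Inter> {H. submodule H R M \<and> X \<subseteq> H} \<subseteq> carrier M" using top assms(2) by auto
    show "\<zero>\<^bsub>M\<^esub> \<in> \<Inter> {H. submodule H R M \<and> X \<subseteq> H}"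
      using subgroup.one_closed[OF submodule.axioms(1)] by force
  qed (auto dest: submoduleE(3-5))
qed

lemma submod_gen_superset: "X \<subseteq> submod_gen R M X"
  by (auto simp: submod_gen_def)

lemma submod_gen_minimal: "submodule H R M \<Longrightarrow> X \<subseteq> H \<Longrightarrow> submod_gen R M X \<subseteq> H"
  by (auto simp: submod_gen_def)

lemma lin_comb_cong:
  assumes "module R M" "c \<in> carrier (free_mod R I)" "w \<in> I \<rightarrow> carrier M"
    and "\<And>i. i \<in> I \<Longrightarrow> v i = w i"
  shows "lin_comb R M v c = lin_comb R M w c"
proof -
  interpret module R M by fact
  have "c i \<odot>\<^bsub>M\<^esub> w i \<in> carrier M \<and> v i = w i" if "c i \<noteq> \<zero>\<^bsub>R\<^esub>" for i
  proof -
    have "i \<in> I" "c i \<in> carrier R" using that assms(2) by (auto simp: free_mod_simps)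
    then show ?thesis using assms(3,4) by (auto intro!: smult_closed)
  qed
  then show ?thesis unfolding lin_comb_def by (intro M.finsum_cong') auto
qed

lemma base_change_rels_submodule:
  assumes "module R M" "\<phi> \<in> ring_hom R R"
  shows "submodule (base_change_rels R R \<phi> M) R (free_mod R (carrier M))"
proof -
  interpret module R M by fact
  have P: "module R (free_mod R (carrier M))" by (rule free_mod_module[OF R.cring_axioms])
  interpret P: module R "free_mod R (carrier M)" by (rule P)
  note u = unit_vec_closed[OF R.cring_axioms]
  show ?thesis unfolding base_change_rels_def
    by (intro submod_gen_submodule[OF P])
       (auto intro!: P.M.minus_closed P.M.a_closed P.smult_closed u ring_hom_closed[OF assms(2)])
qed

lemma base_change_module:
  assumes "module R M" "\<phi> \<in> ring_hom R R"
  shows "module R (base_change R R \<phi> M)"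
proof -
  interpret module R M by fact
  show ?thesis unfolding base_change_def
    by (rule quot_mod_module[OF free_mod_module[OF R.cring_axioms] base_change_rels_submodule[OF assms]])
qed

lemma base_change_proj_mod_hom:
  assumes "module R M" "\<phi> \<in> ring_hom R R"
  shows "(\<lambda>z. base_change_rels R R \<phi> M +>\<^bsub>free_mod R (carrier M)\<^esub> z)
    \<in> mod_hom R (free_mod R (carrier M)) (base_change R R \<phi> M)"
proof -
  interpret module R M by fact
  show ?thesis unfolding base_change_def
    by (rule quot_proj_mod_hom[OF free_mod_module[OF R.cring_axioms] base_change_rels_submodule[OF assms]])
qed

text \<open>
  This is what the defining relations say: \<open>x \<mapsto> 1 \<otimes> x\<close> is additive and \<open>\<phi>\<close>-semilinear.
\<close>

lemma base_change_unit_mod_hom: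
  assumes "module R M" "\<phi> \<in> ring_hom R R"
  shows "(\<lambda>x. base_change_rels R R \<phi> M +>\<^bsub>free_mod R (carrier M)\<^esub> unit_vec R x)
    \<in> mod_hom R M (restrict_scalars \<phi> (base_change R R \<phi> M))"
proof -
  interpret module R M by fact
  let ?P = "free_mod R (carrier M)"
  have P: "module R ?P" by (rule free_mod_module[OF R.cring_axioms])
  interpret P: module R ?P by (rule P)
  note u = unit_vec_closed[OF R.cring_axioms]
  note sub = base_change_rels_submodule[OF assms]
  note pr = mod_homD[OF base_change_proj_mod_hom[OF assms]]
  note eqI = quot_proj_eqI[OF P sub]
  show ?thesis
  proof (unfold mod_hom_def restrict_scalars_simps, intro CollectI conjI ballI funcsetI)
    fix x assume x: "x \<in> carrier M"
    show "base_change_rels R R \<phi> M +>\<^bsub>?P\<^esub> unit_vec R x \<in> carrier (base_change R R \<phi> M)"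
      by (rule pr(1)[OF u[OF x]])
    fix y assume y: "y \<in> carrier M"
    have "base_change_rels R R \<phi> M +>\<^bsub>?P\<^esub> unit_vec R (x \<oplus>\<^bsub>M\<^esub> y)
        = base_change_rels R R \<phi> M +>\<^bsub>?P\<^esub> (unit_vec R x \<oplus>\<^bsub>?P\<^esub> unit_vec R y)"
    proof (intro eqI P.M.a_closed u M.a_closed x y)
      show "unit_vec R (x \<oplus>\<^bsub>M\<^esub> y) \<ominus>\<^bsub>?P\<^esub> (unit_vec R x \<oplus>\<^bsub>?P\<^esub> unit_vec R y) \<in> base_change_rels R R \<phi> M"
        unfolding base_change_rels_def using x y by (intro subsetD[OF submod_gen_superset]) blast
    qed
    then show "base_change_rels R R \<phi> M +>\<^bsub>?P\<^esub> unit_vec R (x \<oplus>\<^bsub>M\<^esub> y)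
        = (base_change_rels R R \<phi> M +>\<^bsub>?P\<^esub> unit_vec R x) \<oplus>\<^bsub>base_change R R \<phi> M\<^esub>
          (base_change_rels R R \<phi> M +>\<^bsub>?P\<^esub> unit_vec R y)"
      unfolding pr(2)[OF u[OF x] u[OF y], symmetric] .
  next
    fix a x assume a: "a \<in> carrier R" and x: "x \<in> carrier M"
    have "base_change_rels R R \<phi> M +>\<^bsub>?P\<^esub> unit_vec R (a \<odot>\<^bsub>M\<^esub> x)
        = base_change_rels R R \<phi> M +>\<^bsub>?P\<^esub> (\<phi> a \<odot>\<^bsub>?P\<^esub> unit_vec R x)"
    proof (intro eqI P.smult_closed u smult_closed ring_hom_closed[OF assms(2)] a x)
      show "unit_vec R (a \<odot>\<^bsub>M\<^esub> x) \<ominus>\<^bsub>?P\<^esub> (\<phi> a \<odot>\<^bsub>?P\<^esub> unit_vec R x) \<in> base_change_rels R R \<phi> M"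
        unfolding base_change_rels_def using a x by (intro subsetD[OF submod_gen_superset]) blast
    qed
    then show "base_change_rels R R \<phi> M +>\<^bsub>?P\<^esub> unit_vec R (a \<odot>\<^bsub>M\<^esub> x)
        = \<phi> a \<odot>\<^bsub>base_change R R \<phi> M\<^esub> (base_change_rels R R \<phi> M +>\<^bsub>?P\<^esub> unit_vec R x)"
      unfolding pr(3)[OF ring_hom_closed[OF assms(2) a] u[OF x], symmetric] .
  qed
qed

text \<open>
  Combined with the semilinearity of \<open>x \<mapsto> 1 \<otimes> x\<close>, this replaces computations with cosets of formal
  combinations by computations in the module \<open>A \<otimes> M\<close>, here with \<open>A = R\<close>.
\<close>

lemma base_change_class:
  assumes "module R M" "\<phi> \<in> ring_hom R R" "z \<in> carrier (free_mod R (carrier M))"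
  shows "base_change_rels R R \<phi> M +>\<^bsub>free_mod R (carrier M)\<^esub> z
    = lin_comb R (base_change R R \<phi> M)
        (\<lambda>x. base_change_rels R R \<phi> M +>\<^bsub>free_mod R (carrier M)\<^esub> unit_vec R x) z"
proof -
  interpret module R M by fact
  have P: "module R (free_mod R (carrier M))" by (rule free_mod_module[OF R.cring_axioms])
  have u: "unit_vec R \<in> carrier M \<rightarrow> carrier (free_mod R (carrier M))"
    by (intro funcsetI unit_vec_closed[OF R.cring_axioms])
  show ?thesis
    using mod_hom_lin_comb[OF P base_change_module[OF assms(1,2)] base_change_proj_mod_hom[OF assms(1,2)] assms(3) u]
    unfolding lin_comb_free_mod_unit_vec[OF R.cring_axioms assms(3)] .
qed

section \<open>Base change of a dual module\<close>

lemma dual_mod_simps: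
  "u \<in> carrier (dual_mod R M) \<longleftrightarrow> u \<in> mod_hom R M (ring_mod R) \<and> u \<in> extensional (carrier M)"
  "\<zero>\<^bsub>dual_mod R M\<^esub> = (\<lambda>x\<in>carrier M. \<zero>\<^bsub>R\<^esub>)"
  "u \<oplus>\<^bsub>dual_mod R M\<^esub> v = (\<lambda>x\<in>carrier M. u x \<oplus>\<^bsub>R\<^esub> v x)"
  "a \<odot>\<^bsub>dual_mod R M\<^esub> u = (\<lambda>x\<in>carrier M. a \<otimes>\<^bsub>R\<^esub> u x)"
  by (auto simp: dual_mod_def)

lemma dual_apply_closed: "u \<in> carrier (dual_mod R M) \<Longrightarrow> x \<in> carrier M \<Longrightarrow> u x \<in> carrier R"
  using mod_homD(1)[of u R M "ring_mod R" x] by (simp add: dual_mod_simps)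

lemma dual_apply_add:
  "u \<in> carrier (dual_mod R M) \<Longrightarrow> x \<in> carrier M \<Longrightarrow> y \<in> carrier M \<Longrightarrow> u (x \<oplus>\<^bsub>M\<^esub> y) = u x \<oplus>\<^bsub>R\<^esub> u y"
  using mod_homD(2)[of u R M "ring_mod R" x y] by (simp add: dual_mod_simps)

lemma dual_apply_smult:
  "u \<in> carrier (dual_mod R M) \<Longrightarrow> a \<in> carrier R \<Longrightarrow> x \<in> carrier M \<Longrightarrow> u (a \<odot>\<^bsub>M\<^esub> x) = a \<otimes>\<^bsub>R\<^esub> u x"
  using mod_homD(3)[of u R M "ring_mod R" a x] by (simp add: dual_mod_simps)

lemma restrict_in_dual:
  assumes "module R M" "f \<in> mod_hom R M (ring_mod R)"
  shows "restrict f (carrier M) \<in> carrier (dual_mod R M)"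
proof -
  interpret module R M by fact
  show ?thesis using assms(2) by (auto simp: dual_mod_simps mod_hom_def)
qed

lemma dual_eqI:
  assumes "u \<in> carrier (dual_mod R M)" "v \<in> carrier (dual_mod R M)"
    "\<And>x. x \<in> carrier M \<Longrightarrow> u x = v x"
  shows "u = v"
  using assms by (intro extensionalityI) (auto simp: dual_mod_simps)

lemma dual_module:
  assumes "module R M"
  shows "module R (dual_mod R M)"
proof -
  interpret module R M by fact
  note cl = dual_apply_closed[of _ R M]
  have in_dual: "restrict f (carrier M) \<in> carrier (dual_mod R M)"
    if "\<And>x. x \<in> carrier M \<Longrightarrow> f x \<in> carrier R"
      "\<And>x y. x \<in> carrier M \<Longrightarrow> y \<in> carrier M \<Longrightarrow> f (x \<oplus>\<^bsub>M\<^esub> y) = f x \<oplus>\<^bsub>R\<^esub> f y"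
      "\<And>a x. a \<in> carrier R \<Longrightarrow> x \<in> carrier M \<Longrightarrow> f (a \<odot>\<^bsub>M\<^esub> x) = a \<otimes>\<^bsub>R\<^esub> f x" for f
    using that by (intro restrict_in_dual[OF assms]) (auto simp: mod_hom_def)
  note add = dual_apply_add[of _ R M] and sm = dual_apply_smult[of _ R M]
  have add_closed: "u \<oplus>\<^bsub>dual_mod R M\<^esub> v \<in> carrier (dual_mod R M)"
    if u: "u \<in> carrier (dual_mod R M)" and v: "v \<in> carrier (dual_mod R M)" for u v
    unfolding dual_mod_simps(3) using cl[OF u] cl[OF v]
    by (intro in_dual) (auto simp: add[OF u] add[OF v] sm[OF u] sm[OF v] R.a_ac R.r_distr)
  have smult_closed: "a \<odot>\<^bsub>dual_mod R M\<^esub> u \<in> carrier (dual_mod R M)"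
    if a: "a \<in> carrier R" and u: "u \<in> carrier (dual_mod R M)" for a u
    unfolding dual_mod_simps(4) using cl[OF u] a
    by (intro in_dual) (auto simp: add[OF u] sm[OF u] R.r_distr R.m_lcomm)
  have zero_closed: "\<zero>\<^bsub>dual_mod R M\<^esub> \<in> carrier (dual_mod R M)"
    unfolding dual_mod_simps(2) by (intro in_dual) auto
  have "abelian_group (dual_mod R M)"
  proof (rule abelian_groupI)
    fix u v w assume u: "u \<in> carrier (dual_mod R M)" and v: "v \<in> carrier (dual_mod R M)"
    show "u \<oplus>\<^bsub>dual_mod R M\<^esub> v = v \<oplus>\<^bsub>dual_mod R M\<^esub> u"
      unfolding dual_mod_simps(3) using cl[OF u] cl[OF v] by (auto simp: R.a_comm)
    assume w: "w \<in> carrier (dual_mod R M)"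
    show "u \<oplus>\<^bsub>dual_mod R M\<^esub> v \<oplus>\<^bsub>dual_mod R M\<^esub> w = u \<oplus>\<^bsub>dual_mod R M\<^esub> (v \<oplus>\<^bsub>dual_mod R M\<^esub> w)"
      unfolding dual_mod_simps(3) using cl[OF u] cl[OF v] cl[OF w] by (auto simp: R.a_assoc)
  next
    fix u assume u: "u \<in> carrier (dual_mod R M)"
    show "\<zero>\<^bsub>dual_mod R M\<^esub> \<oplus>\<^bsub>dual_mod R M\<^esub> u = u"
      using cl[OF u] u by (intro dual_eqI[OF add_closed[OF zero_closed u] u]) (auto simp: dual_mod_simps(2,3))
    have m: "(\<lambda>x\<in>carrier M. \<ominus>\<^bsub>R\<^esub> u x) \<in> carrier (dual_mod R M)"
      using cl[OF u] by (intro in_dual) (auto simp: add[OF u] sm[OF u] R.minus_add R.r_minus)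
    show "\<exists>v\<in>carrier (dual_mod R M). v \<oplus>\<^bsub>dual_mod R M\<^esub> u = \<zero>\<^bsub>dual_mod R M\<^esub>"
      using cl[OF u] by (intro bexI[OF _ m] dual_eqI[OF add_closed[OF m u] zero_closed])
        (auto simp: dual_mod_simps(2,3) R.l_neg)
  qed (use add_closed zero_closed in auto)
  then show ?thesis
  proof (rule moduleI[OF R.cring_axioms])
    fix a b u v assume a: "a \<in> carrier R" and u: "u \<in> carrier (dual_mod R M)"
    {
      assume b: "b \<in> carrier R"
      show "(a \<oplus>\<^bsub>R\<^esub> b) \<odot>\<^bsub>dual_mod R M\<^esub> u
          = a \<odot>\<^bsub>dual_mod R M\<^esub> u \<oplus>\<^bsub>dual_mod R M\<^esub> b \<odot>\<^bsub>dual_mod R M\<^esub> u"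
        unfolding dual_mod_simps(3,4) using cl[OF u] a b by (auto simp: R.l_distr)
      show "(a \<otimes>\<^bsub>R\<^esub> b) \<odot>\<^bsub>dual_mod R M\<^esub> u = a \<odot>\<^bsub>dual_mod R M\<^esub> (b \<odot>\<^bsub>dual_mod R M\<^esub> u)"
        unfolding dual_mod_simps(3,4) using cl[OF u] a b by (auto simp: R.m_assoc)
    next
      assume v: "v \<in> carrier (dual_mod R M)"
      show "a \<odot>\<^bsub>dual_mod R M\<^esub> (u \<oplus>\<^bsub>dual_mod R M\<^esub> v)
          = a \<odot>\<^bsub>dual_mod R M\<^esub> u \<oplus>\<^bsub>dual_mod R M\<^esub> a \<odot>\<^bsub>dual_mod R M\<^esub> v"
        unfolding dual_mod_simps(3,4) using cl[OF u] cl[OF v] a by (auto simp: R.r_distr)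
    }
  next
    fix u assume u: "u \<in> carrier (dual_mod R M)"
    show "\<one>\<^bsub>R\<^esub> \<odot>\<^bsub>dual_mod R M\<^esub> u = u"
      using cl[OF u] by (intro dual_eqI[OF smult_closed[OF R.one_closed u] u]) (auto simp: dual_mod_simps(4))
  qed (use smult_closed in auto)
qed

lemma dual_eval_mod_hom:
  "x \<in> carrier M \<Longrightarrow> (\<lambda>u. u x) \<in> mod_hom R (dual_mod R M) (ring_mod R)"
  by (auto simp: mod_hom_def dual_mod_simps(3,4) dual_apply_closed)

lemma dual_extend:
  assumes "module R M" "is_basis R M B" "\<one>\<^bsub>R\<^esub> \<noteq> \<zero>\<^bsub>R\<^esub>" "h \<in> B \<rightarrow> carrier R"
  obtains u where "u \<in> carrier (dual_mod R M)" "\<And>b. b \<in> B \<Longrightarrow> u b = h b"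
proof -
  interpret module R M by fact
  obtain f where f: "f \<in> mod_hom R M (ring_mod R)" "\<And>b. b \<in> B \<Longrightarrow> f b = h b"
    using basis_extend[OF assms(1) ring_mod_module[OF R.cring_axioms] assms(2,3), of h] assms(4) by auto
  have "B \<subseteq> carrier M" using assms(2) by (simp add: is_basis_def)
  then have "restrict f (carrier M) b = h b" if "b \<in> B" for b using f(2)[OF that] that by auto
  then show ?thesis by (rule that[OF restrict_in_dual[OF assms(1) f(1)]])
qed

text \<open>
  For a module \<open>M\<close> and \<open>x \<in> M\<close>, evaluation at \<open>x\<close> is a linear map from the dual of \<open>M\<close> to \<open>R\<close>, and its
  base change along \<open>\<phi>\<close> is the linear map \<open>a \<otimes> u \<mapsto> a \<phi>(u(x))\<close>.  The function below is this map, read on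
  formal combinations \<open>z\<close> of functionals.  For a basis of \<open>M\<close>, the dual is a product of copies of \<open>R\<close>, and
  the evaluations at the basis elements are the components of the comparison map from the base change
  of that product to the product.
\<close>

definition twisted_eval :: "('a, 'c) ring_scheme \<Rightarrow> ('a \<Rightarrow> 'a) \<Rightarrow> 'm \<Rightarrow> (('m \<Rightarrow> 'a) \<Rightarrow> 'a) \<Rightarrow> 'a" where
  "twisted_eval R \<phi> x z = lin_comb R (ring_mod R) (\<lambda>u. \<phi> (u x)) z"

lemma twisted_eval_mod_hom:
  assumes "cring R" "\<phi> \<in> ring_hom R R" "N \<subseteq> carrier (dual_mod R M)" "x \<in> carrier M"
  shows "twisted_eval R \<phi> x \<in> mod_hom R (free_mod R N) (ring_mod R)"
proof -
  have "(\<lambda>u. \<phi> (u x)) \<in> N \<rightarrow> carrier (ring_mod R)"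
    using assms(3) dual_apply_closed[OF _ assms(4)] ring_hom_closed[OF assms(2)] by fastforce
  then show ?thesis unfolding twisted_eval_def[abs_def]
    by (rule lin_comb_mod_hom[OF ring_mod_module[OF assms(1)]])
qed

lemma twisted_eval_unit_vec:
  assumes "cring R" "\<phi> \<in> ring_hom R R" "\<one>\<^bsub>R\<^esub> \<noteq> \<zero>\<^bsub>R\<^esub>" "u \<in> carrier (dual_mod R M)" "x \<in> carrier M"
  shows "twisted_eval R \<phi> x (unit_vec R u) = \<phi> (u x)"
  unfolding twisted_eval_def
  using ring_hom_closed[OF assms(2) dual_apply_closed[OF assms(4,5)]] assms(3)
  by (intro lin_comb_unit_vec[OF ring_mod_module[OF assms(1)], where v = "\<lambda>u. \<phi> (u x)" and i = u]) simp_all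

text \<open>
  With \<open>mod_hom_eq_on_basis\<close>, this propagates an identity between components from the elements of a
  basis to all elements of the module.
\<close>

lemma twisted_eval_semilinear:
  assumes "cring R" "\<phi> \<in> ring_hom R R" "z \<in> carrier (free_mod R (carrier (dual_mod R M)))"
  shows "(\<lambda>x. twisted_eval R \<phi> x z) \<in> mod_hom R M (restrict_scalars \<phi> (ring_mod R))"
proof -
  interpret cring R by fact
  let ?U = "{u. z u \<noteq> \<zero>\<^bsub>R\<^esub>}"
  have fin: "finite ?U" and zR: "\<And>u. z u \<in> carrier R" and sub: "\<And>u. z u \<noteq> \<zero>\<^bsub>R\<^esub> \<Longrightarrow> u \<in> carrier (dual_mod R M)"
    using assms(3) by (auto simp: free_mod_simps)
  note \<phi> = ring_hom_closed[OF assms(2)] ring_hom_add[OF assms(2)] ring_hom_mult[OF assms(2)]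
  have cl: "\<phi> (u x) \<in> carrier R" "u x \<in> carrier R" if "z u \<noteq> \<zero>\<^bsub>R\<^esub>" "x \<in> carrier M" for u x
    using dual_apply_closed[OF sub[OF that(1)] that(2)] \<phi>(1) by auto
  have ev: "twisted_eval R \<phi> x z = (\<Oplus>\<^bsub>R\<^esub>u\<in>?U. z u \<otimes>\<^bsub>R\<^esub> \<phi> (u x))" for x
    by (simp add: twisted_eval_def lin_comb_def)
  show ?thesis unfolding mod_hom_def ev
  proof (intro CollectI conjI ballI funcsetI)
    fix x assume x: "x \<in> carrier M"
    show "(\<Oplus>\<^bsub>R\<^esub>u\<in>?U. z u \<otimes>\<^bsub>R\<^esub> \<phi> (u x)) \<in> carrier (restrict_scalars \<phi> (ring_mod R))"
      using cl zR x by (auto intro!: finsum_closed)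
    fix y assume y: "y \<in> carrier M"
    have "(\<Oplus>\<^bsub>R\<^esub>u\<in>?U. z u \<otimes>\<^bsub>R\<^esub> \<phi> (u (x \<oplus>\<^bsub>M\<^esub> y)))
        = (\<Oplus>\<^bsub>R\<^esub>u\<in>?U. z u \<otimes>\<^bsub>R\<^esub> \<phi> (u x) \<oplus>\<^bsub>R\<^esub> z u \<otimes>\<^bsub>R\<^esub> \<phi> (u y))"
    proof (intro finsum_cong' refl)
      fix u assume u: "u \<in> ?U"
      then have "u (x \<oplus>\<^bsub>M\<^esub> y) = u x \<oplus>\<^bsub>R\<^esub> u y"
        using sub[of u] x y by (simp add: dual_apply_add)
      then show "z u \<otimes>\<^bsub>R\<^esub> \<phi> (u (x \<oplus>\<^bsub>M\<^esub> y)) = z u \<otimes>\<^bsub>R\<^esub> \<phi> (u x) \<oplus>\<^bsub>R\<^esub> z u \<otimes>\<^bsub>R\<^esub> \<phi> (u y)"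
        using cl[of u] u x y zR by (simp add: \<phi>(2) r_distr)
    qed (use cl zR x y in auto)
    also have "\<dots> = (\<Oplus>\<^bsub>R\<^esub>u\<in>?U. z u \<otimes>\<^bsub>R\<^esub> \<phi> (u x)) \<oplus>\<^bsub>R\<^esub> (\<Oplus>\<^bsub>R\<^esub>u\<in>?U. z u \<otimes>\<^bsub>R\<^esub> \<phi> (u y))"
      using cl zR x y by (intro finsum_addf) auto
    finally show "(\<Oplus>\<^bsub>R\<^esub>u\<in>?U. z u \<otimes>\<^bsub>R\<^esub> \<phi> (u (x \<oplus>\<^bsub>M\<^esub> y)))
        = (\<Oplus>\<^bsub>R\<^esub>u\<in>?U. z u \<otimes>\<^bsub>R\<^esub> \<phi> (u x)) \<oplus>\<^bsub>restrict_scalars \<phi> (ring_mod R)\<^esub>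
          (\<Oplus>\<^bsub>R\<^esub>u\<in>?U. z u \<otimes>\<^bsub>R\<^esub> \<phi> (u y))" by simp
  next
    fix a x assume a: "a \<in> carrier R" and x: "x \<in> carrier M"
    have "(\<Oplus>\<^bsub>R\<^esub>u\<in>?U. z u \<otimes>\<^bsub>R\<^esub> \<phi> (u (a \<odot>\<^bsub>M\<^esub> x)))
        = (\<Oplus>\<^bsub>R\<^esub>u\<in>?U. \<phi> a \<otimes>\<^bsub>R\<^esub> (z u \<otimes>\<^bsub>R\<^esub> \<phi> (u x)))"
    proof (intro finsum_cong' refl)
      fix u assume u: "u \<in> ?U"
      then have "u (a \<odot>\<^bsub>M\<^esub> x) = a \<otimes>\<^bsub>R\<^esub> u x"
        using sub[of u] x a by (simp add: dual_apply_smult)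
      then show "z u \<otimes>\<^bsub>R\<^esub> \<phi> (u (a \<odot>\<^bsub>M\<^esub> x)) = \<phi> a \<otimes>\<^bsub>R\<^esub> (z u \<otimes>\<^bsub>R\<^esub> \<phi> (u x))"
        using cl[of u] u x a zR \<phi>(1) by (simp add: \<phi>(3) m_lcomm)
    qed (use cl zR x a \<phi>(1) in auto)
    also have "\<dots> = \<phi> a \<otimes>\<^bsub>R\<^esub> (\<Oplus>\<^bsub>R\<^esub>u\<in>?U. z u \<otimes>\<^bsub>R\<^esub> \<phi> (u x))"
      using cl zR x a fin \<phi>(1) by (intro finsum_rdistr[symmetric]) auto
    finally show "(\<Oplus>\<^bsub>R\<^esub>u\<in>?U. z u \<otimes>\<^bsub>R\<^esub> \<phi> (u (a \<odot>\<^bsub>M\<^esub> x)))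
        = a \<odot>\<^bsub>restrict_scalars \<phi> (ring_mod R)\<^esub> (\<Oplus>\<^bsub>R\<^esub>u\<in>?U. z u \<otimes>\<^bsub>R\<^esub> \<phi> (u x))" by simp
  qed
qed

text \<open>
  The comparison map from the base change of a product of copies of \<open>R\<close> to the product is injective
  when \<open>R\<close> is Noetherian.  Let the difference \<open>z = \<Sum>\<^sub>u z(u) \<otimes> u\<close> of the two elements have
  all components \<open>\<Sum>\<^sub>u z(u) \<phi>(u(b))\<close> equal to zero.  Only finitely many \<open>u\<close> occur, so the tuples \<open>(k\<^sub>u)\<close> with \<open>\<Sum>\<^sub>u z(u) \<phi>(k\<^sub>u) = 0\<close> form a submodule of a
  finite free module, generated by finitely many tuples \<open>x\<close>.  For each basis element \<open>b\<close> the tuple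
  \<open>(u(b))\<^sub>u\<close> is one of them; collecting its coefficients over all \<open>b\<close> gives functionals \<open>d\<^sub>x\<close> with
  \<open>u = \<Sum>\<^sub>x x\<^sub>u d\<^sub>x\<close>, where the same finitely many \<open>d\<^sub>x\<close> serve all \<open>u\<close>.  Hence the class of \<open>z\<close> is
  \<open>\<Sum>\<^sub>x (\<Sum>\<^sub>u z(u) \<phi>(x\<^sub>u)) (1 \<otimes> d\<^sub>x) = 0\<close>.
\<close>

lemma base_change_dual_eqI:
  assumes cr: "cring R" "noetherian_ring R" "\<one>\<^bsub>R\<^esub> \<noteq> \<zero>\<^bsub>R\<^esub>" and \<phi>: "\<phi> \<in> ring_hom R R"
    and M: "module R M" "is_basis R M B"
    and y: "y \<in> carrier (free_mod R (carrier (dual_mod R M)))"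
    and y': "y' \<in> carrier (free_mod R (carrier (dual_mod R M)))"
    and eq: "\<And>b. b \<in> B \<Longrightarrow> twisted_eval R \<phi> b y = twisted_eval R \<phi> b y'"
  shows "base_change_rels R R \<phi> (dual_mod R M) +>\<^bsub>free_mod R (carrier (dual_mod R M))\<^esub> y
    = base_change_rels R R \<phi> (dual_mod R M) +>\<^bsub>free_mod R (carrier (dual_mod R M))\<^esub> y'"
proof -
  interpret R: cring R by fact
  define D where "D = dual_mod R M"
  define P where "P = free_mod R (carrier D)"
  define Q where "Q = base_change R R \<phi> D"
  define \<kappa> where "\<kappa> u = base_change_rels R R \<phi> D +>\<^bsub>P\<^esub> unit_vec R u" for u
  define N where "N = restrict_scalars \<phi> (ring_mod R)"
  have D: "module R D" unfolding D_def by (rule dual_module[OF M(1)])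
  have P: "module R P" unfolding P_def by (rule free_mod_module[OF cr(1)])
  have Q: "module R Q" unfolding Q_def by (rule base_change_module[OF D \<phi>])
  have RM: "module R (ring_mod R)" by (rule ring_mod_module[OF cr(1)])
  have N: "module R N" unfolding N_def by (rule restrict_scalars_module[OF RM \<phi>])
  interpret D: module R D by (rule D)
  interpret P: module R P by (rule P)
  interpret Q: module R Q by (rule Q)
  have B: "B \<subseteq> carrier M" using M(2) by (simp add: is_basis_def)
  have \<kappa>: "\<kappa> \<in> mod_hom R D (restrict_scalars \<phi> Q)"
    unfolding \<kappa>_def P_def Q_def by (rule base_change_unit_mod_hom[OF D \<phi>])
  have pr: "(\<lambda>z. base_change_rels R R \<phi> D +>\<^bsub>P\<^esub> z) \<in> mod_hom R P Q"
    unfolding P_def Q_def by (rule base_change_proj_mod_hom[OF D \<phi>])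
  define z where "z = y \<ominus>\<^bsub>P\<^esub> y'"
  have yP: "y \<in> carrier P" "y' \<in> carrier P" using y y' by (simp_all add: P_def D_def)
  then have z: "z \<in> carrier P" unfolding z_def by simp
  define U where "U = {u. z u \<noteq> \<zero>\<^bsub>R\<^esub>}"
  have finU: "finite U" and zR: "\<And>u. z u \<in> carrier R" and UD: "\<And>u. u \<in> U \<Longrightarrow> u \<in> carrier D"
    using z by (auto simp: P_def free_mod_simps U_def)
  have ub: "u b \<in> carrier R" if "u \<in> U" "b \<in> B" for u b
    using dual_apply_closed[of u R M b] UD[OF that(1)] that(2) B by (auto simp: D_def)
  have ev0: "twisted_eval R \<phi> b z = \<zero>\<^bsub>R\<^esub>" if b: "b \<in> B" for b
  proof -
    have bM: "b \<in> carrier M" using b B by auto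
    have te: "twisted_eval R \<phi> b \<in> mod_hom R P (ring_mod R)"
      unfolding P_def by (rule twisted_eval_mod_hom[OF cr(1) \<phi> _ bM]) (simp add: D_def)
    have "twisted_eval R \<phi> b z = twisted_eval R \<phi> b y \<ominus>\<^bsub>ring_mod R\<^esub> twisted_eval R \<phi> b y'"
      unfolding z_def by (rule mod_hom_diff[OF P RM te yP])
    then show ?thesis
      using mod_homD(1)[OF te yP(2)] by (simp add: eq[OF b] a_minus_def R.r_neg)
  qed
  have evz: "twisted_eval R \<phi> b z = (\<Oplus>\<^bsub>R\<^esub>u\<in>U. z u \<otimes>\<^bsub>R\<^esub> \<phi> (u b))" for b
    by (simp add: twisted_eval_def lin_comb_def U_def)

  define F where "F = free_mod R U"
  have F: "module R F" unfolding F_def by (rule free_mod_module[OF cr(1)])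
  interpret F: module R F by (rule F)
  have zN: "z \<in> U \<rightarrow> carrier N" using zR by (auto simp: N_def)
  have l: "lin_comb R N z \<in> mod_hom R F N" unfolding F_def by (rule lin_comb_mod_hom[OF N zN])
  have l_eq: "lin_comb R N z c = (\<Oplus>\<^bsub>R\<^esub>u\<in>U. z u \<otimes>\<^bsub>R\<^esub> \<phi> (c u))" if c: "c \<in> carrier F" for c
  proof -
    have cR: "c u \<in> carrier R" for u using c by (auto simp: F_def free_mod_simps)
    have "lin_comb R N z c = (\<Oplus>\<^bsub>N\<^esub>u\<in>U. c u \<odot>\<^bsub>N\<^esub> z u)"
      using c zR by (intro lin_comb_superset[OF N finU]) (auto simp: F_def free_mod_simps N_def)
    also have "\<dots> = (\<Oplus>\<^bsub>R\<^esub>u\<in>U. \<phi> (c u) \<otimes>\<^bsub>R\<^esub> z u)" by (simp add: N_def)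
    also have "\<dots> = (\<Oplus>\<^bsub>R\<^esub>u\<in>U. z u \<otimes>\<^bsub>R\<^esub> \<phi> (c u))"
      using cR zR ring_hom_closed[OF \<phi>] by (intro R.finsum_cong' refl R.m_comm) auto
    finally show ?thesis .
  qed
  define K where "K = {c \<in> carrier F. lin_comb R N z c = \<zero>\<^bsub>N\<^esub>}"
  have K: "submodule K R F" unfolding K_def by (rule kernel_submodule[OF F N l])
  obtain X where X: "finite X" "X \<subseteq> K" "K \<subseteq> span R F X"
    using noetherian_free_submodule_fg[OF cr finU K[unfolded F_def]] unfolding F_def .
  have XF: "X \<subseteq> carrier F" using X(2) by (auto simp: K_def)
  have xR: "x u \<in> carrier R" if "x \<in> X" for x u using XF that by (auto simp: F_def free_mod_simps)

  \<comment> \<open>The tuple \<open>(u(b))\<^sub>u\<close>, extended by zero to an element of the free module on \<open>U\<close>.\<close>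
  define w where "w b u = (if u \<in> U then u b else \<zero>\<^bsub>R\<^esub>)" for b u
  have w: "w b \<in> span R F X" if b: "b \<in> B" for b
  proof -
    have "finite {u. w b u \<noteq> \<zero>\<^bsub>R\<^esub>}" by (rule finite_subset[OF _ finU]) (auto simp: w_def)
    then have wF: "w b \<in> carrier F" using ub[OF _ b] by (auto simp: F_def free_mod_simps w_def)
    have "lin_comb R N z (w b) = (\<Oplus>\<^bsub>R\<^esub>u\<in>U. z u \<otimes>\<^bsub>R\<^esub> \<phi> (u b))"
      unfolding l_eq[OF wF] using zR ub[OF _ b] ring_hom_closed[OF \<phi>]
      by (intro R.finsum_cong' refl) (auto simp: w_def)
    also have "\<dots> = \<zero>\<^bsub>N\<^esub>" using ev0[OF b] evz by (simp add: N_def)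
    finally have "w b \<in> K" using wF by (simp add: K_def)
    then show ?thesis using X(3) by auto
  qed
  have "\<forall>b\<in>B. \<exists>c. c \<in> X \<rightarrow> carrier R \<and> w b = (\<Oplus>\<^bsub>F\<^esub>x\<in>X. c x \<odot>\<^bsub>F\<^esub> x)"
    using w span_finite_iff[OF F X(1) XF] by (simp add: Bex_def)
  from bchoice[OF this] obtain c where c: "b \<in> B \<Longrightarrow> c b \<in> X \<rightarrow> carrier R"
      "b \<in> B \<Longrightarrow> w b = (\<Oplus>\<^bsub>F\<^esub>x\<in>X. c b x \<odot>\<^bsub>F\<^esub> x)" for b
    by blast
  have "\<forall>x\<in>X. \<exists>d. d \<in> carrier D \<and> (\<forall>b\<in>B. d b = c b x)"
  proof
    fix x assume "x \<in> X"
    then have "(\<lambda>b. c b x) \<in> B \<rightarrow> carrier R" using c(1) by auto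
    then obtain d where "d \<in> carrier D" "\<And>b. b \<in> B \<Longrightarrow> d b = c b x"
      using dual_extend[OF M cr(3)] unfolding D_def by blast
    then show "\<exists>d. d \<in> carrier D \<and> (\<forall>b\<in>B. d b = c b x)" by blast
  qed
  from bchoice[OF this] obtain d
    where d: "x \<in> X \<Longrightarrow> d x \<in> carrier D" "x \<in> X \<Longrightarrow> b \<in> B \<Longrightarrow> d x b = c b x" for x b
    by blast
  have uD: "u = (\<Oplus>\<^bsub>D\<^esub>x\<in>X. x u \<odot>\<^bsub>D\<^esub> d x)" if u: "u \<in> U" for u
  proof -
    let ?s = "\<Oplus>\<^bsub>D\<^esub>x\<in>X. x u \<odot>\<^bsub>D\<^esub> d x"
    have t: "(\<lambda>x. x u \<odot>\<^bsub>D\<^esub> d x) \<in> X \<rightarrow> carrier D" using xR d(1) by auto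
    then have s: "?s \<in> carrier D" by (rule D.M.finsum_closed)
    have "?s b = u b" if b: "b \<in> B" for b
    proof -
      have bM: "b \<in> carrier M" using b B by auto
      have dR: "d x b \<in> carrier R" if "x \<in> X" for x
        using dual_apply_closed[of "d x" R M b] d(1)[OF that] bM by (simp add: D_def)
      have ev: "(\<lambda>u. u b) \<in> mod_hom R D (ring_mod R)"
        unfolding D_def by (rule dual_eval_mod_hom[OF bM])
      have "?s b = (\<Oplus>\<^bsub>ring_mod R\<^esub>x\<in>X. (x u \<odot>\<^bsub>D\<^esub> d x) b)"
        by (rule mod_hom_finsum[OF D RM ev X(1) t])
      also have "\<dots> = (\<Oplus>\<^bsub>R\<^esub>x\<in>X. (c b x \<odot>\<^bsub>F\<^esub> x) u)"
        unfolding ring_mod_simps using bM xR dR c(1)[OF b] d(2)[OF _ b]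
        by (intro R.finsum_cong' refl) (auto simp: D_def dual_mod_simps(4) F_def free_mod_simps(4) R.m_comm)
      also have "\<dots> = w b u"
        using XF c(1)[OF b] F.smult_closed unfolding c(2)[OF b] F_def
        by (intro free_mod_finsum[OF cr(1) X(1), symmetric]) blast
      also have "\<dots> = u b" using u by (simp add: w_def)
      finally show ?thesis .
    qed
    moreover have "?s \<in> mod_hom R M (ring_mod R)" "u \<in> mod_hom R M (ring_mod R)"
      using s UD[OF u] unfolding D_def by (simp_all only: dual_mod_simps(1))
    ultimately have "u x = ?s x" if "x \<in> carrier M" for x
      using mod_hom_eq_on_basis[OF M(1) RM M(2), of u ?s x] that by simp
    then show ?thesis
      by (rule dual_eqI[OF UD[OF u, unfolded D_def] s[unfolded D_def], folded D_def])
  qed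

  have \<kappa>Q: "\<kappa> u \<in> carrier Q" if "u \<in> carrier D" for u using mod_homD(1)[OF \<kappa> that] by simp
  have \<kappa>u: "\<kappa> u = (\<Oplus>\<^bsub>Q\<^esub>x\<in>X. \<phi> (x u) \<odot>\<^bsub>Q\<^esub> \<kappa> (d x))" if u: "u \<in> U" for u
  proof -
    have t: "(\<lambda>x. x u \<odot>\<^bsub>D\<^esub> d x) \<in> X \<rightarrow> carrier D" using xR d(1) by auto
    have "\<kappa> u = \<kappa> (\<Oplus>\<^bsub>D\<^esub>x\<in>X. x u \<odot>\<^bsub>D\<^esub> d x)" using uD[OF u] by simp
    also have "\<dots> = (\<Oplus>\<^bsub>restrict_scalars \<phi> Q\<^esub>x\<in>X. \<kappa> (x u \<odot>\<^bsub>D\<^esub> d x))"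
      by (rule mod_hom_finsum[OF D restrict_scalars_module[OF Q \<phi>] \<kappa> X(1) t])
    also have "\<dots> = (\<Oplus>\<^bsub>Q\<^esub>x\<in>X. \<phi> (x u) \<odot>\<^bsub>Q\<^esub> \<kappa> (d x))"
      unfolding restrict_scalars_simps using xR d(1) \<kappa>Q ring_hom_closed[OF \<phi>]
      by (intro Q.M.finsum_cong' refl) (auto simp: mod_homD(3)[OF \<kappa>])
    finally show ?thesis .
  qed
  have "base_change_rels R R \<phi> D +>\<^bsub>P\<^esub> z = (\<Oplus>\<^bsub>Q\<^esub>u\<in>U. z u \<odot>\<^bsub>Q\<^esub> \<kappa> u)"
    using base_change_class[OF D \<phi>, of z] z unfolding P_def[symmetric] Q_def[symmetric] \<kappa>_def[symmetric]
    by (simp add: lin_comb_def U_def)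
  also have "\<dots> = (\<Oplus>\<^bsub>Q\<^esub>u\<in>U. \<Oplus>\<^bsub>Q\<^esub>x\<in>X. (z u \<otimes>\<^bsub>R\<^esub> \<phi> (x u)) \<odot>\<^bsub>Q\<^esub> \<kappa> (d x))"
  proof (intro Q.M.finsum_cong' refl)
    have cl: "\<phi> (x u) \<in> carrier R" "\<kappa> (d x) \<in> carrier Q" if "x \<in> X" for x u
      using that xR d(1) \<kappa>Q ring_hom_closed[OF \<phi>] by auto
    show "(\<lambda>u. \<Oplus>\<^bsub>Q\<^esub>x\<in>X. (z u \<otimes>\<^bsub>R\<^esub> \<phi> (x u)) \<odot>\<^bsub>Q\<^esub> \<kappa> (d x)) \<in> U \<rightarrow> carrier Q"
      using cl zR by (auto intro!: Q.M.finsum_closed)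
    fix u assume u: "u \<in> U"
    have "z u \<odot>\<^bsub>Q\<^esub> \<kappa> u = (\<Oplus>\<^bsub>Q\<^esub>x\<in>X. z u \<odot>\<^bsub>Q\<^esub> (\<phi> (x u) \<odot>\<^bsub>Q\<^esub> \<kappa> (d x)))"
      unfolding \<kappa>u[OF u] using cl zR by (intro Q.finsum_smult_ldistr X(1)) auto
    also have "\<dots> = (\<Oplus>\<^bsub>Q\<^esub>x\<in>X. (z u \<otimes>\<^bsub>R\<^esub> \<phi> (x u)) \<odot>\<^bsub>Q\<^esub> \<kappa> (d x))"
      using cl zR by (intro Q.M.finsum_cong' refl) (auto simp: Q.smult_assoc1)
    finally show "z u \<odot>\<^bsub>Q\<^esub> \<kappa> u = (\<Oplus>\<^bsub>Q\<^esub>x\<in>X. (z u \<otimes>\<^bsub>R\<^esub> \<phi> (x u)) \<odot>\<^bsub>Q\<^esub> \<kappa> (d x))" .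
  qed
  also have "\<dots> = (\<Oplus>\<^bsub>Q\<^esub>x\<in>X. \<Oplus>\<^bsub>Q\<^esub>u\<in>U. (z u \<otimes>\<^bsub>R\<^esub> \<phi> (x u)) \<odot>\<^bsub>Q\<^esub> \<kappa> (d x))"
    using xR d(1) \<kappa>Q ring_hom_closed[OF \<phi>] zR
    by (intro Q.M.finsum_swap finU X(1) Q.smult_closed) auto
  also have "\<dots> = (\<Oplus>\<^bsub>Q\<^esub>x\<in>X. \<zero>\<^bsub>Q\<^esub>)"
  proof (intro Q.M.finsum_cong' refl)
    fix x assume x: "x \<in> X"
    have zx: "z u \<otimes>\<^bsub>R\<^esub> \<phi> (x u) \<in> carrier R" for u using zR xR[OF x] ring_hom_closed[OF \<phi>] by auto
    have hom: "(\<lambda>a. a \<odot>\<^bsub>Q\<^esub> \<kappa> (d x)) \<in> mod_hom R (ring_mod R) Q"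
      using \<kappa>Q[OF d(1)[OF x]] by (auto simp: mod_hom_def Q.smult_l_distr Q.smult_assoc1)
    have "(\<Oplus>\<^bsub>Q\<^esub>u\<in>U. (z u \<otimes>\<^bsub>R\<^esub> \<phi> (x u)) \<odot>\<^bsub>Q\<^esub> \<kappa> (d x))
        = (\<Oplus>\<^bsub>ring_mod R\<^esub>u\<in>U. z u \<otimes>\<^bsub>R\<^esub> \<phi> (x u)) \<odot>\<^bsub>Q\<^esub> \<kappa> (d x)"
      using zx by (intro mod_hom_finsum[OF RM Q hom finU, symmetric]) auto
    also have "(\<Oplus>\<^bsub>ring_mod R\<^esub>u\<in>U. z u \<otimes>\<^bsub>R\<^esub> \<phi> (x u)) = \<zero>\<^bsub>R\<^esub>"
      using l_eq[of x] x X(2) by (auto simp: K_def N_def)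
    also have "\<zero>\<^bsub>R\<^esub> \<odot>\<^bsub>Q\<^esub> \<kappa> (d x) = \<zero>\<^bsub>Q\<^esub>" using \<kappa>Q[OF d(1)[OF x]] by simp
    finally show "(\<Oplus>\<^bsub>Q\<^esub>u\<in>U. (z u \<otimes>\<^bsub>R\<^esub> \<phi> (x u)) \<odot>\<^bsub>Q\<^esub> \<kappa> (d x)) = \<zero>\<^bsub>Q\<^esub>" .
  qed auto
  also have "\<dots> = \<zero>\<^bsub>Q\<^esub>" by simp
  finally have "base_change_rels R R \<phi> D +>\<^bsub>P\<^esub> z = \<zero>\<^bsub>Q\<^esub>" .
  moreover have "base_change_rels R R \<phi> D +>\<^bsub>P\<^esub> z
      = (base_change_rels R R \<phi> D +>\<^bsub>P\<^esub> y) \<ominus>\<^bsub>Q\<^esub> (base_change_rels R R \<phi> D +>\<^bsub>P\<^esub> y')"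
    unfolding z_def by (rule mod_hom_diff[OF P Q pr yP])
  ultimately have "base_change_rels R R \<phi> D +>\<^bsub>P\<^esub> y = base_change_rels R R \<phi> D +>\<^bsub>P\<^esub> y'"
    using Q.eq_of_diff_eq_zero[OF mod_homD(1)[OF pr yP(1)] mod_homD(1)[OF pr yP(2)]] by simp
  then show ?thesis unfolding P_def D_def .
qed

text \<open>
  The comparison map is surjective when \<open>\<phi>\<close> is module-finite: finitely many generators \<open>x\<close> work for all
  components at once, \<open>h(b) = \<Sum>\<^sub>x \<phi>(c\<^sub>b\<^sub>,\<^sub>x) x\<close>, so \<open>\<Sum>\<^sub>x x \<otimes> (c\<^sub>b\<^sub>,\<^sub>x)\<^sub>b\<close> is a preimage of \<open>h\<close>.
\<close>

lemma twisted_eval_surj: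
  assumes cr: "cring R" "\<one>\<^bsub>R\<^esub> \<noteq> \<zero>\<^bsub>R\<^esub>" and \<phi>: "\<phi> \<in> ring_hom R R" "module_finite_hom R R \<phi>"
    and M: "module R M" "is_basis R M B" and h: "h \<in> B \<rightarrow> carrier R"
  obtains z where "z \<in> carrier (free_mod R (carrier (dual_mod R M)))"
    "\<And>b. b \<in> B \<Longrightarrow> twisted_eval R \<phi> b z = h b"
proof -
  interpret R: cring R by fact
  have RM: "module R (ring_mod R)" by (rule ring_mod_module[OF cr(1)])
  define D where "D = dual_mod R M"
  define P where "P = free_mod R (carrier D)"
  have P: "module R P" unfolding P_def by (rule free_mod_module[OF cr(1)])
  interpret P: module R P by (rule P)
  have B: "B \<subseteq> carrier M" using M(2) by (simp add: is_basis_def)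
  obtain X where X: "finite X" "X \<subseteq> carrier R"
      "\<And>t. t \<in> carrier R \<Longrightarrow> \<exists>c\<in>X \<rightarrow> carrier R. t = (\<Oplus>\<^bsub>R\<^esub>x\<in>X. \<phi> (c x) \<otimes>\<^bsub>R\<^esub> x)"
    using \<phi>(2) unfolding module_finite_hom_def by blast
  have "\<forall>b\<in>B. \<exists>c. c \<in> X \<rightarrow> carrier R \<and> h b = (\<Oplus>\<^bsub>R\<^esub>x\<in>X. \<phi> (c x) \<otimes>\<^bsub>R\<^esub> x)"
    using X(3) h by blast
  from bchoice[OF this] obtain c where c: "b \<in> B \<Longrightarrow> c b \<in> X \<rightarrow> carrier R"
      "b \<in> B \<Longrightarrow> h b = (\<Oplus>\<^bsub>R\<^esub>x\<in>X. \<phi> (c b x) \<otimes>\<^bsub>R\<^esub> x)" for b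
    by blast
  have "\<forall>x\<in>X. \<exists>d. d \<in> carrier D \<and> (\<forall>b\<in>B. d b = c b x)"
  proof
    fix x assume "x \<in> X"
    then have "(\<lambda>b. c b x) \<in> B \<rightarrow> carrier R" using c(1) by auto
    then obtain d where "d \<in> carrier D" "\<And>b. b \<in> B \<Longrightarrow> d b = c b x"
      using dual_extend[OF M cr(2)] unfolding D_def by blast
    then show "\<exists>d. d \<in> carrier D \<and> (\<forall>b\<in>B. d b = c b x)" by blast
  qed
  from bchoice[OF this] obtain d
    where d: "x \<in> X \<Longrightarrow> d x \<in> carrier D" "x \<in> X \<Longrightarrow> b \<in> B \<Longrightarrow> d x b = c b x" for x b
    by blast
  define z where "z = (\<Oplus>\<^bsub>P\<^esub>x\<in>X. x \<odot>\<^bsub>P\<^esub> unit_vec R (d x))"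
  have uP: "unit_vec R (d x) \<in> carrier P" if "x \<in> X" for x
    unfolding P_def by (rule unit_vec_closed[OF cr(1) d(1)[OF that]])
  have t: "(\<lambda>x. x \<odot>\<^bsub>P\<^esub> unit_vec R (d x)) \<in> X \<rightarrow> carrier P" using uP X(2) by auto
  show ?thesis
  proof (rule that)
    show "z \<in> carrier (free_mod R (carrier (dual_mod R M)))"
      using P.M.finsum_closed[OF t] unfolding z_def P_def D_def .
    fix b assume b: "b \<in> B"
    then have bM: "b \<in> carrier M" using B by auto
    have te: "twisted_eval R \<phi> b \<in> mod_hom R P (ring_mod R)"
      unfolding P_def by (rule twisted_eval_mod_hom[OF cr(1) \<phi>(1) _ bM]) (simp add: D_def)
    have "twisted_eval R \<phi> b z = (\<Oplus>\<^bsub>ring_mod R\<^esub>x\<in>X. twisted_eval R \<phi> b (x \<odot>\<^bsub>P\<^esub> unit_vec R (d x)))"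
      unfolding z_def by (rule mod_hom_finsum[OF P RM te X(1) t])
    also have "\<dots> = (\<Oplus>\<^bsub>R\<^esub>x\<in>X. \<phi> (c b x) \<otimes>\<^bsub>R\<^esub> x)"
      unfolding ring_mod_simps
    proof (intro R.finsum_cong' refl)
      have cR: "c b x \<in> carrier R" "x \<in> carrier R" if "x \<in> X" for x using c(1)[OF b] that X(2) by auto
      then show "(\<lambda>x. \<phi> (c b x) \<otimes>\<^bsub>R\<^esub> x) \<in> X \<rightarrow> carrier R" using ring_hom_closed[OF \<phi>(1)] by auto
      fix x assume x: "x \<in> X"
      have "twisted_eval R \<phi> b (x \<odot>\<^bsub>P\<^esub> unit_vec R (d x)) = x \<otimes>\<^bsub>R\<^esub> twisted_eval R \<phi> b (unit_vec R (d x))"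
        using mod_homD(3)[OF te cR(2)[OF x] uP[OF x]] by simp
      also have "\<dots> = x \<otimes>\<^bsub>R\<^esub> \<phi> (d x b)"
        using twisted_eval_unit_vec[OF cr(1) \<phi>(1) cr(2) _ bM, of "d x"] d(1)[OF x] by (simp add: D_def)
      also have "\<dots> = \<phi> (c b x) \<otimes>\<^bsub>R\<^esub> x"
        using cR[OF x] ring_hom_closed[OF \<phi>(1)] by (simp add: d(2)[OF x b] R.m_comm)
      finally show "twisted_eval R \<phi> b (x \<odot>\<^bsub>P\<^esub> unit_vec R (d x)) = \<phi> (c b x) \<otimes>\<^bsub>R\<^esub> x" .
    qed
    finally show "twisted_eval R \<phi> b z = h b" unfolding c(2)[OF b] .
  qed
qed

section \<open>F-finite rings\<close>

lemma module_finite_hom_iff_span: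
  assumes "cring R" "\<phi> \<in> ring_hom R R"
  shows "module_finite_hom R R \<phi> \<longleftrightarrow>
    (\<exists>X. finite X \<and> X \<subseteq> carrier R \<and> carrier R \<subseteq> span R (restrict_scalars \<phi> (ring_mod R)) X)"
proof -
  have N: "module R (restrict_scalars \<phi> (ring_mod R))"
    by (rule restrict_scalars_module[OF ring_mod_module[OF assms(1)] assms(2)])
  have "(\<forall>t\<in>carrier R. \<exists>c\<in>X \<rightarrow> carrier R. t = (\<Oplus>\<^bsub>R\<^esub>x\<in>X. \<phi> (c x) \<otimes>\<^bsub>R\<^esub> x)) \<longleftrightarrow>
      carrier R \<subseteq> span R (restrict_scalars \<phi> (ring_mod R)) X"
    if "finite X" "X \<subseteq> carrier R" for X
    using span_finite_iff[OF N that(1)] that(2) by (simp add: subset_eq)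
  then show ?thesis unfolding module_finite_hom_def by (simp cong: conj_cong)
qed

text \<open>
  If elements \<open>x\<close> generate \<open>R\<close> over \<open>\<phi>\<close> and elements \<open>y\<close> generate \<open>R\<close> over \<open>\<psi>\<close>, then the products \<open>\<phi>(y) x\<close>
  generate \<open>R\<close> over the composition.  The latter enters as a third map \<open>\<chi>\<close>, since iterated Frobenius maps
  are compositions on the carrier of \<open>R\<close> only.
\<close>

lemma module_finite_hom_comp:
  assumes cr: "cring R" "\<one>\<^bsub>R\<^esub> \<noteq> \<zero>\<^bsub>R\<^esub>"
    and hom: "\<phi> \<in> ring_hom R R" "\<psi> \<in> ring_hom R R" "\<chi> \<in> ring_hom R R"
    and fin: "module_finite_hom R R \<phi>" "module_finite_hom R R \<psi>"
    and \<chi>: "\<And>r. r \<in> carrier R \<Longrightarrow> \<chi> r = \<phi> (\<psi> r)"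
  shows "module_finite_hom R R \<chi>"
proof -
  interpret R: cring R by fact
  interpret \<phi>: ring_hom_cring R R \<phi> by (intro ring_hom_cring.intro ring_hom_cring_axioms.intro hom cr)
  define N where "N = restrict_scalars \<chi> (ring_mod R)"
  have N: "module R N"
    unfolding N_def by (rule restrict_scalars_module[OF ring_mod_module[OF cr(1)] hom(3)])
  obtain X where X: "finite X" "X \<subseteq> carrier R"
      "\<And>t. t \<in> carrier R \<Longrightarrow> \<exists>c\<in>X \<rightarrow> carrier R. t = (\<Oplus>\<^bsub>R\<^esub>x\<in>X. \<phi> (c x) \<otimes>\<^bsub>R\<^esub> x)"
    using fin(1) unfolding module_finite_hom_def by blast
  obtain Y where Y: "finite Y" "Y \<subseteq> carrier R"
      "\<And>t. t \<in> carrier R \<Longrightarrow> \<exists>c\<in>Y \<rightarrow> carrier R. t = (\<Oplus>\<^bsub>R\<^esub>y\<in>Y. \<psi> (c y) \<otimes>\<^bsub>R\<^esub> y)"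
    using fin(2) unfolding module_finite_hom_def by blast
  define Z where "Z = (\<lambda>(x, y). \<phi> y \<otimes>\<^bsub>R\<^esub> x) ` (X \<times> Y)"
  have Z: "Z \<subseteq> carrier N" using X(2) Y(2) by (auto simp: Z_def N_def)
  have sp: "submodule (span R N Z) R N" by (rule span_submodule[OF N Z])
  have prod: "\<phi> t \<otimes>\<^bsub>R\<^esub> x \<in> span R N Z" if t: "t \<in> carrier R" and x: "x \<in> X" for t x
  proof -
    obtain c where c: "c \<in> Y \<rightarrow> carrier R" "t = (\<Oplus>\<^bsub>R\<^esub>y\<in>Y. \<psi> (c y) \<otimes>\<^bsub>R\<^esub> y)" using Y(3)[OF t] by blast
    have xR: "x \<in> carrier R" using x X(2) by auto
    have cY: "c y \<in> carrier R" "y \<in> carrier R" "\<psi> (c y) \<in> carrier R" if "y \<in> Y" for y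
      using that c(1) Y(2) ring_hom_closed[OF hom(2)] by auto
    have "\<phi> t \<otimes>\<^bsub>R\<^esub> x = (\<Oplus>\<^bsub>R\<^esub>y\<in>Y. \<phi> (\<psi> (c y) \<otimes>\<^bsub>R\<^esub> y)) \<otimes>\<^bsub>R\<^esub> x"
      unfolding c(2) using cY by (subst \<phi>.hom_finsum) (auto simp: comp_def)
    also have "\<dots> = (\<Oplus>\<^bsub>R\<^esub>y\<in>Y. \<phi> (\<psi> (c y) \<otimes>\<^bsub>R\<^esub> y) \<otimes>\<^bsub>R\<^esub> x)"
      using cY xR by (intro R.finsum_ldistr Y(1)) auto
    also have "\<dots> = (\<Oplus>\<^bsub>N\<^esub>y\<in>Y. c y \<odot>\<^bsub>N\<^esub> (\<phi> y \<otimes>\<^bsub>R\<^esub> x))"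
      unfolding N_def restrict_scalars_simps ring_mod_simps using cY xR
      by (intro R.finsum_cong' refl) (auto simp: \<chi> R.m_assoc)
    also have "\<dots> \<in> span R N Z"
    proof (intro submodule_finsum[OF N sp Y(1)] funcsetI submodule.smult_closed[OF sp])
      fix y assume y: "y \<in> Y"
      show "c y \<in> carrier R" by (rule cY(1)[OF y])
      show "\<phi> y \<otimes>\<^bsub>R\<^esub> x \<in> span R N Z"
        using x y span_superset[OF N Z cr(2)] by (auto simp: Z_def)
    qed
    finally show ?thesis .
  qed
  have "t \<in> span R N Z" if t: "t \<in> carrier R" for t
  proof -
    obtain c where c: "c \<in> X \<rightarrow> carrier R" "t = (\<Oplus>\<^bsub>N\<^esub>x\<in>X. \<phi> (c x) \<otimes>\<^bsub>R\<^esub> x)"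
      using X(3)[OF t] by (auto simp: N_def)
    show ?thesis unfolding c(2) using prod c(1) by (intro submodule_finsum[OF N sp X(1)]) auto
  qed
  moreover have "finite Z" unfolding Z_def using X(1) Y(1) by auto
  ultimately show ?thesis
    unfolding module_finite_hom_iff_span[OF cr(1) hom(3)] using Z unfolding N_def by auto
qed

lemma ring_hom_char_zero:
  assumes "ring R" "ring T" "\<iota> \<in> ring_hom R T" "[(n::nat)] \<cdot>\<^bsub>R\<^esub> \<one>\<^bsub>R\<^esub> = \<zero>\<^bsub>R\<^esub>"
  shows "[n] \<cdot>\<^bsub>T\<^esub> \<one>\<^bsub>T\<^esub> = \<zero>\<^bsub>T\<^esub>"
proof -
  interpret R: ring R by fact
  interpret T: ring T by fact
  have z: "\<iota> \<zero>\<^bsub>R\<^esub> = \<zero>\<^bsub>T\<^esub>" by (rule ring_hom_zero[OF assms(3,1,2)])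
  have "\<iota> ([k] \<cdot>\<^bsub>R\<^esub> \<one>\<^bsub>R\<^esub>) = [k] \<cdot>\<^bsub>T\<^esub> \<one>\<^bsub>T\<^esub>" for k :: nat
    by (induction k) (auto simp: z ring_hom_add[OF assms(3)] ring_hom_one[OF assms(3)])
  then show ?thesis using assms(4) z by metis
qed

text \<open>
  The extension \<open>R \<rightarrow> R\<^sup>1\<^sup>/\<^sup>p\<close> is a copy of the Frobenius endomorphism of \<open>R\<close>: the \<open>p\<close>-th power of an
  expression \<open>t = \<Sum>\<^sub>x c\<^sub>x x\<close> in \<open>R\<^sup>1\<^sup>/\<^sup>p\<close> is an expression \<open>t\<^sup>p = \<Sum>\<^sub>x c\<^sub>x\<^sup>p x\<^sup>p\<close> in \<open>R\<close>.
\<close>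

lemma F_finite_frob_1:
  assumes "cring R" "\<one>\<^bsub>R\<^esub> \<noteq> \<zero>\<^bsub>R\<^esub>" "prime p" "F_finite R p"
  shows "module_finite_hom R R (frob R p 1)"
proof -
  interpret R: cring R by fact
  have p0: "[p] \<cdot>\<^bsub>R\<^esub> \<one>\<^bsub>R\<^esub> = \<zero>\<^bsub>R\<^esub>" using assms(4) by (simp add: F_finite_def has_char_def)
  obtain T :: "'a ring" and \<iota> where T: "is_pth_root_ring R p T \<iota>" "module_finite_hom R T \<iota>"
    using assms(4) unfolding F_finite_def by blast
  have cT: "cring T" and \<iota>: "\<iota> \<in> ring_hom R T" and inj: "inj_on \<iota> (carrier R)"
    and pow: "\<And>t. t \<in> carrier T \<Longrightarrow> t [^]\<^bsub>T\<^esub> p \<in> \<iota> ` carrier R"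
    and root: "\<And>r. r \<in> carrier R \<Longrightarrow> \<exists>t\<in>carrier T. t [^]\<^bsub>T\<^esub> p = \<iota> r"
    using T(1) by (auto simp: is_pth_root_ring_def reduced_ring_def)
  interpret T: cring T by fact
  interpret \<iota>: ring_hom_cring R T \<iota> by (intro ring_hom_cring.intro ring_hom_cring_axioms.intro assms(1) cT \<iota>)
  have "frob T p 1 \<in> ring_hom T T"
    using ring_hom_char_zero[OF R.ring_axioms T.ring_axioms \<iota> p0] by (rule frob_ring_hom[OF cT assms(3)])
  then interpret \<sigma>: ring_hom_cring T T "frob T p 1" by (intro ring_hom_cring.intro ring_hom_cring_axioms.intro cT)
  have fh: "frob R p 1 \<in> ring_hom R R" by (rule frob_ring_hom[OF assms(1,3) p0])
  define N where "N = restrict_scalars (frob R p 1) (ring_mod R)"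
  have N: "module R N"
    unfolding N_def by (rule restrict_scalars_module[OF ring_mod_module[OF assms(1)] fh])
  obtain X where X: "finite X" "X \<subseteq> carrier T"
      "\<And>t. t \<in> carrier T \<Longrightarrow> \<exists>c\<in>X \<rightarrow> carrier R. t = (\<Oplus>\<^bsub>T\<^esub>x\<in>X. \<iota> (c x) \<otimes>\<^bsub>T\<^esub> x)"
    using T(2) unfolding module_finite_hom_def by blast
  have "\<forall>x\<in>X. \<exists>r. r \<in> carrier R \<and> \<iota> r = x [^]\<^bsub>T\<^esub> p"
  proof
    fix x assume "x \<in> X"
    then have "x [^]\<^bsub>T\<^esub> p \<in> \<iota> ` carrier R" using pow X(2) by blast
    then show "\<exists>r. r \<in> carrier R \<and> \<iota> r = x [^]\<^bsub>T\<^esub> p" by (elim imageE) auto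
  qed
  from bchoice[OF this] obtain r
    where r: "x \<in> X \<Longrightarrow> r x \<in> carrier R" "x \<in> X \<Longrightarrow> \<iota> (r x) = x [^]\<^bsub>T\<^esub> p" for x
    by blast
  have rX: "r ` X \<subseteq> carrier N" using r(1) by (auto simp: N_def)
  have sp: "submodule (span R N (r ` X)) R N" by (rule span_submodule[OF N rX])
  have "h \<in> span R N (r ` X)" if h: "h \<in> carrier R" for h
  proof -
    obtain t where t: "t \<in> carrier T" "t [^]\<^bsub>T\<^esub> p = \<iota> h" using root[OF h] by blast
    obtain c where c: "c \<in> X \<rightarrow> carrier R" "t = (\<Oplus>\<^bsub>T\<^esub>x\<in>X. \<iota> (c x) \<otimes>\<^bsub>T\<^esub> x)" using X(3)[OF t(1)] by blast
    have cX: "c x \<in> carrier R" "x \<in> carrier T" if "x \<in> X" for x using that c(1) X(2) by auto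
    have "\<iota> h = frob T p 1 t" using t(2) by (simp add: frob_def)
    also have "\<dots> = (\<Oplus>\<^bsub>T\<^esub>x\<in>X. frob T p 1 (\<iota> (c x) \<otimes>\<^bsub>T\<^esub> x))"
      unfolding c(2) using cX by (subst \<sigma>.hom_finsum) (auto simp: comp_def)
    also have "\<dots> = (\<Oplus>\<^bsub>T\<^esub>x\<in>X. \<iota> (c x [^]\<^bsub>R\<^esub> p \<otimes>\<^bsub>R\<^esub> r x))"
      using cX r by (intro T.finsum_cong' refl) (auto simp: frob_def T.nat_pow_distrib)
    also have "\<dots> = \<iota> (\<Oplus>\<^bsub>R\<^esub>x\<in>X. c x [^]\<^bsub>R\<^esub> p \<otimes>\<^bsub>R\<^esub> r x)"
      using cX r(1) by (subst \<iota>.hom_finsum) (auto simp: comp_def)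
    finally have "h = (\<Oplus>\<^bsub>R\<^esub>x\<in>X. c x [^]\<^bsub>R\<^esub> p \<otimes>\<^bsub>R\<^esub> r x)"
      using inj h cX r(1) by (elim inj_onD) (auto intro!: R.finsum_closed)
    also have "\<dots> = (\<Oplus>\<^bsub>N\<^esub>x\<in>X. c x \<odot>\<^bsub>N\<^esub> r x)" by (simp add: N_def frob_def)
    also have "\<dots> \<in> span R N (r ` X)"
    proof (intro submodule_finsum[OF N sp X(1)] funcsetI submodule.smult_closed[OF sp])
      fix x assume x: "x \<in> X"
      show "c x \<in> carrier R" by (rule cX(1)[OF x])
      show "r x \<in> span R N (r ` X)" using x span_superset[OF N rX assms(2)] by auto
    qed
    finally show ?thesis .
  qed
  then show ?thesis
    unfolding module_finite_hom_iff_span[OF assms(1) fh] N_def[symmetric]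
    using X(1) rX by (intro exI[of _ "r ` X"]) (auto simp: N_def)
qed

lemma F_finite_frob:
  assumes "cring R" "\<one>\<^bsub>R\<^esub> \<noteq> \<zero>\<^bsub>R\<^esub>" "prime p" "F_finite R p"
  shows "module_finite_hom R R (frob R p e)"
proof (induction e)
  interpret R: cring R by fact
  case 0
  have "\<exists>c\<in>{\<one>\<^bsub>R\<^esub>} \<rightarrow> carrier R. t = (\<Oplus>\<^bsub>R\<^esub>x\<in>{\<one>\<^bsub>R\<^esub>}. frob R p 0 (c x) \<otimes>\<^bsub>R\<^esub> x)" if "t \<in> carrier R" for t
    using that by (intro bexI[of _ "\<lambda>_. t"]) (auto simp: frob_def R.nat_pow_eone)
  then show ?case unfolding module_finite_hom_def by (intro exI[of _ "{\<one>\<^bsub>R\<^esub>}"]) auto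
next
  case (Suc e)
  have p0: "[p] \<cdot>\<^bsub>R\<^esub> \<one>\<^bsub>R\<^esub> = \<zero>\<^bsub>R\<^esub>" using assms(4) by (simp add: F_finite_def has_char_def)
  note fh = frob_ring_hom[OF assms(1,3) p0]
  show ?case
    by (rule module_finite_hom_comp[OF assms(1,2) fh fh fh Suc F_finite_frob_1[OF assms]])
       (rule frob_Suc(1)[OF assms(1)])
qed

section \<open>The image of the Frobenius functor of a submodule\<close>

lemma free_mod_mono: "N \<subseteq> N' \<Longrightarrow> carrier (free_mod R N) \<subseteq> carrier (free_mod R N')"
  by (force simp: free_mod_simps)

lemma free_mod_diff:
  assumes "cring R" "c \<in> carrier (free_mod R I)" "d \<in> carrier (free_mod R I)"
  shows "c \<ominus>\<^bsub>free_mod R I\<^esub> d = (\<lambda>i. c i \<ominus>\<^bsub>R\<^esub> d i)"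
proof
  fix i
  interpret R: cring R by fact
  have ev: "(\<lambda>c. c i) \<in> mod_hom R (free_mod R I) (ring_mod R)"
    by (auto simp: mod_hom_def free_mod_simps)
  show "(c \<ominus>\<^bsub>free_mod R I\<^esub> d) i = c i \<ominus>\<^bsub>R\<^esub> d i"
    using mod_hom_diff[OF free_mod_module[OF assms(1)] ring_mod_module[OF assms(1)] ev assms(2,3)]
    by (simp add: a_minus_def)
qed

text \<open>
  The relations of \<open>M\<close> between elements of \<open>N\<close> form a submodule that contains all generating relations
  of \<open>N\<close>.  This makes the map from the base change of \<open>N\<close> to that of \<open>M\<close> well defined.
\<close>

lemma base_change_rels_submodule_subset:
  assumes "module R M" "submodule N R M" "\<phi> \<in> ring_hom R R"
  shows "base_change_rels R R \<phi> (M\<lparr>carrier := N\<rparr>) \<subseteq> base_change_rels R R \<phi> M"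
proof -
  interpret module R M by fact
  note cr = R.cring_axioms
  have NM: "N \<subseteq> carrier M" using submoduleE(1)[OF assms(2)] .
  define P where "P = free_mod R (carrier M)"
  define P' where "P' = free_mod R N"
  have P: "module R P" and P': "module R P'" unfolding P_def P'_def by (rule free_mod_module[OF cr])+
  interpret P: module R P by (rule P)
  interpret P': module R P' by (rule P')
  have PP: "carrier P' \<subseteq> carrier P" unfolding P_def P'_def by (rule free_mod_mono[OF NM])
  have ops: "c \<oplus>\<^bsub>P'\<^esub> d = c \<oplus>\<^bsub>P\<^esub> d" "a \<odot>\<^bsub>P'\<^esub> c = a \<odot>\<^bsub>P\<^esub> c" "\<zero>\<^bsub>P'\<^esub> = \<zero>\<^bsub>P\<^esub>" for a c d
    by (simp_all add: P_def P'_def free_mod_simps)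
  have diff: "c \<ominus>\<^bsub>P'\<^esub> d = c \<ominus>\<^bsub>P\<^esub> d" if "c \<in> carrier P'" "d \<in> carrier P'" for c d
    using free_mod_diff[OF cr, of c N d] free_mod_diff[OF cr, of c "carrier M" d]
      that subsetD[OF PP that(1)] subsetD[OF PP that(2)]
    by (simp add: P_def P'_def)
  have u: "unit_vec R x \<in> carrier P'" if "x \<in> N" for x
    unfolding P'_def by (rule unit_vec_closed[OF cr that])
  define L where "L = base_change_rels R R \<phi> M"
  have L: "submodule L R P" unfolding L_def P_def by (rule base_change_rels_submodule[OF assms(1,3)])
  note LE = P.submoduleE[OF L]
  have sub: "submodule (L \<inter> carrier P') R P'"
  proof (rule P'.submoduleI)
    show "\<zero>\<^bsub>P'\<^esub> \<in> L \<inter> carrier P'"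
      using subgroup.one_closed[OF submodule.axioms(1)[OF L]] P'.M.zero_closed by (auto simp: ops)
  next
    fix c assume c: "c \<in> L \<inter> carrier P'"
    have "\<ominus>\<^bsub>P'\<^esub> c = \<zero>\<^bsub>P'\<^esub> \<ominus>\<^bsub>P'\<^esub> c" using c by (simp add: a_minus_def)
    also have "\<dots> = \<ominus>\<^bsub>P\<^esub> c"
      using c PP diff[OF P'.M.zero_closed, of c] by (auto simp: ops(3) a_minus_def subset_iff)
    finally show "\<ominus>\<^bsub>P'\<^esub> c \<in> L \<inter> carrier P'" using c LE(3)[of c] P'.M.a_inv_closed[of c] by simp
  next
    fix c d assume "c \<in> L \<inter> carrier P'" "d \<in> L \<inter> carrier P'"
    then show "c \<oplus>\<^bsub>P'\<^esub> d \<in> L \<inter> carrier P'"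
      using LE(5)[of c d] P'.M.a_closed[of c d] by (simp add: ops(1))
  next
    fix a c assume "a \<in> carrier R" "c \<in> L \<inter> carrier P'"
    then show "a \<odot>\<^bsub>P'\<^esub> c \<in> L \<inter> carrier P'"
      using LE(4)[of a c] P'.smult_closed[of a c] by (simp add: ops(2))
  qed auto
  have gens: "unit_vec R (x \<oplus>\<^bsub>M\<^esub> y) \<ominus>\<^bsub>P'\<^esub> (unit_vec R x \<oplus>\<^bsub>P'\<^esub> unit_vec R y) \<in> L \<inter> carrier P'"
    if xy: "x \<in> N" "y \<in> N" for x y
  proof
    have cl: "unit_vec R x \<oplus>\<^bsub>P'\<^esub> unit_vec R y \<in> carrier P'" "unit_vec R (x \<oplus>\<^bsub>M\<^esub> y) \<in> carrier P'"
      using u xy submoduleE(5)[OF assms(2)] by (auto intro!: P'.M.a_closed)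
    show "unit_vec R (x \<oplus>\<^bsub>M\<^esub> y) \<ominus>\<^bsub>P'\<^esub> (unit_vec R x \<oplus>\<^bsub>P'\<^esub> unit_vec R y) \<in> carrier P'"
      by (rule P'.M.minus_closed[OF cl(2,1)])
    show "unit_vec R (x \<oplus>\<^bsub>M\<^esub> y) \<ominus>\<^bsub>P'\<^esub> (unit_vec R x \<oplus>\<^bsub>P'\<^esub> unit_vec R y) \<in> L"
      unfolding diff[OF cl(2,1)] unfolding ops L_def P_def base_change_rels_def
      using xy NM by (intro subsetD[OF submod_gen_superset]) blast
  qed
  have gens': "unit_vec R (a \<odot>\<^bsub>M\<^esub> x) \<ominus>\<^bsub>P'\<^esub> (\<phi> a \<odot>\<^bsub>P'\<^esub> unit_vec R x) \<in> L \<inter> carrier P'"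
    if a: "a \<in> carrier R" and x: "x \<in> N" for a x
  proof
    have cl: "\<phi> a \<odot>\<^bsub>P'\<^esub> unit_vec R x \<in> carrier P'" "unit_vec R (a \<odot>\<^bsub>M\<^esub> x) \<in> carrier P'"
      using u x a submoduleE(4)[OF assms(2)] ring_hom_closed[OF assms(3)] by (auto intro!: P'.smult_closed)
    show "unit_vec R (a \<odot>\<^bsub>M\<^esub> x) \<ominus>\<^bsub>P'\<^esub> (\<phi> a \<odot>\<^bsub>P'\<^esub> unit_vec R x) \<in> carrier P'"
      by (rule P'.M.minus_closed[OF cl(2,1)])
    show "unit_vec R (a \<odot>\<^bsub>M\<^esub> x) \<ominus>\<^bsub>P'\<^esub> (\<phi> a \<odot>\<^bsub>P'\<^esub> unit_vec R x) \<in> L"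
      unfolding diff[OF cl(2,1)] unfolding ops L_def P_def base_change_rels_def
      using a x NM by (intro subsetD[OF submod_gen_superset]) blast
  qed
  have "base_change_rels R R \<phi> (M\<lparr>carrier := N\<rparr>) \<subseteq> L \<inter> carrier P'"
    unfolding base_change_rels_def
  proof (rule submod_gen_minimal)
    show "submodule (L \<inter> carrier P') R (free_mod R (carrier (M\<lparr>carrier := N\<rparr>)))"
      using sub by (simp add: P'_def)
  qed (use gens gens' in \<open>auto simp: P'_def\<close>)
  then show ?thesis by (auto simp: L_def)
qed

text \<open>
  The relations of \<open>N\<close> are relations of \<open>M\<close>, so enlarging a coset of the former by the latter gives the
  coset of the latter with the same representative.
\<close>

lemma frob_power_class:
  assumes "module R M" "submodule N R M" "frob R p e \<in> ring_hom R R" "y \<in> carrier (free_mod R N)"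
  shows "base_change_rels R R (frob R p e) M +>\<^bsub>free_mod R (carrier M)\<^esub> y \<in> frob_power R p e M N"
proof -
  interpret module R M by fact
  define P where "P = free_mod R (carrier M)"
  have P: "module R P" unfolding P_def by (rule free_mod_module[OF R.cring_axioms])
  interpret P: module R P by (rule P)
  define L where "L = base_change_rels R R (frob R p e) M"
  define L' where "L' = base_change_rels R R (frob R p e) (M\<lparr>carrier := N\<rparr>)"
  have L: "submodule L R P" unfolding L_def P_def by (rule base_change_rels_submodule[OF assms(1,3)])
  note LE = P.submoduleE[OF L]
  have N: "module R (M\<lparr>carrier := N\<rparr>)" by (rule submodule.submodule_is_module[OF assms(2,1)])
  have L': "submodule L' R (free_mod R N)"
    unfolding L'_def using base_change_rels_submodule[OF N assms(3)] by simp
  have L'L: "L' \<subseteq> L" unfolding L_def L'_def by (rule base_change_rels_submodule_subset[OF assms(1-3)])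
  have zero: "\<zero>\<^bsub>P\<^esub> \<in> L'"
    using subgroup.one_closed[OF submodule.axioms(1)[OF L']] by (simp add: P_def free_mod_simps)
  have yP: "y \<in> carrier P"
    unfolding P_def using assms(4) free_mod_mono[OF submoduleE(1)[OF assms(2)], of R] by blast
  have "L <+>\<^bsub>P\<^esub> (L' +>\<^bsub>P\<^esub> y) = L +>\<^bsub>P\<^esub> y"
  proof
    show "L <+>\<^bsub>P\<^esub> (L' +>\<^bsub>P\<^esub> y) \<subseteq> L +>\<^bsub>P\<^esub> y"
    proof
      fix v assume "v \<in> L <+>\<^bsub>P\<^esub> (L' +>\<^bsub>P\<^esub> y)"
      then obtain l l' where l: "l \<in> L" "l' \<in> L'" "v = l \<oplus>\<^bsub>P\<^esub> (l' \<oplus>\<^bsub>P\<^esub> y)"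
        by (auto simp: set_add_def' a_r_coset_def')
      have l': "l' \<in> L" using l(2) L'L by auto
      then have "v = (l \<oplus>\<^bsub>P\<^esub> l') \<oplus>\<^bsub>P\<^esub> y" using l yP LE(1) by (simp add: subset_iff P.M.a_assoc)
      then show "v \<in> L +>\<^bsub>P\<^esub> y" using LE(5)[OF l(1) l'] by (auto simp: a_r_coset_def')
    qed
    show "L +>\<^bsub>P\<^esub> y \<subseteq> L <+>\<^bsub>P\<^esub> (L' +>\<^bsub>P\<^esub> y)"
    proof
      fix v assume "v \<in> L +>\<^bsub>P\<^esub> y"
      then obtain l where l: "l \<in> L" "v = l \<oplus>\<^bsub>P\<^esub> y" by (auto simp: a_r_coset_def')
      then have "v = l \<oplus>\<^bsub>P\<^esub> (\<zero>\<^bsub>P\<^esub> \<oplus>\<^bsub>P\<^esub> y)" using yP by simp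
      then show "v \<in> L <+>\<^bsub>P\<^esub> (L' +>\<^bsub>P\<^esub> y)"
        using l(1) zero unfolding set_add_def' a_r_coset_def' by blast
    qed
  qed
  moreover have "L' +>\<^bsub>P\<^esub> y = L' +>\<^bsub>free_mod R N\<^esub> y"
    by (simp add: a_r_coset_def' P_def free_mod_simps)
  moreover have "L' +>\<^bsub>free_mod R N\<^esub> y \<in> carrier (frob_functor R p e (M\<lparr>carrier := N\<rparr>))"
    using assms(4) by (auto simp: frob_functor_def base_change_def quot_mod_def A_RCOSETS_def' L'_def)
  ultimately show ?thesis
    unfolding frob_power_def P_def[symmetric] L_def[symmetric] by (metis imageI)
qed

section \<open>Solid algebras are phantom extensions\<close>

lemma mod_hom_restrict_scalars:
  assumes "f \<in> mod_hom R M N" "\<phi> \<in> ring_hom R R"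
  shows "f \<in> mod_hom R (restrict_scalars \<phi> M) (restrict_scalars \<phi> N)"
  using assms(1) ring_hom_closed[OF assms(2)] by (auto simp: mod_hom_def)

lemma (in algebra) smult_pow:
  assumes "a \<in> carrier R" "x \<in> carrier M"
  shows "(a \<odot>\<^bsub>M\<^esub> x) [^]\<^bsub>M\<^esub> n = (a [^]\<^bsub>R\<^esub> n) \<odot>\<^bsub>M\<^esub> (x [^]\<^bsub>M\<^esub> (n :: nat))"
proof (induction n)
  case 0 then show ?case by simp
next
  case (Suc n)
  have cl: "x [^]\<^bsub>M\<^esub> n \<in> carrier M" "a [^]\<^bsub>R\<^esub> n \<in> carrier R"
    using assms M_cring by (auto intro: monoid.nat_pow_closed R.nat_pow_closed simp: cring.cring_simprules)
  have comm: "y \<otimes>\<^bsub>M\<^esub> z = z \<otimes>\<^bsub>M\<^esub> y" if "y \<in> carrier M" "z \<in> carrier M" for y z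
    using cring.cring_simprules(14)[OF M_cring that] .
  have "(a \<odot>\<^bsub>M\<^esub> x) [^]\<^bsub>M\<^esub> Suc n = ((a [^]\<^bsub>R\<^esub> n) \<odot>\<^bsub>M\<^esub> (x [^]\<^bsub>M\<^esub> n)) \<otimes>\<^bsub>M\<^esub> (a \<odot>\<^bsub>M\<^esub> x)"
    using Suc by simp
  also have "\<dots> = (a [^]\<^bsub>R\<^esub> n) \<odot>\<^bsub>M\<^esub> ((x [^]\<^bsub>M\<^esub> n) \<otimes>\<^bsub>M\<^esub> (a \<odot>\<^bsub>M\<^esub> x))"
    using cl assms by (intro smult_assoc2) auto
  also have "(x [^]\<^bsub>M\<^esub> n) \<otimes>\<^bsub>M\<^esub> (a \<odot>\<^bsub>M\<^esub> x) = a \<odot>\<^bsub>M\<^esub> (x \<otimes>\<^bsub>M\<^esub> (x [^]\<^bsub>M\<^esub> n))"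
    using cl assms comm[of "x [^]\<^bsub>M\<^esub> n" "a \<odot>\<^bsub>M\<^esub> x"] by (simp add: smult_assoc2)
  also have "x \<otimes>\<^bsub>M\<^esub> (x [^]\<^bsub>M\<^esub> n) = x [^]\<^bsub>M\<^esub> Suc n"
    using cl assms comm[of x "x [^]\<^bsub>M\<^esub> n"] by simp
  also have "(a [^]\<^bsub>R\<^esub> n) \<odot>\<^bsub>M\<^esub> (a \<odot>\<^bsub>M\<^esub> (x [^]\<^bsub>M\<^esub> Suc n)) = (a [^]\<^bsub>R\<^esub> Suc n) \<odot>\<^bsub>M\<^esub> (x [^]\<^bsub>M\<^esub> Suc n)"
    using cl assms cring.cring_simprules(5)[OF M_cring, of "x [^]\<^bsub>M\<^esub> n" x] by (simp add: smult_assoc1)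
  finally show ?case .
qed

lemma algebra_frob_mod_hom:
  assumes "algebra R S" "prime p" "[p] \<cdot>\<^bsub>R\<^esub> \<one>\<^bsub>R\<^esub> = \<zero>\<^bsub>R\<^esub>"
  shows "frob S p e \<in> mod_hom R S (restrict_scalars (frob R p e) S)"
proof -
  interpret algebra R S by fact
  have "structure_map S \<in> ring_hom R S"
    by (rule ring_hom_memI)
      (auto simp: structure_map_def smult_l_distr smult_assoc2 smult_assoc1)
  then have "[p] \<cdot>\<^bsub>S\<^esub> \<one>\<^bsub>S\<^esub> = \<zero>\<^bsub>S\<^esub>"
    using assms(3) by (rule ring_hom_char_zero[OF R.ring_axioms cring.axioms(1)[OF M_cring]])
  then have h: "frob S p e \<in> ring_hom S S" by (rule frob_ring_hom[OF M_cring assms(2)])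
  show ?thesis
    using ring_hom_closed[OF h] ring_hom_add[OF h]
    by (auto simp: mod_hom_def frob_def smult_pow)
qed

text \<open>
  A nonzero functional takes a nonzero value at some \<open>s\<close>; precomposing it with multiplication by \<open>s\<close>
  moves that value to \<open>1\<close>.
\<close>

lemma solid_algebra_retraction:
  assumes "algebra R S" "solid R S"
  obtains \<gamma> where "\<gamma> \<in> mod_hom R S (ring_mod R)" "\<gamma> \<one>\<^bsub>S\<^esub> \<noteq> \<zero>\<^bsub>R\<^esub>"
proof -
  interpret algebra R S by fact
  note S_comm = cring.cring_simprules(14)[OF M_cring]
  have z: "\<zero>\<^bsub>dual_mod R S\<^esub> \<in> carrier (dual_mod R S)"
    using abelian_monoid.zero_closed[OF abelian_group.axioms(1)[OF module.axioms(2)[OF dual_module[OF module]]]] .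
  then obtain f where f: "f \<in> carrier (dual_mod R S)" "f \<noteq> \<zero>\<^bsub>dual_mod R S\<^esub>"
    using assms(2) unfolding solid_def by blast
  then obtain s where s: "s \<in> carrier S" "f s \<noteq> \<zero>\<^bsub>R\<^esub>"
    using dual_eqI[OF f(1) z] by (auto simp: dual_mod_simps(2))
  show ?thesis
  proof (rule that)
    show "f (s \<otimes>\<^bsub>S\<^esub> \<one>\<^bsub>S\<^esub>) \<noteq> \<zero>\<^bsub>R\<^esub>" using s by simp
    have fh: "f \<in> mod_hom R S (ring_mod R)" using f(1) by (simp add: dual_mod_simps(1))
    have "(\<lambda>x. s \<otimes>\<^bsub>S\<^esub> x) \<in> mod_hom R S S" unfolding mod_hom_def
    proof (intro CollectI conjI ballI funcsetI)
      fix a x assume a: "a \<in> carrier R" and x: "x \<in> carrier S"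
      have "s \<otimes>\<^bsub>S\<^esub> (a \<odot>\<^bsub>S\<^esub> x) = (a \<odot>\<^bsub>S\<^esub> x) \<otimes>\<^bsub>S\<^esub> s" using s a x by (intro S_comm) auto
      also have "\<dots> = a \<odot>\<^bsub>S\<^esub> (x \<otimes>\<^bsub>S\<^esub> s)" using s a x by (intro smult_assoc2) auto
      also have "x \<otimes>\<^bsub>S\<^esub> s = s \<otimes>\<^bsub>S\<^esub> x" using s x by (intro S_comm) auto
      finally show "s \<otimes>\<^bsub>S\<^esub> (a \<odot>\<^bsub>S\<^esub> x) = a \<odot>\<^bsub>S\<^esub> (s \<otimes>\<^bsub>S\<^esub> x)" .
    qed (use s in \<open>auto simp: r_distr\<close>)
    then show "(\<lambda>x. f (s \<otimes>\<^bsub>S\<^esub> x)) \<in> mod_hom R S (ring_mod R)" using fh by (rule mod_hom_compose)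
  qed
qed

lemma dual_map_mod_hom:
  assumes "module R G" "\<nu> \<in> mod_hom R G F"
  shows "(\<lambda>h. compose (carrier G) h \<nu>) \<in> mod_hom R (dual_mod R F) (dual_mod R G)"
proof -
  interpret G: module R G by fact
  note \<nu> = mod_homD[OF assms(2)]
  have cl: "compose (carrier G) h \<nu> \<in> carrier (dual_mod R G)" if h: "h \<in> carrier (dual_mod R F)" for h
  proof -
    have "(\<lambda>x. h (\<nu> x)) \<in> mod_hom R G (ring_mod R)"
      using h by (intro mod_hom_compose[OF assms(2)]) (simp add: dual_mod_simps(1))
    then show ?thesis unfolding compose_def by (rule restrict_in_dual[OF assms(1)])
  qed
  show ?thesis unfolding mod_hom_def
    using cl \<nu>(1) by (auto simp: compose_def dual_mod_simps(3,4))
qed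

theorem theorem4p8:
  fixes R :: "'a ring" and \<mm> :: "'a set" and p :: nat and S :: "('a, 's) module"
  assumes "domain R"
    and "noetherian_local_ring R \<mm>"
    and "p > 0"
    and "has_char R p"
    and "F_finite R p"
    and "algebra R S"
    and "solid R S"
  shows "phantom_extension R p S (structure_map S)"
proof -
  interpret R: domain R by fact
  interpret S: algebra R S by fact
  have cr: "cring R" by (rule R.cring_axioms)
  have noeth: "noetherian_ring R" using assms(2) by (simp add: noetherian_local_ring_def)
  have nz: "\<one>\<^bsub>R\<^esub> \<noteq> \<zero>\<^bsub>R\<^esub>" by (rule R.one_not_zero)
  have pr: "prime p" by (rule has_char_prime[OF assms(1,3,4)])
  have p0: "[p] \<cdot>\<^bsub>R\<^esub> \<one>\<^bsub>R\<^esub> = \<zero>\<^bsub>R\<^esub>" using assms(4) by (simp add: has_char_def)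
  have RM: "module R (ring_mod R)" by (rule ring_mod_module[OF cr])
  have Sm: "module R S" by (rule S.module)
  note frob_hom = frob_ring_hom[OF cr pr p0]
  have \<alpha>: "structure_map S \<in> mod_hom R (ring_mod R) S"
    by (auto simp: mod_hom_def structure_map_def S.smult_l_distr S.smult_assoc1)
  obtain \<gamma> where \<gamma>: "\<gamma> \<in> mod_hom R S (ring_mod R)" "\<gamma> \<one>\<^bsub>S\<^esub> \<noteq> \<zero>\<^bsub>R\<^esub>"
    by (rule solid_algebra_retraction[OF assms(6,7)])
  have \<gamma>1: "\<gamma> \<one>\<^bsub>S\<^esub> \<in> carrier R" using mod_homD(1)[OF \<gamma>(1), of "\<one>\<^bsub>S\<^esub>"] by simp
  have \<gamma>\<alpha>: "\<gamma> (r \<odot>\<^bsub>S\<^esub> \<one>\<^bsub>S\<^esub>) = r \<otimes>\<^bsub>R\<^esub> \<gamma> \<one>\<^bsub>S\<^esub>" if "r \<in> carrier R" for r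
    using mod_homD(3)[OF \<gamma>(1) that, of "\<one>\<^bsub>S\<^esub>"] by simp
  have inj: "inj_on (structure_map S) (carrier R)"
  proof (rule inj_onI)
    fix r r' assume r: "r \<in> carrier R" "r' \<in> carrier R" "structure_map S r = structure_map S r'"
    then have "r \<otimes>\<^bsub>R\<^esub> \<gamma> \<one>\<^bsub>S\<^esub> = r' \<otimes>\<^bsub>R\<^esub> \<gamma> \<one>\<^bsub>S\<^esub>"
      using \<gamma>\<alpha>[OF r(1)] \<gamma>\<alpha>[OF r(2)] by (simp add: structure_map_def)
    then show "r = r'" using R.m_rcancel[OF \<gamma>(2) \<gamma>1 r(1,2)] by simp
  qed
  have im: "submodule (structure_map S ` carrier R) R S"
    using image_submodule[OF RM Sm \<alpha>] by simp
  have "(\<lambda>g\<in>carrier G. inv_into (carrier R) (structure_map S) (\<mu>' (\<nu> g)))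
      \<in> tight_closure R p (dual_mod R G) ((\<lambda>h. compose (carrier G) h \<nu>) ` carrier (dual_mod R F))"
    if pres: "free_presentation R (quot_mod S (structure_map S ` carrier R)) F G \<mu> \<nu>"
      and \<mu>': "\<mu>' \<in> mod_hom R F S"
      and lift: "\<forall>x\<in>carrier F. (structure_map S ` carrier R) +>\<^bsub>S\<^esub> \<mu>' x = \<mu> x"
    for F :: "('a, 's \<Rightarrow> 'a) module" and G :: "('a, ('s \<Rightarrow> 'a) \<Rightarrow> 'a) module" and \<mu> \<nu> \<mu>'
  proof -
    obtain BF BG where F: "module R F" "is_basis R F BF" and G: "module R G" "is_basis R G BG"
      using pres by (auto simp: free_presentation_def free_module_def)
    have \<nu>: "\<nu> \<in> mod_hom R G F" and ker: "\<nu> ` carrier G = {x \<in> carrier F. \<mu> x = structure_map S ` carrier R}"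
      using pres by (auto simp: free_presentation_def quot_mod_def)
    note \<nu>G = mod_homD(1)[OF \<nu>]
    define D where "D = dual_mod R G"
    have D: "module R D" unfolding D_def by (rule dual_module[OF G(1)])
    interpret D: module R D by (rule D)
    define N where "N = (\<lambda>h. compose (carrier G) h \<nu>) ` carrier (dual_mod R F)"
    note \<nu>d = dual_map_mod_hom[OF G(1) \<nu>]
    have N: "submodule N R D"
      unfolding N_def D_def by (rule image_submodule[OF dual_module[OF F(1)] dual_module[OF G(1)] \<nu>d])
    have ND: "N \<subseteq> carrier D" using D.submoduleE(1)[OF N] .

    \<comment> \<open>Exactness at \<open>F\<close> puts \<open>\<mu>'(\<nu>(g))\<close> into the image of \<open>\<alpha>\<close>, so the chosen preimage is a true one.\<close>
    define t where "t = (\<lambda>g\<in>carrier G. inv_into (carrier R) (structure_map S) (\<mu>' (\<nu> g)))"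
    have t: "t g \<in> carrier R" "t g \<odot>\<^bsub>S\<^esub> \<one>\<^bsub>S\<^esub> = \<mu>' (\<nu> g)" if g: "g \<in> carrier G" for g
    proof -
      have "\<nu> g \<in> {x \<in> carrier F. \<mu> x = structure_map S ` carrier R}" using g ker by blast
      then have "(structure_map S ` carrier R) +>\<^bsub>S\<^esub> \<mu>' (\<nu> g) = structure_map S ` carrier R"
        using lift by auto
      then have "\<mu>' (\<nu> g) \<in> structure_map S ` carrier R"
        using quot_proj_eq_zero_iff[OF Sm im mod_homD(1)[OF \<mu>' \<nu>G[OF g]]] by simp
      then show "t g \<in> carrier R" "t g \<odot>\<^bsub>S\<^esub> \<one>\<^bsub>S\<^esub> = \<mu>' (\<nu> g)"
        using g inv_into_into[of "\<mu>' (\<nu> g)" "structure_map S" "carrier R"]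
          f_inv_into_f[of "\<mu>' (\<nu> g)" "structure_map S" "carrier R"]
        by (simp_all add: t_def structure_map_def)
    qed
    have tD: "t \<in> carrier D"
    proof -
      have inj': "r = r'" if "r \<in> carrier R" "r' \<in> carrier R" "r \<odot>\<^bsub>S\<^esub> \<one>\<^bsub>S\<^esub> = r' \<odot>\<^bsub>S\<^esub> \<one>\<^bsub>S\<^esub>" for r r'
        using inj_onD[OF inj _ that(1,2)] that(3) by (simp add: structure_map_def)
      interpret G: module R G by (rule G(1))
      have "t \<in> mod_hom R G (ring_mod R)" unfolding mod_hom_def ring_mod_simps
      proof (intro CollectI conjI ballI funcsetI)
        fix g assume g: "g \<in> carrier G"
        show "t g \<in> carrier R" by (rule t(1)[OF g])
        fix g' assume g': "g' \<in> carrier G"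
        have "t (g \<oplus>\<^bsub>G\<^esub> g') \<odot>\<^bsub>S\<^esub> \<one>\<^bsub>S\<^esub> = (t g \<oplus>\<^bsub>R\<^esub> t g') \<odot>\<^bsub>S\<^esub> \<one>\<^bsub>S\<^esub>"
          using g g' t[OF g] t[OF g'] t(2)[of "g \<oplus>\<^bsub>G\<^esub> g'"] mod_homD(2)[OF \<nu> g g']
            mod_homD(2)[OF \<mu>' \<nu>G[OF g] \<nu>G[OF g']]
          by (simp add: S.smult_l_distr)
        then show "t (g \<oplus>\<^bsub>G\<^esub> g') = t g \<oplus>\<^bsub>R\<^esub> t g'"
          using t(1) g g' by (intro inj') auto
      next
        fix a g assume a: "a \<in> carrier R" and g: "g \<in> carrier G"
        have "t (a \<odot>\<^bsub>G\<^esub> g) \<odot>\<^bsub>S\<^esub> \<one>\<^bsub>S\<^esub> = (a \<otimes>\<^bsub>R\<^esub> t g) \<odot>\<^bsub>S\<^esub> \<one>\<^bsub>S\<^esub>"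
          using a g t[OF g] t(2)[of "a \<odot>\<^bsub>G\<^esub> g"] mod_homD(3)[OF \<nu> a g] mod_homD(3)[OF \<mu>' a \<nu>G[OF g]]
          by (simp add: S.smult_assoc1)
        then show "t (a \<odot>\<^bsub>G\<^esub> g) = a \<otimes>\<^bsub>R\<^esub> t g"
          using t(1) a g by (intro inj') auto
      qed
      then show ?thesis by (simp add: D_def dual_mod_simps(1) t_def)
    qed

    have "\<gamma> \<one>\<^bsub>S\<^esub> \<odot>\<^bsub>frob_functor R p e D\<^esub> frob_elt R p e D t \<in> frob_power R p e D N" for e
    proof -
      define \<phi> where "\<phi> = frob R p e"
      have \<phi>: "\<phi> \<in> ring_hom R R" unfolding \<phi>_def by (rule frob_hom)
      define \<sigma> where "\<sigma> = frob S p e"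
      have \<sigma>: "\<sigma> \<in> mod_hom R S (restrict_scalars \<phi> S)"
        unfolding \<sigma>_def \<phi>_def by (rule algebra_frob_mod_hom[OF assms(6) pr p0])
      \<comment> \<open>The semilinear map \<open>x \<mapsto> \<gamma>((\<mu>'(x))\<^sup>q)\<close> on \<open>F\<close> comes from the base change of the dual of \<open>F\<close>.\<close>
      have h: "(\<lambda>x. \<gamma> (\<sigma> (\<mu>' x))) \<in> mod_hom R F (restrict_scalars \<phi> (ring_mod R))"
        by (rule mod_hom_compose[OF mod_hom_compose[OF \<mu>' \<sigma>] mod_hom_restrict_scalars[OF \<gamma>(1) \<phi>]])
      have BF: "BF \<subseteq> carrier F" and BG: "BG \<subseteq> carrier G" using F(2) G(2) by (auto simp: is_basis_def)
      have "(\<lambda>x. \<gamma> (\<sigma> (\<mu>' x))) \<in> BF \<rightarrow> carrier R" using mod_homD(1)[OF h] BF by auto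
      then obtain z where z: "z \<in> carrier (free_mod R (carrier (dual_mod R F)))"
          "\<And>b. b \<in> BF \<Longrightarrow> twisted_eval R \<phi> b z = \<gamma> (\<sigma> (\<mu>' b))"
        using twisted_eval_surj[OF cr nz \<phi> _ F] F_finite_frob[OF cr nz pr assms(5), of e]
        unfolding \<phi>_def by blast
      have ev_z: "twisted_eval R \<phi> x z = \<gamma> (\<sigma> (\<mu>' x))" if "x \<in> carrier F" for x
        by (rule mod_hom_eq_on_basis[OF F(1) restrict_scalars_module[OF RM \<phi>] F(2)
              twisted_eval_semilinear[OF cr \<phi> z(1)] h z(2) that])

      \<comment> \<open>Transport \<open>z\<close> along the dual of \<open>\<nu>\<close>; the result lives on functionals in the image \<open>N\<close>.\<close>
      define y where "y = lin_comb R (free_mod R N) (\<lambda>u. unit_vec R (compose (carrier G) u \<nu>)) z"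
      have FN: "module R (free_mod R N)" by (rule free_mod_module[OF cr])
      have uN: "(\<lambda>u. unit_vec R (compose (carrier G) u \<nu>)) \<in> carrier (dual_mod R F) \<rightarrow> carrier (free_mod R N)"
        by (intro funcsetI unit_vec_closed[OF cr]) (simp add: N_def)
      have yN: "y \<in> carrier (free_mod R N)"
        unfolding y_def by (rule mod_homD(1)[OF lin_comb_mod_hom[OF FN uN] z(1)])
      have yD: "y \<in> carrier (free_mod R (carrier D))" using yN free_mod_mono[OF ND] by blast
      have ev_y: "twisted_eval R \<phi> g y = twisted_eval R \<phi> (\<nu> g) z" if g: "g \<in> carrier G" for g
      proof -
        have te: "twisted_eval R \<phi> g \<in> mod_hom R (free_mod R N) (ring_mod R)"
          using twisted_eval_mod_hom[OF cr \<phi> _ g] ND by (simp add: D_def)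
        have "twisted_eval R \<phi> g y
            = lin_comb R (ring_mod R) (\<lambda>u. twisted_eval R \<phi> g (unit_vec R (compose (carrier G) u \<nu>))) z"
          unfolding y_def by (rule mod_hom_lin_comb[OF FN RM te z(1) uN])
        also have "\<dots> = lin_comb R (ring_mod R) (\<lambda>u. \<phi> (u (\<nu> g))) z"
        proof (rule lin_comb_cong[OF RM z(1)])
          show "(\<lambda>u. \<phi> (u (\<nu> g))) \<in> carrier (dual_mod R F) \<rightarrow> carrier (ring_mod R)"
            using ring_hom_closed[OF \<phi> dual_apply_closed[OF _ \<nu>G[OF g]]] by auto
          fix u assume u: "u \<in> carrier (dual_mod R F)"
          show "twisted_eval R \<phi> g (unit_vec R (compose (carrier G) u \<nu>)) = \<phi> (u (\<nu> g))"
            using twisted_eval_unit_vec[OF cr \<phi> nz mod_homD(1)[OF \<nu>d u] g] g by (simp add: compose_def)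
        qed
        finally show ?thesis by (simp add: twisted_eval_def)
      qed

      \<comment> \<open>Both \<open>c \<otimes> t\<close> and \<open>y\<close> have the component \<open>\<gamma>((\<mu>'(\<nu>(g)))\<^sup>q)\<close> at \<open>g\<close>.\<close>
      define c where "c = \<gamma> \<one>\<^bsub>S\<^esub>"
      have cR: "c \<in> carrier R" using \<gamma>1 by (simp add: c_def)
      define P where "P = free_mod R (carrier D)"
      have P: "module R P" unfolding P_def by (rule free_mod_module[OF cr])
      have tP: "unit_vec R t \<in> carrier P" unfolding P_def by (rule unit_vec_closed[OF cr tD])
      have ctP: "c \<odot>\<^bsub>P\<^esub> unit_vec R t \<in> carrier P" by (rule module.smult_closed[OF P cR tP])
      have "twisted_eval R \<phi> g (c \<odot>\<^bsub>P\<^esub> unit_vec R t) = twisted_eval R \<phi> g y" if g: "g \<in> BG" for g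
      proof -
        have gG: "g \<in> carrier G" using g BG by auto
        have te: "twisted_eval R \<phi> g \<in> mod_hom R P (ring_mod R)"
          unfolding P_def by (rule twisted_eval_mod_hom[OF cr \<phi> _ gG]) (simp add: D_def)
        have \<phi>t: "\<phi> (t g) \<in> carrier R" by (rule ring_hom_closed[OF \<phi> t(1)[OF gG]])
        have "twisted_eval R \<phi> g (c \<odot>\<^bsub>P\<^esub> unit_vec R t) = c \<otimes>\<^bsub>R\<^esub> twisted_eval R \<phi> g (unit_vec R t)"
          using mod_homD(3)[OF te cR tP] by simp
        also have "\<dots> = c \<otimes>\<^bsub>R\<^esub> \<phi> (t g)"
          using twisted_eval_unit_vec[OF cr \<phi> nz tD[unfolded D_def] gG] by simp
        also have "\<dots> = \<phi> (t g) \<otimes>\<^bsub>R\<^esub> \<gamma> \<one>\<^bsub>S\<^esub>" using cR \<phi>t by (simp add: c_def R.m_comm)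
        also have "\<dots> = \<gamma> (\<phi> (t g) \<odot>\<^bsub>S\<^esub> \<one>\<^bsub>S\<^esub>)" by (rule \<gamma>\<alpha>[OF \<phi>t, symmetric])
        also have "\<phi> (t g) \<odot>\<^bsub>S\<^esub> \<one>\<^bsub>S\<^esub> = \<sigma> (t g \<odot>\<^bsub>S\<^esub> \<one>\<^bsub>S\<^esub>)"
        proof -
          interpret S': cring S by (rule S.M_cring)
          have "\<sigma> \<one>\<^bsub>S\<^esub> = \<one>\<^bsub>S\<^esub>" by (simp add: \<sigma>_def frob_def)
          then show ?thesis using mod_homD(3)[OF \<sigma> t(1)[OF gG], of "\<one>\<^bsub>S\<^esub>"] by simp
        qed
        also have "t g \<odot>\<^bsub>S\<^esub> \<one>\<^bsub>S\<^esub> = \<mu>' (\<nu> g)" by (rule t(2)[OF gG])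
        also have "\<gamma> (\<sigma> (\<mu>' (\<nu> g))) = twisted_eval R \<phi> (\<nu> g) z" by (rule ev_z[OF \<nu>G[OF gG], symmetric])
        also have "\<dots> = twisted_eval R \<phi> g y" by (rule ev_y[OF gG, symmetric])
        finally show ?thesis .
      qed
      then have "base_change_rels R R \<phi> D +>\<^bsub>P\<^esub> (c \<odot>\<^bsub>P\<^esub> unit_vec R t) = base_change_rels R R \<phi> D +>\<^bsub>P\<^esub> y"
        unfolding P_def D_def
        using ctP yD by (intro base_change_dual_eqI[OF cr noeth nz \<phi> G]) (simp_all add: P_def D_def)
      also have "\<dots> \<in> frob_power R p e D N"
        unfolding \<phi>_def P_def by (rule frob_power_class[OF D N frob_hom yN])
      also have "base_change_rels R R \<phi> D +>\<^bsub>P\<^esub> (c \<odot>\<^bsub>P\<^esub> unit_vec R t)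
          = c \<odot>\<^bsub>base_change R R \<phi> D\<^esub> (base_change_rels R R \<phi> D +>\<^bsub>P\<^esub> unit_vec R t)"
        using mod_homD(3)[OF base_change_proj_mod_hom[OF D \<phi>] cR tP[unfolded P_def]] unfolding P_def .
      finally show ?thesis
        unfolding frob_functor_def frob_elt_def P_def \<phi>_def c_def .
    qed
    then show ?thesis
      using tD \<gamma>1 \<gamma>(2) unfolding tight_closure_def t_def[symmetric] D_def[symmetric] N_def[symmetric] by blast
  qed
  then show ?thesis unfolding phantom_extension_def using \<alpha> inj by blast
qed

end
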